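(* Let $\Omega\subset\mathbb{H}$ be a circular domain and let $f\in\mathcal{SEM}(\Omega)\setminus\mathcal{SEM}_{\mathbb{R}}(\Omega)$. Then $f$ is equivalent (in the sense of $\simeq$) to a one-slice preserving function $g\in\mathcal{SEM}(\Omega)\setminus\mathcal{SEM}_{\mathbb{R}}(\Omega)$ if and only if $f_v^s\not\equiv 0$ and $f_v^s$ has a square root in $\mathcal{SEM}_{\mathbb{R}}(\Omega)$. Moreover, all idempotents in $\mathcal{SR}(\Omega)$ are equivalent.
   Context: $\mathbb{H}$ denotes the quaternions, $q^c$ the quaternionic conjugate, $\mathbb{S}=\{q\in\mathbb{H}: q^2=-1\}$, and $\mathbb{C}_I=\mathbb{R}+I\mathbb{R}$ for $I\in\mathbb{S}$. For $q=x+Iy$ put $\mathbb{S}_q=\{x+Jy: J\in\mathbb{S}\}$. A domain (connected open set) $\Omega\subset\mathbb{H}$ is circular if $\mathbb{S}_q\subset\Omega$ for all $q\in\Omega$. A function $f$ on a circular open set $\Omega$ is slice regular ($f\in\mathcal{SR}(\Omega)$) if $f(x+Iy)=F_1(x,y)+IF_2(x,y)$ for all $x+Iy\in\Omega$ ($x,y\in\mathbb{R}$, $I\in\mathbb{S}$), with $\mathbb{H}$-valued $F_1$ even in $y$ and $F_2$ odd in $y$, and each restriction $f|_{\Omega\cap\mathbb{C}_I}$ is real differentiable with $\frac12(\partial_x+I\partial_y)f|_{\Omega\cap\mathbb{C}_I}\equiv0$. The $*$-product is $(f*g)(q)=0$ if $f(q)=0$ and $(f*g)(q)=f(q)\,g(f(q)^{-1}qf(q))$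 otherwise. $f$ is slice preserving if $f(\Omega\cap\mathbb{C}_I)\subset\mathbb{C}_I$ for every $I\in\mathbb{S}$, and one-slice preserving if $f(\Omega\cap\mathbb{C}_I)\subset\mathbb{C}_I$ for some $I\in\mathbb{S}$ (for semi-regular $f$, where defined). A function $f$ is slice semi-regular on $\Omega$ ($f\in\mathcal{SEM}(\Omega)$) if there is a circular open $\widetilde\Omega\subseteq\Omega$ with $f\in\mathcal{SR}(\widetilde\Omega)$ and each point of $\Omega\setminus\widetilde\Omega$ is a pole or a removable singularity; i.e. $\Omega\setminus\widetilde\Omega$ consists of isolated real points and isolated spheres $\mathbb{S}_p$, near each of which $\Delta_p^m f$ extends slice regularly for some integer $m\ge0$, where $\Delta_p(q)=q^2-2\mathrm{Re}(p)q+|p|^2$. Functions agreeing where both are defined are identified. $\mathcal{SEM}_{\mathbb{R}}(\Omega)$ is the subset of slice preserving elements; it is a field and the center of the algebra $(\mathcal{SEM}(\Omega),+,* )$, which is a 4-dimensional vector space over it: for an orthonormal basis $(1,I,J,K)$ of $\mathbb{H}$, each $f$ is uniquely $f_0+f_1I+f_2J+f_3K$ with $f_\ell\in\mathcal{SEM}_{\mathbb{R}}(\Omega)$. Set $f^c=f_0-(f_1I+f_2J+f_3K)$, $f^s=f*f^c=f_0^2+f_1^2+f_2^2+f_3^2$, $f_0=(f+f^c)/2$, $f_v=f-f_0$, so $f_v^s=(f_v)^s=f_1^2+f_2^2+f_3^2$. $f$ is $*$-invertible iff $f^s\not\equiv0$, with $f^{-*}=(f^s)^{-1}f^c$. An idempotent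 is $\sigma\not\equiv0,1$ with $\sigma*\sigma=\sigma$. We write $f\simeq g$ ($f$ and $g$ are equivalent) if there is a $*$-invertible $h\in\mathcal{SEM}(\Omega)$ with $f=h^{-*}*g*h$. *)

theory Defs
  imports "HOL-Analysis.Analysis"
begin

section \<open>Quaternions\<close>

datatype quat = Quat (qRe: real) (qI: real) (qJ: real) (qK: real)

lemma quat_eq_iff: "a = b \<longleftrightarrow> qRe a = qRe b \<and> qI a = qI b \<and> qJ a = qJ b \<and> qK a = qK b"
  by (cases a; cases b) auto

instantiation quat :: ring_1
begin
definition "0 = Quat 0 0 0 0"
definition "1 = Quat 1 0 0 0"
definition "- a = Quat (- qRe a) (- qI a) (- qJ a) (- qK a)"
definition "a + b = Quat (qRe a + qRe b) (qI a + qI b) (qJ a + qJ b) (qK a + qK b)"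
definition "(a :: quat) - b = Quat (qRe a - qRe b) (qI a - qI b) (qJ a - qJ b) (qK a - qK b)"
definition "a * b = Quat
    (qRe a * qRe b - qI a * qI b - qJ a * qJ b - qK a * qK b)
    (qRe a * qI b + qI a * qRe b + qJ a * qK b - qK a * qJ b)
    (qRe a * qJ b - qI a * qK b + qJ a * qRe b + qK a * qI b)
    (qRe a * qK b + qI a * qJ b - qJ a * qI b + qK a * qRe b)"
instance
  by standard
    (simp_all add: quat_eq_iff zero_quat_def one_quat_def uminus_quat_def plus_quat_def
      minus_quat_def times_quat_def algebra_simps)
end

instantiation quat :: real_algebra_1
begin
definition "scaleR r a = Quat (r * qRe a) (r * qI a) (r * qJ a) (r * qK a)"
instance
  by standard
    (simp_all add: quat_eq_iff scaleR_quat_def plus_quat_def times_quat_def algebra_simps)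
end

lemma quat_simps [simp]:
  "qRe 0 = 0" "qI 0 = 0" "qJ 0 = 0" "qK 0 = 0"
  "qRe 1 = 1" "qI 1 = 0" "qJ 1 = 0" "qK 1 = 0"
  "qRe (- a) = - qRe a" "qI (- a) = - qI a" "qJ (- a) = - qJ a" "qK (- a) = - qK a"
  "qRe (a + b) = qRe a + qRe b" "qI (a + b) = qI a + qI b"
  "qJ (a + b) = qJ a + qJ b" "qK (a + b) = qK a + qK b"
  "qRe (a - b) = qRe a - qRe b" "qI (a - b) = qI a - qI b"
  "qJ (a - b) = qJ a - qJ b" "qK (a - b) = qK a - qK b"
  "qRe (r *\<^sub>R a) = r * qRe a" "qI (r *\<^sub>R a) = r * qI a"
  "qJ (r *\<^sub>R a) = r * qJ a" "qK (r *\<^sub>R a) = r * qK a"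
  "qRe (a * b) = qRe a * qRe b - qI a * qI b - qJ a * qJ b - qK a * qK b"
  "qI (a * b) = qRe a * qI b + qI a * qRe b + qJ a * qK b - qK a * qJ b"
  "qJ (a * b) = qRe a * qJ b - qI a * qK b + qJ a * qRe b + qK a * qI b"
  "qK (a * b) = qRe a * qK b + qI a * qJ b - qJ a * qI b + qK a * qRe b"
  by (simp_all add: zero_quat_def one_quat_def uminus_quat_def plus_quat_def
      minus_quat_def times_quat_def scaleR_quat_def)

lemma quat_of_real_simps [simp]:
  "qRe (of_real r) = r" "qI (of_real r) = 0" "qJ (of_real r) = 0" "qK (of_real r) = 0"
  by (simp_all add: of_real_def)

lemma quat_numeral_simps [simp]:
  "qRe (numeral n) = numeral n" "qI (numeral n) = 0" "qJ (numeral n) = 0" "qK (numeral n) = 0"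
  using quat_of_real_simps[of "numeral n"] by simp_all

instantiation quat :: real_inner
begin
definition "inner a b = qRe a * qRe b + qI a * qI b + qJ a * qJ b + qK a * qK b"
definition "norm (a :: quat) = sqrt (inner a a)"
definition "sgn (a :: quat) = a /\<^sub>R norm a"
definition "dist (a :: quat) b = norm (a - b)"
definition "(uniformity :: (quat \<times> quat) filter) =
  (INF e\<in>{0 <..}. principal {(x, y). dist x y < e})"
definition "open (U :: quat set) \<longleftrightarrow> (\<forall>x\<in>U. eventually (\<lambda>(x', y). x' = x \<longrightarrow> y \<in> U) uniformity)"
instance
proof
  fix x :: quat
  have *: "0 \<le> qRe x * qRe x" "0 \<le> qI x * qI x" "0 \<le> qJ x * qJ x" "0 \<le> qK x * qK x"
    by simp_all
  show "0 \<le> inner x x" using * by (simp add: inner_quat_def)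
  show "inner x x = 0 \<longleftrightarrow> x = 0"
  proof
    assume "inner x x = 0"
    hence "qRe x * qRe x = 0" "qI x * qI x = 0" "qJ x * qJ x = 0" "qK x * qK x = 0"
      using * unfolding inner_quat_def by linarith+
    thus "x = 0" by (simp add: quat_eq_iff)
  qed (simp add: inner_quat_def)
qed (simp_all add: inner_quat_def norm_quat_def sgn_quat_def dist_quat_def
      uniformity_quat_def open_quat_def algebra_simps)
end

lemma norm_quat_power2: "(norm (a :: quat))\<^sup>2 = (qRe a)\<^sup>2 + (qI a)\<^sup>2 + (qJ a)\<^sup>2 + (qK a)\<^sup>2"
  unfolding power2_norm_eq_inner inner_quat_def by (simp add: power2_eq_square)

definition qcnj :: "quat \<Rightarrow> quat" where
  "qcnj a = Quat (qRe a) (- qI a) (- qJ a) (- qK a)"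

lemma qcnj_simps [simp]:
  "qRe (qcnj a) = qRe a" "qI (qcnj a) = - qI a" "qJ (qcnj a) = - qJ a" "qK (qcnj a) = - qK a"
  by (simp_all add: qcnj_def)

lemma mult_qcnj: "a * qcnj a = of_real ((norm a)\<^sup>2)" "qcnj a * a = of_real ((norm a)\<^sup>2)"
  unfolding quat_eq_iff norm_quat_power2 quat_of_real_simps
  by (simp_all add: power2_eq_square algebra_simps)

instantiation quat :: real_normed_div_algebra
begin
definition "inverse (a :: quat) = qcnj a /\<^sub>R (norm a)\<^sup>2"
definition "divide (a :: quat) b = a * inverse b"
instance
proof
  fix a b :: quat
  show "a \<noteq> 0 \<Longrightarrow> inverse a * a = 1"
    by (simp add: inverse_quat_def mult_qcnj del: of_real_power) (simp add: of_real_def)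
  show "a \<noteq> 0 \<Longrightarrow> a * inverse a = 1"
    by (simp add: inverse_quat_def mult_qcnj del: of_real_power) (simp add: of_real_def)
  show "a div b = a * inverse b" by (simp add: divide_quat_def)
  show "inverse (0 :: quat) = 0" by (simp add: inverse_quat_def quat_eq_iff)
  have "(norm (a * b))\<^sup>2 = (norm a * norm b)\<^sup>2"
    unfolding power_mult_distrib norm_quat_power2 by (simp add: power2_eq_square algebra_simps)
  thus "norm (a * b) = norm a * norm b"
    by (metis norm_ge_zero mult_nonneg_nonneg power2_eq_imp_eq)
qed
end

abbreviation quat_i :: quat where "quat_i \<equiv> Quat 0 1 0 0"
abbreviation quat_j :: quat where "quat_j \<equiv> Quat 0 0 1 0"
abbreviation quat_k :: quat where "quat_k \<equiv> Quat 0 0 0 1"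


section \<open>Slices, spheres and circular sets\<close>

definition quat_imag_units :: "quat set" ("\<S>") where
  "\<S> = {q. q\<^sup>2 = -1}"

definition slice_plane :: "quat \<Rightarrow> quat set" where
  "slice_plane I = {of_real x + I * of_real y | x y. True}"

definition qsphere :: "quat \<Rightarrow> quat set" where
  "qsphere q = {of_real x + J * of_real y | x y J. J \<in> \<S> \<and> (\<exists>I\<in>\<S>. q = of_real x + I * of_real y)}"

definition circular :: "quat set \<Rightarrow> bool" where
  "circular U \<longleftrightarrow> (\<forall>q\<in>U. qsphere q \<subseteq> U)"

definition circular_domain :: "quat set \<Rightarrow> bool" where
  "circular_domain U \<longleftrightarrow> open U \<and> connected U \<and> circular U"


section \<open>Slice regular functions\<close>

text \<open>Functions are total on the quaternions; only the values on the domain in question matter.\<close>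

definition is_slice_function :: "quat set \<Rightarrow> (quat \<Rightarrow> quat) \<Rightarrow> bool" where
  "is_slice_function U f \<longleftrightarrow>
     (\<exists>F1 F2 :: real \<Rightarrow> real \<Rightarrow> quat.
        (\<forall>x y. F1 x (- y) = F1 x y) \<and> (\<forall>x y. F2 x (- y) = - F2 x y) \<and>
        (\<forall>x y. \<forall>I\<in>\<S>. of_real x + I * of_real y \<in> U \<longrightarrow>
           f (of_real x + I * of_real y) = F1 x y + I * F2 x y))"

text \<open>\<open>D (1, 0)\<close> and \<open>D (0, 1)\<close> are the partial derivatives in \<open>x\<close> and \<open>y\<close> of the restriction
  of \<open>f\<close> to the slice of \<open>I\<close>.\<close>

definition slice_holomorphic :: "quat set \<Rightarrow> (quat \<Rightarrow> quat) \<Rightarrow> bool" where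
  "slice_holomorphic U f \<longleftrightarrow>
     (\<forall>I\<in>\<S>. \<forall>x y. of_real x + I * of_real y \<in> U \<longrightarrow>
        (\<exists>D. ((\<lambda>(s, t). f (of_real s + I * of_real t)) has_derivative D) (at (x, y)) \<and>
             (1 / 2) *\<^sub>R (D (1, 0) + I * D (0, 1)) = 0))"

definition SR :: "quat set \<Rightarrow> (quat \<Rightarrow> quat) set" where
  "SR U = {f. is_slice_function U f \<and> slice_holomorphic U f}"


section \<open>Semi-regular functions\<close>

definition qDelta :: "quat \<Rightarrow> quat \<Rightarrow> quat" where
  "qDelta p q = q\<^sup>2 - 2 * of_real (qRe p) * q + of_real ((norm p)\<^sup>2)"

text \<open>\<open>regular_off_poles \<Omega> f U\<close> says that \<open>U\<close> is an admissible domain of definition of the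
  semi-regular function \<open>f\<close> on \<open>\<Omega>\<close>. The sphere of a real point \<open>p\<close> is \<open>{p}\<close>, so isolated real
  points and isolated spheres are treated uniformly. The values of \<open>f\<close> outside \<open>U\<close> are irrelevant.
  Multiplication by \<open>qDelta p\<close> is pointwise because that function is slice preserving.\<close>

definition regular_off_poles :: "quat set \<Rightarrow> (quat \<Rightarrow> quat) \<Rightarrow> quat set \<Rightarrow> bool" where
  "regular_off_poles \<Omega> f U \<longleftrightarrow>
     U \<subseteq> \<Omega> \<and> open U \<and> circular U \<and> f \<in> SR U \<and>
     (\<forall>p\<in>\<Omega> - U. \<exists>N. open N \<and> circular N \<and> p \<in> N \<and> N \<subseteq> \<Omega> \<and> N - qsphere p \<subseteq> U \<and>
        (\<exists>m. \<exists>g\<in>SR N. \<forall>q\<in>N - qsphere p. g q = (qDelta p q) ^ m * f q))"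

definition SEM :: "quat set \<Rightarrow> (quat \<Rightarrow> quat) set" where
  "SEM \<Omega> = {f. \<exists>U. regular_off_poles \<Omega> f U}"

text \<open>Equality of semi-regular functions: agreement where both are defined.\<close>

definition sem_eq :: "quat set \<Rightarrow> (quat \<Rightarrow> quat) \<Rightarrow> (quat \<Rightarrow> quat) \<Rightarrow> bool" where
  "sem_eq \<Omega> f g \<longleftrightarrow>
     (\<exists>U V. regular_off_poles \<Omega> f U \<and> regular_off_poles \<Omega> g V \<and> (\<forall>q\<in>U \<inter> V. f q = g q))"

definition SEM_R :: "quat set \<Rightarrow> (quat \<Rightarrow> quat) set" where
  "SEM_R \<Omega> = {f. \<exists>U. regular_off_poles \<Omega> f U \<and>
                     (\<forall>I\<in>\<S>. f ` (U \<inter> slice_plane I) \<subseteq> slice_plane I)}"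

definition one_slice_preserving :: "quat set \<Rightarrow> (quat \<Rightarrow> quat) \<Rightarrow> bool" where
  "one_slice_preserving \<Omega> f \<longleftrightarrow>
     (\<exists>U. regular_off_poles \<Omega> f U \<and> (\<exists>I\<in>\<S>. f ` (U \<inter> slice_plane I) \<subseteq> slice_plane I))"


section \<open>The algebra of semi-regular functions\<close>

definition star_prod :: "(quat \<Rightarrow> quat) \<Rightarrow> (quat \<Rightarrow> quat) \<Rightarrow> quat \<Rightarrow> quat" (infixl "\<star>" 70) where
  "(f \<star> g) q = (if f q = 0 then 0 else f q * g (inverse (f q) * q * f q))"

text \<open>The decomposition \<open>f = f0 + f1 I + f2 J + f3 K\<close> with slice preserving coefficients, for the
  standard basis. The conjugate does not depend on the choice of the orthonormal basis.\<close>

definition sem_decomp ::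
  "quat set \<Rightarrow> (quat \<Rightarrow> quat) \<Rightarrow> (quat \<Rightarrow> quat) \<times> (quat \<Rightarrow> quat) \<times> (quat \<Rightarrow> quat) \<times> (quat \<Rightarrow> quat) \<Rightarrow> bool"
  where
  "sem_decomp \<Omega> f = (\<lambda>(f0, f1, f2, f3).
     f0 \<in> SEM_R \<Omega> \<and> f1 \<in> SEM_R \<Omega> \<and> f2 \<in> SEM_R \<Omega> \<and> f3 \<in> SEM_R \<Omega> \<and>
     sem_eq \<Omega> f (\<lambda>q. f0 q + f1 q * quat_i + f2 q * quat_j + f3 q * quat_k))"

text \<open>The choice below is well defined up to \<^const>\<open>sem_eq\<close>: see \<open>sem_decomp_exists\<close> and
  \<open>sem_decomp_unique\<close>.\<close>

definition sem_conj :: "quat set \<Rightarrow> (quat \<Rightarrow> quat) \<Rightarrow> quat \<Rightarrow> quat" where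
  "sem_conj \<Omega> f = (case SOME c. sem_decomp \<Omega> f c of (f0, f1, f2, f3) \<Rightarrow>
     (\<lambda>q. f0 q - (f1 q * quat_i + f2 q * quat_j + f3 q * quat_k)))"

definition sem_symm :: "quat set \<Rightarrow> (quat \<Rightarrow> quat) \<Rightarrow> quat \<Rightarrow> quat" where
  "sem_symm \<Omega> f = f \<star> sem_conj \<Omega> f"

definition sem_real_part :: "quat set \<Rightarrow> (quat \<Rightarrow> quat) \<Rightarrow> quat \<Rightarrow> quat" where
  "sem_real_part \<Omega> f = (\<lambda>q. (1 / 2) *\<^sub>R (f q + sem_conj \<Omega> f q))"

definition sem_vec_part :: "quat set \<Rightarrow> (quat \<Rightarrow> quat) \<Rightarrow> quat \<Rightarrow> quat" where
  "sem_vec_part \<Omega> f = (\<lambda>q. f q - sem_real_part \<Omega> f q)"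

definition star_invertible :: "quat set \<Rightarrow> (quat \<Rightarrow> quat) \<Rightarrow> bool" where
  "star_invertible \<Omega> f \<longleftrightarrow> f \<in> SEM \<Omega> \<and> \<not> sem_eq \<Omega> (sem_symm \<Omega> f) (\<lambda>_. 0)"

text \<open>The inverse of \<open>f\<^sup>s\<close> in the field of slice preserving functions is the pointwise one.\<close>

definition star_inverse :: "quat set \<Rightarrow> (quat \<Rightarrow> quat) \<Rightarrow> quat \<Rightarrow> quat" where
  "star_inverse \<Omega> f = (\<lambda>q. inverse (sem_symm \<Omega> f q)) \<star> sem_conj \<Omega> f"

definition sem_equivalent :: "quat set \<Rightarrow> (quat \<Rightarrow> quat) \<Rightarrow> (quat \<Rightarrow> quat) \<Rightarrow> bool" where
  "sem_equivalent \<Omega> f g \<longleftrightarrow>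
     (\<exists>h. star_invertible \<Omega> h \<and> sem_eq \<Omega> f (star_inverse \<Omega> h \<star> g \<star> h))"

definition sem_idempotent :: "quat set \<Rightarrow> (quat \<Rightarrow> quat) \<Rightarrow> bool" where
  "sem_idempotent \<Omega> f \<longleftrightarrow>
     f \<in> SEM \<Omega> \<and> \<not> sem_eq \<Omega> f (\<lambda>_. 0) \<and> \<not> sem_eq \<Omega> f (\<lambda>_. 1) \<and> sem_eq \<Omega> (f \<star> f) f"

section \<open>Existence and uniqueness of the decomposition\<close>

lemma imag_unit_mult: "I \<in> \<S> \<Longrightarrow> I * I = -1"
  by (simp add: quat_imag_units_def power2_eq_square)

lemma imag_unit_mult2: "I \<in> \<S> \<Longrightarrow> I * (I * a) = - a"
  by (simp add: imag_unit_mult flip: mult.assoc)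

lemma imag_unit_uminus: "I \<in> \<S> \<Longrightarrow> - I \<in> \<S>"
  by (simp add: quat_imag_units_def)

lemma quat_i_unit: "quat_i \<in> \<S>" and quat_j_unit: "quat_j \<in> \<S>"
  by (simp_all add: quat_imag_units_def power2_eq_square quat_eq_iff)

lemma imag_unit_re:
  assumes "I \<in> \<S>"
  shows "qRe I = 0" "(qI I)\<^sup>2 + (qJ I)\<^sup>2 + (qK I)\<^sup>2 = 1"
proof -
  have *: "qRe I * qRe I - qI I * qI I - qJ I * qJ I - qK I * qK I = -1"
    "qRe I * qI I = 0" "qRe I * qJ I = 0" "qRe I * qK I = 0"
    using imag_unit_mult[OF assms] by (auto simp: quat_eq_iff)
  show "qRe I = 0"
  proof (rule ccontr)
    assume "qRe I \<noteq> 0"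
    with * have "qRe I * qRe I = -1" by simp
    moreover have "qRe I * qRe I \<ge> 0" by simp
    ultimately show False by linarith
  qed
  with * show "(qI I)\<^sup>2 + (qJ I)\<^sup>2 + (qK I)\<^sup>2 = 1" by (simp add: power2_eq_square)
qed

lemma qcnj_slice: "I \<in> \<S> \<Longrightarrow> qcnj (of_real x + I * of_real y) = of_real x - I * of_real y"
  by (simp add: quat_eq_iff imag_unit_re)

definition vec_norm :: "quat \<Rightarrow> real" where
  "vec_norm q = sqrt ((qI q)\<^sup>2 + (qJ q)\<^sup>2 + (qK q)\<^sup>2)"

definition vec_dir :: "quat \<Rightarrow> quat" where
  "vec_dir q = (if vec_norm q = 0 then quat_i
                else Quat 0 (qI q / vec_norm q) (qJ q / vec_norm q) (qK q / vec_norm q))"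

lemma vec_norm_power2: "(vec_norm q)\<^sup>2 = (qI q)\<^sup>2 + (qJ q)\<^sup>2 + (qK q)\<^sup>2"
  by (simp add: vec_norm_def)

lemma vec_norm_0D:
  assumes "vec_norm q = 0"
  shows "qI q = 0" "qJ q = 0" "qK q = 0"
proof -
  have "(qI q)\<^sup>2 + (qJ q)\<^sup>2 + (qK q)\<^sup>2 = 0" using vec_norm_power2[of q] assms by simp
  moreover have "0 \<le> (qI q)\<^sup>2" "0 \<le> (qJ q)\<^sup>2" "0 \<le> (qK q)\<^sup>2" by simp_all
  ultimately have "(qI q)\<^sup>2 = 0" "(qJ q)\<^sup>2 = 0" "(qK q)\<^sup>2 = 0" by linarith+
  thus "qI q = 0" "qJ q = 0" "qK q = 0" by simp_all
qed

lemma vec_dir_unit: "vec_dir q \<in> \<S>"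
proof (cases "vec_norm q = 0")
  case False
  have e: "qI q * qI q + qJ q * qJ q + qK q * qK q = vec_norm q * vec_norm q"
    using vec_norm_power2[of q] by (simp add: power2_eq_square)
  have "(qI q * qI q + qJ q * qJ q + qK q * qK q) / (vec_norm q * vec_norm q) = 1"
    unfolding e using False by simp
  thus ?thesis using False
    by (simp add: vec_dir_def quat_imag_units_def power2_eq_square quat_eq_iff add_divide_distrib)
qed (simp add: vec_dir_def quat_i_unit)

lemma quat_slice_repr: "q = of_real (qRe q) + vec_dir q * of_real (vec_norm q)"
  by (cases "vec_norm q = 0") (auto simp: quat_eq_iff vec_dir_def vec_norm_0D)

lemma quat_slice_cases:
  obtains x y I where "I \<in> \<S>" "q = of_real x + I * of_real y"
  using quat_slice_repr vec_dir_unit by blast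

lemma vec_dir_slice:
  assumes "I \<in> \<S>" "y \<noteq> 0"
  shows "vec_dir (of_real x + I * of_real y) = sgn y *\<^sub>R I"
proof -
  let ?q = "of_real x + I * of_real y :: quat"
  have "vec_norm ?q = sqrt (((qI I)\<^sup>2 + (qJ I)\<^sup>2 + (qK I)\<^sup>2) * y\<^sup>2)"
    by (simp add: vec_norm_def algebra_simps power_mult_distrib)
  hence "vec_norm ?q = \<bar>y\<bar>" using imag_unit_re[OF assms(1)] by simp
  thus ?thesis using assms imag_unit_re[OF assms(1)]
    by (auto simp: vec_dir_def quat_eq_iff sgn_if)
qed

lemma circularD:
  assumes "circular U" "of_real x + I * of_real y \<in> U" "I \<in> \<S>" "J \<in> \<S>"
  shows "of_real x + J * of_real y \<in> U"
  using assms unfolding circular_def qsphere_def by blast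

lemma circular_qcnj:
  assumes "circular U" "of_real x + I * of_real y \<in> U" "I \<in> \<S>"
  shows "of_real x - I * of_real y \<in> U"
  using circularD[OF assms(1-3) imag_unit_uminus[OF assms(3)]] by simp

lemma circular_Int: "circular U \<Longrightarrow> circular V \<Longrightarrow> circular (U \<inter> V)"
  unfolding circular_def by blast

lemma qsphere_refl: "q \<in> qsphere q"
proof -
  obtain x y I where "I \<in> \<S>" "q = of_real x + I * of_real y" by (rule quat_slice_cases)
  thus ?thesis unfolding qsphere_def by blast
qed

lemma qsphere_qcnj: "q \<in> qsphere p \<Longrightarrow> qcnj q \<in> qsphere p"
proof -
  assume "q \<in> qsphere p"
  then obtain x y J I where *: "q = of_real x + J * of_real y" "J \<in> \<S>" "I \<in> \<S>"
    "p = of_real x + I * of_real y" unfolding qsphere_def by blast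
  hence "qcnj q = of_real x + (- J) * of_real y" by (simp add: qcnj_slice)
  with * show ?thesis unfolding qsphere_def using imag_unit_uminus by blast
qed

lemma qcnj_qcnj [simp]: "qcnj (qcnj q) = q" by (simp add: quat_eq_iff)

text \<open>The stem components of an arbitrary function on the slice of \<open>I\<close>.\<close>

definition stem1 :: "(quat \<Rightarrow> quat) \<Rightarrow> quat \<Rightarrow> real \<times> real \<Rightarrow> quat" where
  "stem1 f I = (\<lambda>(s, t). (1 / 2) *\<^sub>R (f (of_real s + I * of_real t) + f (of_real s - I * of_real t)))"

definition stem2 :: "(quat \<Rightarrow> quat) \<Rightarrow> quat \<Rightarrow> real \<times> real \<Rightarrow> quat" where
  "stem2 f I = (\<lambda>(s, t). - (I * ((1 / 2) *\<^sub>R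
     (f (of_real s + I * of_real t) - f (of_real s - I * of_real t)))))"

definition slice_coeff :: "(quat \<Rightarrow> real) \<Rightarrow> (quat \<Rightarrow> quat) \<Rightarrow> quat \<Rightarrow> quat" where
  "slice_coeff L f q =
     of_real (L (stem1 f (vec_dir q) (qRe q, vec_norm q))) +
     vec_dir q * of_real (L (stem2 f (vec_dir q) (qRe q, vec_norm q)))"

lemma vec_norm_slice:
  assumes "I \<in> \<S>"
  shows "vec_norm (of_real x + I * of_real y) = \<bar>y\<bar>"
proof -
  let ?q = "of_real x + I * of_real y :: quat"
  have "vec_norm ?q = sqrt (((qI I)\<^sup>2 + (qJ I)\<^sup>2 + (qK I)\<^sup>2) * y\<^sup>2)"
    by (simp add: vec_norm_def algebra_simps power_mult_distrib)
  thus ?thesis using imag_unit_re[OF assms] by simp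
qed

lemma slice_coeff_slice:
  assumes I: "I \<in> \<S>" and L: "bounded_linear L"
  shows "slice_coeff L f (of_real s + I * of_real t) =
           of_real (L (stem1 f I (s, t))) + I * of_real (L (stem2 f I (s, t)))"
proof -
  let ?q = "of_real s + I * of_real t :: quat"
  have re: "qRe ?q = s" using imag_unit_re[OF I] by simp
  interpret bounded_linear L by fact
  consider "t = 0" | "t > 0" | "t < 0" by linarith
  thus ?thesis
  proof cases
    case 1
    thus ?thesis using re vec_norm_slice[OF I, of s t]
      by (simp add: slice_coeff_def stem1_def stem2_def zero)
  next
    case 2
    hence d: "vec_dir ?q = I" "vec_norm ?q = t"
      using vec_norm_slice[OF I, of s t] vec_dir_slice[OF I, of t s] by simp_all
    show ?thesis unfolding slice_coeff_def re d ..
  next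
    case 3
    hence d: "vec_dir ?q = - I" "vec_norm ?q = - t"
      using vec_norm_slice[OF I, of s t] vec_dir_slice[OF I, of t s] by simp_all
    have "stem1 f (- I) (s, - t) = stem1 f I (s, t)" "stem2 f (- I) (s, - t) = - stem2 f I (s, t)"
      by (simp_all add: stem1_def stem2_def)
    thus ?thesis unfolding slice_coeff_def re d by (simp add: neg)
  qed
qed

lemma stem_eq:
  assumes "I \<in> \<S>"
  shows "stem1 f I (s, t) + I * stem2 f I (s, t) = f (of_real s + I * of_real t)"
proof -
  have *: "I * stem2 f I (s, t) =
      (1 / 2) *\<^sub>R (f (of_real s + I * of_real t) - f (of_real s - I * of_real t))"
    by (simp add: stem2_def imag_unit_mult2[OF assms] flip: scaleR_minus_right)
  show ?thesis unfolding * by (simp add: stem1_def quat_eq_iff field_simps)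
qed

lemma bounded_linear_coords:
  "bounded_linear qRe" "bounded_linear qI" "bounded_linear qJ" "bounded_linear qK"
proof -
  have sq: "\<bar>a\<bar> \<le> sqrt b" if "a\<^sup>2 \<le> b" for a b :: real
    using real_sqrt_le_mono[OF that] by simp
  have nrm: "norm x = sqrt ((qRe x)\<^sup>2 + (qI x)\<^sup>2 + (qJ x)\<^sup>2 + (qK x)\<^sup>2)" for x :: quat
    by (metis norm_quat_power2 norm_ge_zero real_sqrt_unique)
  show "bounded_linear qRe" "bounded_linear qI" "bounded_linear qJ" "bounded_linear qK"
    by (rule bounded_linear_intro[where K = 1]; simp add: nrm; rule sq; simp)+
qed

lemma slice_coeff_sum:
  "slice_coeff qRe f q + slice_coeff qI f q * quat_i + slice_coeff qJ f q * quat_j +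
     slice_coeff qK f q * quat_k = f q"
proof -
  obtain s t I where I: "I \<in> \<S>" and q: "q = of_real s + I * of_real t" by (rule quat_slice_cases)
  have e: "of_real (qRe a) + of_real (qI a) * quat_i + of_real (qJ a) * quat_j +
      of_real (qK a) * quat_k = a" for a
    by (simp add: quat_eq_iff)
  let ?P = "stem1 f I (s, t)" and ?Q = "stem2 f I (s, t)"
  have "slice_coeff qRe f q + slice_coeff qI f q * quat_i + slice_coeff qJ f q * quat_j +
     slice_coeff qK f q * quat_k =
     (of_real (qRe ?P) + of_real (qI ?P) * quat_i + of_real (qJ ?P) * quat_j + of_real (qK ?P) * quat_k) +
     I * (of_real (qRe ?Q) + of_real (qI ?Q) * quat_i + of_real (qJ ?Q) * quat_j + of_real (qK ?Q) * quat_k)"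
    unfolding q by (simp only: slice_coeff_slice[OF I] bounded_linear_coords)
      (simp only: distrib_left distrib_right mult.assoc add_ac)
  also have "\<dots> = f q" unfolding e q by (rule stem_eq[OF I])
  finally show ?thesis .
qed

lemma stem_of_slice_function:
  assumes "I \<in> \<S>" "of_real x + I * of_real y \<in> U" "circular U"
    and ev: "\<And>x y. F1 x (- y) = F1 x y" and od: "\<And>x y. F2 x (- y) = - F2 x y"
    and f: "\<And>x y I. I \<in> \<S> \<Longrightarrow> of_real x + I * of_real y \<in> U \<Longrightarrow>
              f (of_real x + I * of_real y) = F1 x y + I * F2 x y"
  shows "stem1 f I (x, y) = F1 x y" "stem2 f I (x, y) = F2 x y"
proof -
  have "of_real x + I * of_real (- y) \<in> U" using circular_qcnj[OF assms(3,2,1)] by simp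
  from f[OF assms(1) this] have 1: "f (of_real x - I * of_real y) = F1 x y - I * F2 x y"
    by (simp add: ev od)
  have 2: "f (of_real x + I * of_real y) = F1 x y + I * F2 x y" using f assms by blast
  show "stem1 f I (x, y) = F1 x y" by (simp add: stem1_def 1 2 quat_eq_iff)
  have "(F1 x y + I * F2 x y) - (F1 x y - I * F2 x y) = 2 *\<^sub>R (I * F2 x y)"
    by (simp add: scaleR_2)
  hence "stem2 f I (x, y) = - (I * (I * F2 x y))"
    by (simp add: stem2_def 1 2)
  also have "\<dots> = F2 x y" using imag_unit_mult[OF assms(1)] by (simp flip: mult.assoc)
  finally show "stem2 f I (x, y) = F2 x y" .
qed

lemma slice_coeff_slice_function:
  assumes "is_slice_function U f" "circular U" "bounded_linear L"
  shows "is_slice_function U (slice_coeff L f)"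
proof -
  interpret L: bounded_linear L by fact
  obtain F1 F2 where F: "\<And>x y. F1 x (- y) = F1 x y" "\<And>x y. F2 x (- y) = - F2 x y"
    "\<And>x y I. I \<in> \<S> \<Longrightarrow> of_real x + I * of_real y \<in> U \<Longrightarrow>
       f (of_real x + I * of_real y) = F1 x y + I * F2 x y"
    using assms(1) unfolding is_slice_function_def by metis
  have "slice_coeff L f (of_real x + I * of_real y) =
      of_real (L (F1 x y)) + I * of_real (L (F2 x y))"
    if "I \<in> \<S>" "of_real x + I * of_real y \<in> U" for x y I
    using stem_of_slice_function[OF that assms(2) F] slice_coeff_slice[OF that(1) assms(3)] by simp
  thus ?thesis unfolding is_slice_function_def
    by (intro exI[of _ "\<lambda>x y. of_real (L (F1 x y))"] exI[of _ "\<lambda>x y. of_real (L (F2 x y))"])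
      (simp add: F L.neg)
qed

lemma slice_coeff_holomorphic:
  assumes "slice_holomorphic U f" "circular U" "bounded_linear L"
  shows "slice_holomorphic U (slice_coeff L f)"
  unfolding slice_holomorphic_def
proof (intro ballI allI impI)
  fix I x y assume I: "I \<in> \<S>" and xy: "of_real x + I * of_real y \<in> U"
  interpret L: bounded_linear L by fact
  define h where "h = (\<lambda>(s, t). f (of_real s + I * of_real t))"
  have II: "I * (I * a) = - a" for a using imag_unit_mult[OF I] by (simp flip: mult.assoc)
  obtain D where D: "(h has_derivative D) (at (x, y))"
    and "(1 / 2) *\<^sub>R (D (1, 0) + I * D (0, 1)) = 0"
    using assms(1) I xy unfolding slice_holomorphic_def h_def by blast
  hence CR: "D (1, 0) = - (I * D (0, 1))" by (simp add: eq_neg_iff_add_eq_0)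
  have "of_real x + I * of_real (- y) \<in> U" using circular_qcnj[OF assms(2) xy I] by simp
  then obtain D' where D': "(h has_derivative D') (at (x, - y))"
    and "(1 / 2) *\<^sub>R (D' (1, 0) + I * D' (0, 1)) = 0"
    using assms(1) I unfolding slice_holomorphic_def h_def by blast
  hence CR': "D' (1, 0) = - (I * D' (0, 1))" by (simp add: eq_neg_iff_add_eq_0)
  define c :: "real \<times> real \<Rightarrow> real \<times> real" where "c = (\<lambda>v. (fst v, - snd v))"
  have c: "(c has_derivative c) (at (x, y))"
    unfolding c_def by (auto intro!: derivative_eq_intros)
  have "(h has_derivative D') (at (c (x, y)))" using D' by (simp add: c_def)
  from has_derivative_compose[OF c this]
  have Dc: "((\<lambda>v. h (c v)) has_derivative (\<lambda>v. D' (c v))) (at (x, y))" .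
  have s1: "stem1 f I = (\<lambda>v. (1 / 2) *\<^sub>R (h v + h (c v)))"
    and s2: "stem2 f I = (\<lambda>v. - (I * ((1 / 2) *\<^sub>R (h v - h (c v)))))"
    by (auto simp: stem1_def stem2_def h_def c_def)
  define P Q where "P = (\<lambda>v. (1 / 2) *\<^sub>R (D v + D' (c v)))"
    and "Q = (\<lambda>v. - (I * ((1 / 2) *\<^sub>R (D v - D' (c v)))))"
  have P: "(stem1 f I has_derivative P) (at (x, y))"
    unfolding s1 P_def by (intro derivative_intros D Dc)
  have Q: "(stem2 f I has_derivative Q) (at (x, y))"
    unfolding s2 Q_def by (rule derivative_eq_intros D Dc refl)+ 
  have D'lin: "D' (0, - 1) = - D' (0, 1)"
    using linear_neg[OF has_derivative_linear[OF D'], of "(0, 1)"] by simp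
  have e1: "P (1, 0) = Q (0, 1)"
    unfolding P_def Q_def c_def by (simp add: CR CR' D'lin algebra_simps)
  have e2: "Q (1, 0) = - P (0, 1)"
    unfolding P_def Q_def c_def by (simp add: CR CR' D'lin II algebra_simps)
  let ?T = "\<lambda>v. of_real (L (P v)) + I * of_real (L (Q v))"
  have "((\<lambda>v. of_real (L (stem1 f I v)) + I * of_real (L (stem2 f I v))) has_derivative ?T) (at (x, y))"
    by (intro derivative_intros L.has_derivative P Q
        bounded_linear.has_derivative[OF bounded_linear_of_real])
  moreover have "(\<lambda>v. of_real (L (stem1 f I v)) + I * of_real (L (stem2 f I v))) =
      (\<lambda>(s, t). slice_coeff L f (of_real s + I * of_real t))"
    by (auto simp: slice_coeff_slice[OF I assms(3)])
  moreover have "?T (1, 0) + I * ?T (0, 1) = 0"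
    by (simp add: e1 e2 L.neg distrib_left II)
  ultimately show "\<exists>D. ((\<lambda>(s, t). slice_coeff L f (of_real s + I * of_real t)) has_derivative D)
      (at (x, y)) \<and> (1 / 2) *\<^sub>R (D (1, 0) + I * D (0, 1)) = 0"
    by (intro exI[of _ ?T]) simp
qed

lemma slice_coeff_SR:
  "f \<in> SR U \<Longrightarrow> circular U \<Longrightarrow> bounded_linear L \<Longrightarrow> slice_coeff L f \<in> SR U"
  unfolding SR_def using slice_coeff_slice_function slice_coeff_holomorphic by blast

lemma slice_coeff_preserving:
  assumes "I \<in> \<S>" "bounded_linear L" "q \<in> slice_plane I"
  shows "slice_coeff L f q \<in> slice_plane I"
  using assms slice_coeff_slice unfolding slice_plane_def by fastforce

lemma slice_plane_mult:
  assumes "I \<in> \<S>"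
  shows "(of_real a + I * of_real b) * (of_real c + I * of_real d) =
           of_real (a * c - b * d) + I * of_real (a * d + b * c)"
  using imag_unit_re[OF assms] by (simp add: quat_eq_iff power2_eq_square) algebra

lemma qDelta_power_slice:
  assumes "I \<in> \<S>"
  shows "\<exists>a b. qDelta p (of_real s + I * of_real t) ^ m = of_real a + I * of_real b \<and>
               qDelta p (of_real s - I * of_real t) ^ m = of_real a - I * of_real b"
proof (induction m)
  case 0
  show ?case by (intro exI[of _ 1] exI[of _ 0]) simp
next
  case (Suc m)
  then obtain a b where ab:
    "qDelta p (of_real s + I * of_real t) ^ m = of_real a + I * of_real b"
    "qDelta p (of_real s - I * of_real t) ^ m = of_real a + (- I) * of_real b" by auto
  define c where "c = s\<^sup>2 - t\<^sup>2 - 2 * qRe p * s + (norm p)\<^sup>2"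
  define d where "d = 2 * s * t - 2 * qRe p * t"
  have D: "qDelta p (of_real s + J * of_real t) = of_real c + J * of_real d" if "J \<in> \<S>" for J
    unfolding qDelta_def power2_eq_square slice_plane_mult[OF that] c_def d_def
    by (simp add: algebra_simps quat_eq_iff)
  note D1 = D[OF assms] and D2 = D[OF imag_unit_uminus[OF assms]]
  show ?case
    using D2 ab slice_plane_mult[OF assms, of c d a b]
      slice_plane_mult[OF imag_unit_uminus[OF assms], of c d a b]
    by (intro exI[of _ "c * a - d * b"] exI[of _ "c * b + d * a"]) (simp add: D1)
qed

lemma slice_coeff_pole:
  assumes L: "bounded_linear L" and g: "\<And>z. z \<in> {q, qcnj q} \<Longrightarrow> g z = qDelta p z ^ m * f z"
  shows "slice_coeff L g q = qDelta p q ^ m * slice_coeff L f q"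
proof -
  interpret L: bounded_linear L by fact
  obtain s t I where I: "I \<in> \<S>" and q: "q = of_real s + I * of_real t" by (rule quat_slice_cases)
  have II: "I * (I * a) = - a" for a using imag_unit_mult[OF I] by (simp flip: mult.assoc)
  have qc: "qcnj q = of_real s - I * of_real t" using q qcnj_slice[OF I] by simp
  obtain a b where ab: "qDelta p q ^ m = of_real a + I * of_real b"
    "qDelta p (qcnj q) ^ m = of_real a - I * of_real b"
    using qDelta_power_slice[OF I, of p s t m] unfolding qc unfolding q by blast
  have g1: "g q = a *\<^sub>R f q + b *\<^sub>R (I * f q)"
    using g[of q] ab by (simp add: distrib_right scaleR_conv_of_real quat_eq_iff algebra_simps)
  have g2: "g (qcnj q) = a *\<^sub>R f (qcnj q) - b *\<^sub>R (I * f (qcnj q))"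
    using g[of "qcnj q"] ab
    by (simp add: left_diff_distrib scaleR_conv_of_real quat_eq_iff algebra_simps)
  have S: "stem1 l I (s, t) = (1 / 2) *\<^sub>R (l q + l (qcnj q))"
    "stem2 l I (s, t) = - (I * ((1 / 2) *\<^sub>R (l q - l (qcnj q))))" for l
    unfolding stem1_def stem2_def qc unfolding q by simp_all
  have P: "stem1 g I (s, t) = a *\<^sub>R stem1 f I (s, t) - b *\<^sub>R stem2 f I (s, t)"
    unfolding S g1 g2 by (simp add: algebra_simps)
  have Q: "stem2 g I (s, t) = a *\<^sub>R stem2 f I (s, t) + b *\<^sub>R stem1 f I (s, t)"
    unfolding S g1 g2 by (simp add: algebra_simps II)
  show ?thesis
    unfolding ab(1) unfolding q slice_coeff_slice[OF I L] slice_plane_mult[OF I] P Q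
    by (simp add: L.add L.diff L.scaleR)
qed

lemma SR_mono: "f \<in> SR U \<Longrightarrow> V \<subseteq> U \<Longrightarrow> f \<in> SR V"
proof -
  assume f: "f \<in> SR U" and V: "V \<subseteq> U"
  have "is_slice_function V f"
  proof -
    obtain F1 F2 where "\<forall>x y. F1 x (- y) = F1 x y" "\<forall>x y. F2 x (- y) = - F2 x y"
      "\<forall>x y. \<forall>I\<in>\<S>. of_real x + I * of_real y \<in> U \<longrightarrow>
         f (of_real x + I * of_real y) = F1 x y + I * F2 x y"
      using f unfolding SR_def is_slice_function_def by auto
    thus ?thesis unfolding is_slice_function_def using subsetD[OF V]
      by (intro exI[of _ F1] exI[of _ F2]) simp
  qed
  moreover have "slice_holomorphic V f"
    using f subsetD[OF V] unfolding SR_def slice_holomorphic_def by simp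
  ultimately show ?thesis unfolding SR_def by simp
qed

lemma regular_off_poles_slice_coeff:
  assumes "regular_off_poles \<Omega> f U" "bounded_linear L"
  shows "regular_off_poles \<Omega> (slice_coeff L f) U"
  unfolding regular_off_poles_def
proof (intro conjI ballI)
  show "U \<subseteq> \<Omega>" "open U" "circular U" "slice_coeff L f \<in> SR U"
    using assms slice_coeff_SR unfolding regular_off_poles_def by blast+
  fix p assume "p \<in> \<Omega> - U"
  then obtain N m g where N: "open N" "circular N" "p \<in> N" "N \<subseteq> \<Omega>" "N - qsphere p \<subseteq> U" "g \<in> SR N"
    and g: "\<forall>q\<in>N - qsphere p. g q = (qDelta p q) ^ m * f q"
    using assms(1) unfolding regular_off_poles_def by meson
  have "slice_coeff L g q = qDelta p q ^ m * slice_coeff L f q" if q: "q \<in> N - qsphere p" for q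
  proof (rule slice_coeff_pole[OF assms(2)])
    obtain s t I where "I \<in> \<S>" "q = of_real s + I * of_real t" by (rule quat_slice_cases)
    hence "qcnj q \<in> N" using circular_qcnj[OF N(2)] q by (simp add: qcnj_slice)
    moreover have "qcnj q \<notin> qsphere p" using qsphere_qcnj[of "qcnj q" p] q by auto
    ultimately show "g z = qDelta p z ^ m * f z" if "z \<in> {q, qcnj q}" for z
      using that q g by auto
  qed
  thus "\<exists>N. open N \<and> circular N \<and> p \<in> N \<and> N \<subseteq> \<Omega> \<and> N - qsphere p \<subseteq> U \<and>
        (\<exists>m. \<exists>g\<in>SR N. \<forall>q\<in>N - qsphere p. g q = (qDelta p q) ^ m * slice_coeff L f q)"
    using N slice_coeff_SR[OF N(6) N(2) assms(2)] by blast
qed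

theorem sem_decomp_exists:
  assumes "f \<in> SEM \<Omega>"
  shows "\<exists>c. sem_decomp \<Omega> f c"
proof -
  obtain U where U: "regular_off_poles \<Omega> f U" using assms unfolding SEM_def by blast
  have R: "slice_coeff L f \<in> SEM_R \<Omega>" if "bounded_linear L" for L
    unfolding SEM_R_def
  proof (intro CollectI exI[of _ U] conjI ballI image_subsetI)
    show "regular_off_poles \<Omega> (slice_coeff L f) U"
      by (rule regular_off_poles_slice_coeff[OF U that])
    show "slice_coeff L f q \<in> slice_plane I" if "I \<in> \<S>" "q \<in> U \<inter> slice_plane I" for I q
      using slice_coeff_preserving[OF that(1) \<open>bounded_linear L\<close>] that(2) by blast
  qed
  have "sem_eq \<Omega> f f" unfolding sem_eq_def using U by blast
  thus ?thesis
    by (intro exI[of _ "(slice_coeff qRe f, slice_coeff qI f, slice_coeff qJ f, slice_coeff qK f)"])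
      (simp add: sem_decomp_def R bounded_linear_coords slice_coeff_sum)
qed

lemma regular_off_poles_Int:
  assumes U: "regular_off_poles \<Omega> f U" and V: "regular_off_poles \<Omega> g V"
  shows "regular_off_poles \<Omega> f (U \<inter> V)"
  unfolding regular_off_poles_def
proof (intro conjI ballI)
  have UV: "U \<subseteq> \<Omega>" "open U" "circular U" "f \<in> SR U" "V \<subseteq> \<Omega>" "open V" "circular V"
    using U V unfolding regular_off_poles_def by blast+
  show "U \<inter> V \<subseteq> \<Omega>" "open (U \<inter> V)" "circular (U \<inter> V)" "f \<in> SR (U \<inter> V)"
    using UV circular_Int SR_mono[of f U "U \<inter> V"] by auto
  fix p assume p: "p \<in> \<Omega> - (U \<inter> V)"
  obtain N m f' where N: "open N" "circular N" "p \<in> N" "N \<subseteq> \<Omega>" "N - qsphere p \<subseteq> U" "f' \<in> SR N"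
    "\<forall>q\<in>N - qsphere p. f' q = (qDelta p q) ^ m * f q"
  proof (cases "p \<in> U")
    case True
    thus ?thesis using UV by (intro that[of U f 0]) auto
  next
    case False
    hence "p \<in> \<Omega> - U" using p by blast
    thus ?thesis using U that unfolding regular_off_poles_def by meson
  qed
  obtain M where M: "open M" "circular M" "p \<in> M" "M \<subseteq> \<Omega>" "M - qsphere p \<subseteq> V"
  proof (cases "p \<in> V")
    case True
    thus ?thesis using UV by (intro that[of V]) auto
  next
    case False
    hence "p \<in> \<Omega> - V" using p by blast
    thus ?thesis using V that unfolding regular_off_poles_def by meson
  qed
  show "\<exists>N. open N \<and> circular N \<and> p \<in> N \<and> N \<subseteq> \<Omega> \<and> N - qsphere p \<subseteq> U \<inter> V \<and>
        (\<exists>m. \<exists>g\<in>SR N. \<forall>q\<in>N - qsphere p. g q = (qDelta p q) ^ m * f q)"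
  proof (intro exI[of _ "N \<inter> M"] conjI)
    show "\<exists>m. \<exists>g\<in>SR (N \<inter> M). \<forall>q\<in>N \<inter> M - qsphere p. g q = (qDelta p q) ^ m * f q"
      using N SR_mono[OF N(6), of "N \<inter> M"] by (intro exI[of _ m] bexI[of _ f']) auto
  qed (use N M circular_Int in auto)
qed

lemma slice_preserving_stem:
  assumes "is_slice_function U f" "circular U" "of_real x + I * of_real y \<in> U" "I \<in> \<S>"
    and sp: "\<forall>I\<in>\<S>. f ` (U \<inter> slice_plane I) \<subseteq> slice_plane I"
  shows "\<exists>a b. f (of_real x + I * of_real y) = of_real a + I * of_real b \<and>
               f (of_real x - I * of_real y) = of_real a - I * of_real b"
proof -
  obtain F1 F2 where F: "\<And>x y. F1 x (- y) = F1 x y" "\<And>x y. F2 x (- y) = - F2 x y"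
    "\<And>x y I. I \<in> \<S> \<Longrightarrow> of_real x + I * of_real y \<in> U \<Longrightarrow>
       f (of_real x + I * of_real y) = F1 x y + I * F2 x y"
    using assms(1) unfolding is_slice_function_def by metis
  have *: "F1 x y \<in> slice_plane J \<and> F2 x y \<in> slice_plane J" if J: "J \<in> \<S>" for J
  proof -
    have xJ: "of_real x + J * of_real y \<in> U" using circularD[OF assms(2,3,4) J] .
    have xJ': "of_real x + J * of_real (- y) \<in> U" using circular_qcnj[OF assms(2) xJ J] by simp
    obtain a b where ab: "f (of_real x + J * of_real y) = of_real a + J * of_real b"
      using sp J xJ unfolding slice_plane_def by blast
    obtain c d where cd: "f (of_real x + J * of_real (- y)) = of_real c + J * of_real d"
      using sp J xJ' unfolding slice_plane_def by blast
    have cd': "f (of_real x - J * of_real y) = of_real c + J * of_real d" using cd by simp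
    have s1: "stem1 f J (x, y) = F1 x y" and s2: "stem2 f J (x, y) = F2 x y"
      using stem_of_slice_function[OF J xJ assms(2) F] by blast+
    have "stem1 f J (x, y) = of_real ((a + c) / 2) + J * of_real ((b + d) / 2)"
      unfolding stem1_def prod.case ab cd'
      unfolding quat_eq_iff quat_simps quat_of_real_simps by (simp add: field_simps)
    moreover have "stem2 f J (x, y) = of_real ((b - d) / 2) + J * of_real ((c - a) / 2)"
    proof -
      have "(1 / 2) *\<^sub>R ((of_real a + J * of_real b) - (of_real c + J * of_real d)) =
          of_real ((a - c) / 2) + J * of_real ((b - d) / 2)"
        unfolding quat_eq_iff quat_simps quat_of_real_simps by (simp add: field_simps)
      hence "stem2 f J (x, y) =
          (of_real 0 + J * of_real (-1)) * (of_real ((a - c) / 2) + J * of_real ((b - d) / 2))"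
        by (simp only: stem2_def prod.case ab cd') simp
      also have "\<dots> = of_real ((b - d) / 2) + J * of_real ((c - a) / 2)"
        unfolding slice_plane_mult[OF J]
        by (rule arg_cong2[where f = "\<lambda>u v. of_real u + J * of_real v"]) (simp_all add: field_simps)
      finally show ?thesis .
    qed
    ultimately show ?thesis unfolding slice_plane_def s1 s2 by blast
  qed
  have R: "\<exists>r. z = of_real r" if "z \<in> slice_plane quat_i" "z \<in> slice_plane quat_j" for z
    using that unfolding slice_plane_def by (intro exI[of _ "qRe z"]) (auto simp: quat_eq_iff)
  obtain a b where ab: "F1 x y = of_real a" "F2 x y = of_real b"
    using R *[OF quat_i_unit] *[OF quat_j_unit] by blast
  have "of_real x + I * of_real (- y) \<in> U" using circular_qcnj[OF assms(2,3,4)] by simp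
  from F(3)[OF assms(4) this] F(3)[OF assms(4,3)] show ?thesis
    by (intro exI[of _ a] exI[of _ b]) (simp add: ab F)
qed

lemma stem_decomposition_unique:
  assumes W: "circular W" "q \<in> W"
    and reg: "\<And>l. l \<in> {f0, f1, f2, f3, g0, g1, g2, g3} \<Longrightarrow> l \<in> SR W"
    and sp: "\<And>l. l \<in> {f0, f1, f2, f3, g0, g1, g2, g3} \<Longrightarrow>
               \<forall>I\<in>\<S>. l ` (W \<inter> slice_plane I) \<subseteq> slice_plane I"
    and eq: "\<And>q. q \<in> W \<Longrightarrow>
               f0 q + f1 q * quat_i + f2 q * quat_j + f3 q * quat_k =
               g0 q + g1 q * quat_i + g2 q * quat_j + g3 q * quat_k"
  shows "f0 q = g0 q \<and> f1 q = g1 q \<and> f2 q = g2 q \<and> f3 q = g3 q"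
proof -
  obtain s t I where I: "I \<in> \<S>" and q: "q = of_real s + I * of_real t" by (rule quat_slice_cases)
  define q' where "q' = of_real s - I * of_real t"
  have q': "q' \<in> W" using circular_qcnj[OF W(1) _ I] W(2) unfolding q q'_def by blast
  have II: "I * (I * a) = - a" for a using imag_unit_mult[OF I] by (simp flip: mult.assoc)
  have ex: "\<exists>a b. l q = of_real a + I * of_real b \<and> l q' = of_real a - I * of_real b"
    if "l \<in> {f0, f1, f2, f3, g0, g1, g2, g3}" for l
    using slice_preserving_stem[OF _ W(1) _ I sp[OF that]] reg[OF that] W(2)
    unfolding q'_def q SR_def by blast
  obtain a0 b0 where 0: "f0 q = of_real a0 + I * of_real b0" "f0 q' = of_real a0 - I * of_real b0"
    using ex[of f0] by blast
  obtain a1 b1 where 1: "f1 q = of_real a1 + I * of_real b1" "f1 q' = of_real a1 - I * of_real b1"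
    using ex[of f1] by blast
  obtain a2 b2 where 2: "f2 q = of_real a2 + I * of_real b2" "f2 q' = of_real a2 - I * of_real b2"
    using ex[of f2] by blast
  obtain a3 b3 where 3: "f3 q = of_real a3 + I * of_real b3" "f3 q' = of_real a3 - I * of_real b3"
    using ex[of f3] by blast
  obtain c0 d0 where 4: "g0 q = of_real c0 + I * of_real d0" "g0 q' = of_real c0 - I * of_real d0"
    using ex[of g0] by blast
  obtain c1 d1 where 5: "g1 q = of_real c1 + I * of_real d1" "g1 q' = of_real c1 - I * of_real d1"
    using ex[of g1] by blast
  obtain c2 d2 where 6: "g2 q = of_real c2 + I * of_real d2" "g2 q' = of_real c2 - I * of_real d2"
    using ex[of g2] by blast
  obtain c3 d3 where 7: "g3 q = of_real c3 + I * of_real d3" "g3 q' = of_real c3 - I * of_real d3"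
    using ex[of g3] by blast
  let ?A = "Quat a0 a1 a2 a3" and ?B = "Quat b0 b1 b2 b3"
    and ?C = "Quat c0 c1 c2 c3" and ?E = "Quat d0 d1 d2 d3"
  have 8: "?A + I * ?B = ?C + I * ?E"
    using eq[OF W(2)] unfolding 0 1 2 3 4 5 6 7
    by (simp add: quat_eq_iff imag_unit_re[OF I] algebra_simps)
  have 9: "?A - I * ?B = ?C - I * ?E"
    using eq[OF q'] unfolding 0 1 2 3 4 5 6 7
    by (simp add: quat_eq_iff imag_unit_re[OF I] algebra_simps)
  have half: "Z = X" if "Z + Y = X + T" "Z - Y = X - T" for Z Y X T :: quat
  proof -
    have "(Z + Y) + (Z - Y) = (X + T) + (X - T)" using that by simp
    hence "Z + Z = X + X" by simp
    thus ?thesis by (simp add: quat_eq_iff)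
  qed
  have A: "?A = ?C" using half[OF 8 9] .
  hence *: "I * ?B = I * ?E" using 8 by simp
  have "?B = ?E" using arg_cong[OF *, of "\<lambda>z. I * z"] unfolding II by simp
  with A show ?thesis by (simp add: 0 1 2 3 4 5 6 7)
qed

theorem sem_decomp_unique:
  assumes "sem_decomp \<Omega> f (f0, f1, f2, f3)" "sem_decomp \<Omega> f (g0, g1, g2, g3)"
  shows "sem_eq \<Omega> f0 g0 \<and> sem_eq \<Omega> f1 g1 \<and> sem_eq \<Omega> f2 g2 \<and> sem_eq \<Omega> f3 g3"
proof -
  let ?F = "{f0, f1, f2, f3, g0, g1, g2, g3}"
  have "\<forall>l\<in>?F. \<exists>U. regular_off_poles \<Omega> l U \<and> (\<forall>I\<in>\<S>. l ` (U \<inter> slice_plane I) \<subseteq> slice_plane I)"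
    using assms unfolding sem_decomp_def SEM_R_def by auto
  then obtain W where W: "\<And>l. l \<in> ?F \<Longrightarrow> regular_off_poles \<Omega> l (W l)"
    "\<And>l. l \<in> ?F \<Longrightarrow> \<forall>I\<in>\<S>. l ` (W l \<inter> slice_plane I) \<subseteq> slice_plane I"
    by metis
  define F where "F = (\<lambda>q. f0 q + f1 q * quat_i + f2 q * quat_j + f3 q * quat_k)"
  define G where "G = (\<lambda>q. g0 q + g1 q * quat_i + g2 q * quat_j + g3 q * quat_k)"
  have "sem_eq \<Omega> f F" "sem_eq \<Omega> f G"
    using assms unfolding sem_decomp_def F_def G_def by auto
  then obtain U V U' V' where UV: "regular_off_poles \<Omega> f U" "regular_off_poles \<Omega> F V"
    "regular_off_poles \<Omega> f U'" "regular_off_poles \<Omega> G V'"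
    "\<forall>q\<in>U \<inter> V. f q = F q" "\<forall>q\<in>U' \<inter> V'. f q = G q"
    unfolding sem_eq_def by blast
  define X where "X = U \<inter> V \<inter> U' \<inter> V' \<inter> W f0 \<inter> W f1 \<inter> W f2 \<inter> W f3 \<inter> W g0 \<inter> W g1 \<inter> W g2 \<inter> W g3"
  have i: "regular_off_poles \<Omega> f (Y \<inter> W l)" if "regular_off_poles \<Omega> f Y" "l \<in> ?F" for Y l
    using regular_off_poles_Int[OF that(1) W(1)[OF that(2)]] .
  have "regular_off_poles \<Omega> f (U \<inter> V \<inter> U' \<inter> V')"
    using regular_off_poles_Int[OF regular_off_poles_Int[OF regular_off_poles_Int[OF UV(1,2)] UV(3)] UV(4)] .
  hence fX: "regular_off_poles \<Omega> f X"
    unfolding X_def by (intro i) simp_all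
  have reg: "regular_off_poles \<Omega> l X" if "l \<in> ?F" for l
  proof -
    have "W l \<inter> X = X" using that unfolding X_def by auto
    thus ?thesis using regular_off_poles_Int[OF W(1)[OF that] fX] by simp
  qed
  have XW: "X \<subseteq> W l" if "l \<in> ?F" for l using that unfolding X_def by auto
  have "f0 q = g0 q \<and> f1 q = g1 q \<and> f2 q = g2 q \<and> f3 q = g3 q" if "q \<in> X" for q
  proof (rule stem_decomposition_unique[OF _ that])
    show "circular X" using fX unfolding regular_off_poles_def by blast
    show "l \<in> SR X" if "l \<in> ?F" for l using reg[OF that] unfolding regular_off_poles_def by blast
    show "\<forall>I\<in>\<S>. l ` (X \<inter> slice_plane I) \<subseteq> slice_plane I" if "l \<in> ?F" for l
    proof
      fix I assume "I \<in> \<S>"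
      have "l ` (X \<inter> slice_plane I) \<subseteq> l ` (W l \<inter> slice_plane I)"
        using XW[OF that] by (intro image_mono Int_mono order_refl)
      also have "\<dots> \<subseteq> slice_plane I" using W(2)[OF that] \<open>I \<in> \<S>\<close> by (rule bspec)
      finally show "l ` (X \<inter> slice_plane I) \<subseteq> slice_plane I" .
    qed
    show "f0 q + f1 q * quat_i + f2 q * quat_j + f3 q * quat_k =
          g0 q + g1 q * quat_i + g2 q * quat_j + g3 q * quat_k" if "q \<in> X" for q
    proof -
      have "q \<in> U \<inter> V" "q \<in> U' \<inter> V'" using that unfolding X_def by auto
      hence "F q = G q" using UV(5,6) by metis
      thus ?thesis by (simp only: F_def G_def)
    qed
  qed
  hence "sem_eq \<Omega> f0 g0" "sem_eq \<Omega> f1 g1" "sem_eq \<Omega> f2 g2" "sem_eq \<Omega> f3 g3"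
    unfolding sem_eq_def by (intro exI[of _ X] conjI ballI reg; simp)+
  thus ?thesis by blast
qed

end

theory Submission
  imports Defs "HOL-Complex_Analysis.Complex_Analysis"
begin

text \<open>
On the slice of an imaginary unit \<open>I\<close> a slice function reads \<open>f (x + I y) = P + I Q\<close>, where \<open>P\<close> and
\<open>Q\<close> depend on \<open>x\<close> and \<open>y\<close> but not on \<open>I\<close>. Replacing \<open>I\<close> by the complex unit, which commutes with
everything, turns \<open>f\<close> into a function of \<open>z = x + \<i> y\<close> with values in the biquaternions, the
quaternions with complex coefficients. Under this dictionary slice regular functions have
holomorphic coordinates and semi-regular functions have meromorphic ones (\<open>blift_SR\<close>,
\<open>regular_off_polesI\<close>, \<open>regular_off_poles_stem_of\<close>), the star product becomes the pointwise product
(\<open>star_prod_blift\<close>), and the slice preserving functions are those with scalar values. So the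
semi-regular functions form the quaternion algebra over the ring of meromorphic functions \<open>\<phi>\<close>, on the
set of all \<open>x + \<i> y\<close> with \<open>x + I y \<in> \<Omega>\<close>, that satisfy \<open>\<phi> (cnj z) = cnj (\<phi> z)\<close>. This ring is a field:
connectedness of \<open>\<Omega>\<close> gives the identity principle \<open>stem_coord_zero_or_nonzero\<close>, even when \<open>\<Omega>\<close> misses
the real axis and the planar set falls into two conjugate halves. Every assertion about semi-regular
functions thereby becomes an identity between biquaternions at generic points.

Conjugation by an invertible \<open>h\<close> preserves the scalar part and the norm form of the vector part. If
\<open>g\<close> preserves the slice of \<open>I\<close>, its vector part is \<open>\<phi> I\<close> with norm \<open>\<phi>\<^sup>2\<close>; so a function equivalent to
\<open>g\<close> has a vector part whose norm is a square. Conversely, let \<open>a\<close> and \<open>b\<close> have the same scalar part and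
vector parts of the same norm \<open>n\<close>. Since both vector parts square to \<open>- n\<close>, each element
\<open>h = b\<^sub>v u + u a\<^sub>v\<close> satisfies \<open>h a = b h\<close>, and the norms of these elements for \<open>u = 1, i, j, k\<close> add up to
\<open>8 n\<close>. If \<open>n\<close> is not identically zero, one of the four is invertible and \<open>a\<close>, \<open>b\<close> are equivalent
(\<open>sem_equivalent_of_equal_norms\<close>). When \<open>n = r\<^sup>2\<close> this applies to \<open>f\<close> and \<open>f\<^sub>0 + r i\<close>. It also applies
to two idempotents: in the absence of zero divisors among the scalars, an idempotent other than \<open>0\<close>
and \<open>1\<close> has scalar part \<open>1 / 2\<close> and a vector part of norm \<open>- 1 / 4\<close>.
\<close>

section \<open>Biquaternions\<close>

text \<open>The complexified quaternions. Their complex unit commutes with every element, unlike the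
  imaginary units of the quaternions themselves.\<close>
datatype biquat = Biquat (bq0: complex) (bq1: complex) (bq2: complex) (bq3: complex)

lemma biquat_eq_iff:
  "a = b \<longleftrightarrow> bq0 a = bq0 b \<and> bq1 a = bq1 b \<and> bq2 a = bq2 b \<and> bq3 a = bq3 b"
  by (cases a; cases b) auto

instantiation biquat :: ring_1
begin
definition "0 = Biquat 0 0 0 0"
definition "1 = Biquat 1 0 0 0"
definition "- a = Biquat (- bq0 a) (- bq1 a) (- bq2 a) (- bq3 a)"
definition "a + b = Biquat (bq0 a + bq0 b) (bq1 a + bq1 b) (bq2 a + bq2 b) (bq3 a + bq3 b)"
definition "(a :: biquat) - b =
  Biquat (bq0 a - bq0 b) (bq1 a - bq1 b) (bq2 a - bq2 b) (bq3 a - bq3 b)"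
definition "a * b = Biquat
    (bq0 a * bq0 b - bq1 a * bq1 b - bq2 a * bq2 b - bq3 a * bq3 b)
    (bq0 a * bq1 b + bq1 a * bq0 b + bq2 a * bq3 b - bq3 a * bq2 b)
    (bq0 a * bq2 b - bq1 a * bq3 b + bq2 a * bq0 b + bq3 a * bq1 b)
    (bq0 a * bq3 b + bq1 a * bq2 b - bq2 a * bq1 b + bq3 a * bq0 b)"
instance
  by standard
    (simp_all add: biquat_eq_iff zero_biquat_def one_biquat_def uminus_biquat_def plus_biquat_def
      minus_biquat_def times_biquat_def algebra_simps)
end

lemma biquat_simps [simp]:
  "bq0 0 = 0" "bq1 0 = 0" "bq2 0 = 0" "bq3 0 = 0"
  "bq0 1 = 1" "bq1 1 = 0" "bq2 1 = 0" "bq3 1 = 0"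
  "bq0 (- a) = - bq0 a" "bq1 (- a) = - bq1 a" "bq2 (- a) = - bq2 a" "bq3 (- a) = - bq3 a"
  "bq0 (a + b) = bq0 a + bq0 b" "bq1 (a + b) = bq1 a + bq1 b"
  "bq2 (a + b) = bq2 a + bq2 b" "bq3 (a + b) = bq3 a + bq3 b"
  "bq0 (a - b) = bq0 a - bq0 b" "bq1 (a - b) = bq1 a - bq1 b"
  "bq2 (a - b) = bq2 a - bq2 b" "bq3 (a - b) = bq3 a - bq3 b"
  "bq0 (a * b) = bq0 a * bq0 b - bq1 a * bq1 b - bq2 a * bq2 b - bq3 a * bq3 b"
  "bq1 (a * b) = bq0 a * bq1 b + bq1 a * bq0 b + bq2 a * bq3 b - bq3 a * bq2 b"
  "bq2 (a * b) = bq0 a * bq2 b - bq1 a * bq3 b + bq2 a * bq0 b + bq3 a * bq1 b"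
  "bq3 (a * b) = bq0 a * bq3 b + bq1 a * bq2 b - bq2 a * bq1 b + bq3 a * bq0 b"
  by (simp_all add: zero_biquat_def one_biquat_def uminus_biquat_def plus_biquat_def
      minus_biquat_def times_biquat_def)

definition bscalar :: "complex \<Rightarrow> biquat" where
  "bscalar c = Biquat c 0 0 0"

lemma bscalar_simps [simp]:
  "bq0 (bscalar c) = c" "bq1 (bscalar c) = 0" "bq2 (bscalar c) = 0" "bq3 (bscalar c) = 0"
  by (simp_all add: bscalar_def)

definition bconj :: "biquat \<Rightarrow> biquat" where
  "bconj b = Biquat (bq0 b) (- bq1 b) (- bq2 b) (- bq3 b)"

lemma bconj_simps [simp]:
  "bq0 (bconj b) = bq0 b" "bq1 (bconj b) = - bq1 b"
  "bq2 (bconj b) = - bq2 b" "bq3 (bconj b) = - bq3 b"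
  by (simp_all add: bconj_def)

text \<open>The norm form of the complexified algebra: it is complex valued and isotropic, so a nonzero
  biquaternion of norm zero exists and invertibility means \<open>bnorm b \<noteq> 0\<close>.\<close>
definition bnorm :: "biquat \<Rightarrow> complex" where
  "bnorm b = (bq0 b)\<^sup>2 + (bq1 b)\<^sup>2 + (bq2 b)\<^sup>2 + (bq3 b)\<^sup>2"

definition bvec :: "biquat \<Rightarrow> biquat" where
  "bvec b = Biquat 0 (bq1 b) (bq2 b) (bq3 b)"

lemma bvec_simps [simp]:
  "bq0 (bvec b) = 0" "bq1 (bvec b) = bq1 b" "bq2 (bvec b) = bq2 b" "bq3 (bvec b) = bq3 b"
  by (simp_all add: bvec_def)

text \<open>Complex conjugation of the coefficients, as opposed to the quaternionic conjugation
  \<open>bconj\<close>.\<close>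
definition bcnj :: "biquat \<Rightarrow> biquat" where
  "bcnj b = Biquat (cnj (bq0 b)) (cnj (bq1 b)) (cnj (bq2 b)) (cnj (bq3 b))"

lemma bcnj_simps [simp]:
  "bq0 (bcnj b) = cnj (bq0 b)" "bq1 (bcnj b) = cnj (bq1 b)"
  "bq2 (bcnj b) = cnj (bq2 b)" "bq3 (bcnj b) = cnj (bq3 b)"
  by (simp_all add: bcnj_def)

lemma mult_bconj: "b * bconj b = bscalar (bnorm b)" "bconj b * b = bscalar (bnorm b)"
  by (simp_all add: biquat_eq_iff bnorm_def power2_eq_square)

lemma bnorm_mult: "bnorm (a * b) = bnorm a * bnorm b"
  unfolding bnorm_def biquat_simps by algebra

definition binverse :: "biquat \<Rightarrow> biquat" where
  "binverse b = bscalar (inverse (bnorm b)) * bconj b"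

lemma binverse_mult: "bnorm b \<noteq> 0 \<Longrightarrow> binverse b * b = 1"
  by (simp add: binverse_def mult.assoc mult_bconj) (simp add: biquat_eq_iff)

lemma binverse_conjugation_iff:
  assumes "bnorm h \<noteq> 0"
  shows "a = binverse h * b * h \<longleftrightarrow> h * a = b * h"
proof
  have r: "h * binverse h = 1"
  proof -
    have "h * (bscalar c * x) = bscalar c * (h * x)" for c x
      by (simp add: biquat_eq_iff algebra_simps)
    thus ?thesis using assms by (simp add: binverse_def mult_bconj) (simp add: biquat_eq_iff)
  qed
  show "h * a = b * h" if "a = binverse h * b * h"
    using r that by (simp flip: mult.assoc)
  show "a = binverse h * b * h" if "h * a = b * h"
    using binverse_mult[OF assms] that by (metis mult.assoc mult_1)
qed

text \<open>Conjugate elements have equal norms because the norm is multiplicative, and equal scalar parts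
  because the scalar part is a trace. The norm of the vector part is the difference of the norm and
  the square of the scalar part.\<close>
lemma bnorm_bvec_conjugate:
  assumes h: "bnorm h \<noteq> 0" and "h * a = b * h"
  shows "bnorm (bvec a) = bnorm (bvec b)"
proof -
  have bn: "bnorm h * bnorm a = bnorm b * bnorm h"
    using arg_cong[OF assms(2), of bnorm] by (simp add: bnorm_mult)
  have "bconj h * (h * a) = bconj h * b * h" using assms(2) by (simp add: mult.assoc)
  hence "bscalar (bnorm h) * a = bconj h * b * h" by (simp add: mult_bconj flip: mult.assoc)
  hence "bnorm h * bq0 a = bq0 (bconj h * b * h)" by (metis biquat_simps(21) bscalar_simps diff_zero mult_zero_left)
  also have "\<dots> = bnorm h * bq0 b" 
    unfolding bnorm_def by (simp add: power2_eq_square algebra_simps)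
  finally have "bq0 a = bq0 b" using h by simp
  moreover have "bnorm a = bnorm b" using bn h by simp
  ultimately show ?thesis by (simp add: bnorm_def add.assoc)
qed

definition bi :: biquat where "bi = Biquat 0 1 0 0"
definition bj :: biquat where "bj = Biquat 0 0 1 0"
definition bk :: biquat where "bk = Biquat 0 0 0 1"

text \<open>The scalar parts are central and equal, so only the vector parts matter. They have the same
  square, a scalar, and both products equal \<open>b\<^sub>v u a\<^sub>v\<close> plus that scalar times \<open>u\<close>.\<close>
lemma intertwiner_conjugates:
  assumes "bq0 a = bq0 b" "bnorm (bvec a) = bnorm (bvec b)"
  shows "(bvec b * u + u * bvec a) * a = b * (bvec b * u + u * bvec a)"
proof -
  have dec: "x = bscalar (bq0 x) + bvec x" for x by (simp add: biquat_eq_iff)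
  have sq: "bvec x * bvec x = bscalar (- bnorm (bvec x))" for x
    by (simp add: biquat_eq_iff bnorm_def power2_eq_square)
  have c: "x * bscalar s = bscalar s * x" for x s by (simp add: biquat_eq_iff mult.commute)
  let ?h = "bvec b * u + u * bvec a"
  have "?h * bvec a = bvec b * u * bvec a + u * (bvec a * bvec a)"
    by (simp add: distrib_right mult.assoc)
  also have "\<dots> = bvec b * u * bvec a + (bvec b * bvec b) * u"
    by (simp add: sq c assms(2))
  also have "\<dots> = bvec b * ?h" by (simp add: distrib_left mult.assoc)
  finally have "?h * bvec a = bvec b * ?h" .
  moreover have "?h * bscalar (bq0 a) = bscalar (bq0 b) * ?h"
    by (simp only: c assms(1))
  ultimately have "?h * (bscalar (bq0 a) + bvec a) = (bscalar (bq0 b) + bvec b) * ?h"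
    by (simp only: distrib_left[of ?h] distrib_right[of _ _ ?h])
  thus ?thesis using dec by metis
qed

text \<open>For a single \<open>u\<close> the intertwiner may have norm zero: take \<open>u = 1\<close> and vector parts that are
  opposite. On average it does not: up to a factor the mixed terms pair \<open>b\<^sub>v\<close> with the sum of
  all \<open>u a\<^sub>v u\<^sup>c\<close>, which is four times the scalar part of \<open>a\<^sub>v\<close> and hence zero.\<close>
lemma intertwiner_norm_sum:
  assumes "bnorm (bvec a) = \<rho>" "bnorm (bvec b) = \<rho>"
  shows "(\<Sum>u\<leftarrow>[1, bi, bj, bk]. bnorm (bvec b * u + u * bvec a)) = 8 * \<rho>"
proof -
  have "(\<Sum>u\<leftarrow>[1, bi, bj, bk]. bnorm (bvec b * u + u * bvec a)) = 
    4 * (bnorm (bvec a) + bnorm (bvec b))"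
    unfolding bnorm_def by (simp add: bi_def bj_def bk_def power2_eq_square algebra_simps)
  thus ?thesis using assms by simp
qed

subsection \<open>Evaluation at an imaginary unit\<close>

definition bRe :: "biquat \<Rightarrow> quat" where
  "bRe b = Quat (Re (bq0 b)) (Re (bq1 b)) (Re (bq2 b)) (Re (bq3 b))"

definition bIm :: "biquat \<Rightarrow> quat" where
  "bIm b = Quat (Im (bq0 b)) (Im (bq1 b)) (Im (bq2 b)) (Im (bq3 b))"

text \<open>The complex unit is replaced by left multiplication by \<open>I\<close>.\<close>
definition beval :: "quat \<Rightarrow> biquat \<Rightarrow> quat" where
  "beval I b = bRe b + I * bIm b"

lemma bRe_bIm_mult:
  "bRe (a * b) = bRe a * bRe b - bIm a * bIm b" "bIm (a * b) = bRe a * bIm b + bIm a * bRe b"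
  by (simp_all add: quat_eq_iff bRe_def bIm_def algebra_simps)

lemma bRe_bIm_linear:
  "bRe (a + b) = bRe a + bRe b" "bIm (a + b) = bIm a + bIm b"
  "bRe (a - b) = bRe a - bRe b" "bIm (a - b) = bIm a - bIm b"
  by (simp_all add: quat_eq_iff bRe_def bIm_def)

lemma beval_add: "beval I (a + b) = beval I a + beval I b"
  and beval_diff: "beval I (a - b) = beval I a - beval I b"
  by (simp_all add: beval_def bRe_bIm_linear algebra_simps)

text \<open>Evaluation is not multiplicative because \<open>I\<close> does not commute with the value of the left
  factor. This defect is exactly what the rotated argument in the star product compensates.\<close>
lemma beval_mult:
  assumes "I \<in> \<S>"
  shows "beval I (a * b) = beval I a * bRe b + I * beval I a * bIm b"
  using imag_unit_mult2[OF assms]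
  by (simp add: beval_def bRe_bIm_mult algebra_simps flip: mult.assoc)

lemma beval_bscalar: "beval I (bscalar c) = of_real (Re c) + I * of_real (Im c)"
  by (simp add: beval_def bRe_def bIm_def quat_eq_iff)

lemma beval_bscalar_mult:
  assumes "I \<in> \<S>"
  shows "beval I (bscalar c * b) = beval I (bscalar c) * beval I b"
proof -
  have c: "x * of_real r = of_real r * x" for r and x :: quat by (simp add: quat_eq_iff)
  have "beval I (bscalar c * b) = beval I (bscalar c) * bRe b + (I * beval I (bscalar c)) * bIm b"
    by (rule beval_mult[OF assms])
  also have "I * beval I (bscalar c) = beval I (bscalar c) * I"
    unfolding beval_bscalar by (simp add: algebra_simps c flip: mult.assoc)
  finally show ?thesis by (simp add: beval_def[of I b] algebra_simps)
qed

section \<open>Stem functions with biquaternion values\<close>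

text \<open>The representative in the closed upper half plane of the sphere of \<open>q\<close>.\<close>
definition slice_coord :: "quat \<Rightarrow> complex" where
  "slice_coord q = Complex (qRe q) (vec_norm q)"

text \<open>The slice of \<open>quat_i\<close> serves as reference; for circular sets every slice gives the same planar
  set.\<close>
definition slice_set :: "quat set \<Rightarrow> complex set" where
  "slice_set U = {z. of_real (Re z) + quat_i * of_real (Im z) \<in> U}"

definition blift :: "(complex \<Rightarrow> biquat) \<Rightarrow> quat \<Rightarrow> quat" where
  "blift B q = beval (vec_dir q) (B (slice_coord q))"

text \<open>The real part of such a stem is even in \<open>y\<close> and its imaginary part is odd.\<close>
definition bsymmetric :: "(complex \<Rightarrow> biquat) \<Rightarrow> bool" where
  "bsymmetric B \<longleftrightarrow> (\<forall>z. B (cnj z) = bcnj (B z))"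

lemma slice_coord_slice:
  assumes "I \<in> \<S>"
  shows "slice_coord (of_real x + I * of_real y) = Complex x \<bar>y\<bar>"
  using vec_norm_slice[OF assms] imag_unit_re[OF assms] by (simp add: slice_coord_def)

lemma mem_slice_set_iff:
  assumes "circular U" "I \<in> \<S>"
  shows "Complex x y \<in> slice_set U \<longleftrightarrow> of_real x + I * of_real y \<in> U"
  using circularD[OF assms(1)] assms(2) quat_i_unit unfolding slice_set_def by auto

lemma cnj_mem_slice_set:
  assumes "circular U" "z \<in> slice_set U"
  shows "cnj z \<in> slice_set U"
  using assms circular_qcnj[OF assms(1) _ quat_i_unit] unfolding slice_set_def by simp

lemma slice_coord_mem_iff:
  assumes "circular U"
  shows "slice_coord q \<in> slice_set U \<longleftrightarrow> q \<in> U"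
  using mem_slice_set_iff[OF assms vec_dir_unit, of "qRe q" "vec_norm q" q] quat_slice_repr[of q]
  by (simp add: slice_coord_def)

lemma slice_set_slice_coord_or_cnj:
  assumes "circular U" "z \<in> slice_set U"
  obtains q where "q \<in> U" "slice_coord q = z \<or> slice_coord q = cnj z"
proof
  show "of_real (Re z) + quat_i * of_real (Im z) \<in> U"
    using assms by (simp add: slice_set_def)
  show "slice_coord (of_real (Re z) + quat_i * of_real (Im z)) = z \<or>
        slice_coord (of_real (Re z) + quat_i * of_real (Im z)) = cnj z"
    unfolding slice_coord_slice[OF quat_i_unit] by (auto simp: complex_eq_iff)
qed

lemma continuous_slice_coord: "continuous_on A slice_coord"
proof -
  note [continuous_intros] = bounded_linear_coords[THEN bounded_linear.continuous_on]
  have *: "slice_coord = (\<lambda>q. of_real (qRe q) + \<i> * of_real (vec_norm q))"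
    by (auto simp: slice_coord_def complex_eq_iff)
  show ?thesis unfolding * vec_norm_def by (intro continuous_intros)
qed

lemma open_slice_set:
  assumes "open U"
  shows "open (slice_set U)"
proof -
  have "slice_set U = (\<lambda>z. of_real (Re z) + quat_i * of_real (Im z)) -` U"
    by (auto simp: slice_set_def)
  thus ?thesis using assms by (auto intro!: open_vimage continuous_intros)
qed

lemma bsymmetricD: "bsymmetric B \<Longrightarrow> B (cnj z) = bcnj (B z)"
  by (simp add: bsymmetric_def)

lemma beval_bcnj: "beval I (bcnj b) = beval (- I) b"
  by (simp add: beval_def bRe_def bIm_def quat_eq_iff)

text \<open>The definition of \<open>blift\<close> only looks at the closed upper half plane. Symmetry carries the formula
  over to negative \<open>y\<close>, where both the unit and the coordinate are conjugated, and to real points,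
  where \<open>vec_dir\<close> is an arbitrary unit but the imaginary part of the stem vanishes.\<close>
lemma blift_slice:
  assumes "bsymmetric B" "I \<in> \<S>"
  shows "blift B (of_real x + I * of_real y) = beval I (B (Complex x y))"
proof -
  let ?q = "of_real x + I * of_real y :: quat"
  note z = slice_coord_slice[OF assms(2), of x y]
  consider "y = 0" | "y > 0" | "y < 0" by linarith
  thus ?thesis
  proof cases
    case 1
    have "B (Complex x 0) = bcnj (B (Complex x 0))"
      using bsymmetricD[OF assms(1), of "Complex x 0"] by (simp add: complex_cnj)
    hence "bIm (B (Complex x 0)) = 0" by (simp add: bIm_def biquat_eq_iff quat_eq_iff complex_eq_iff)
    thus ?thesis using z by (simp add: blift_def beval_def 1)
  next
    case 2
    thus ?thesis using vec_dir_slice[OF assms(2), of y x] by (simp add: blift_def z)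
  next
    case 3
    have "B (Complex x (- y)) = bcnj (B (Complex x y))"
      using bsymmetricD[OF assms(1), of "Complex x y"] by (simp add: complex_cnj)
    thus ?thesis using 3 vec_dir_slice[OF assms(2), of y x] by (simp add: blift_def z beval_bcnj)
  qed
qed

text \<open>The values at \<open>x + I y\<close> and \<open>x - I y\<close> together determine both parts of the stem.\<close>
lemma blift_inject:
  assumes "circular U" "bsymmetric B" "bsymmetric C" "z \<in> slice_set U"
    and eq: "\<And>q. q \<in> U \<Longrightarrow> blift B q = blift C q"
  shows "B z = C z"
proof -
  have z: "z = Complex (Re z) (Im z)" by simp
  have e: "beval I (B z) = beval I (C z)" if "I \<in> \<S>" for I
    using eq[of "of_real (Re z) + I * of_real (Im z)"] mem_slice_set_iff[OF assms(1) that] assms(4)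
      blift_slice[OF assms(2) that] blift_slice[OF assms(3) that] z by metis
  have e1: "bRe (B z) + quat_i * bIm (B z) = bRe (C z) + quat_i * bIm (C z)"
    using e[OF quat_i_unit] by (simp add: beval_def)
  have e2: "bRe (B z) - quat_i * bIm (B z) = bRe (C z) - quat_i * bIm (C z)"
    using e[OF imag_unit_uminus[OF quat_i_unit]] by (simp add: beval_def)
  show ?thesis using e1 e2 by (simp add: bRe_def bIm_def biquat_eq_iff complex_eq_iff quat_eq_iff)
qed

lemma blift_add: "blift (\<lambda>z. B z + C z) q = blift B q + blift C q"
  and blift_diff: "blift (\<lambda>z. B z - C z) q = blift B q - blift C q"
  by (simp_all add: blift_def beval_add beval_diff)

lemma blift_bscalar_mult:
  "blift (\<lambda>z. bscalar (c z) * B z) q = blift (\<lambda>z. bscalar (c z)) q * blift B q"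
  by (simp add: blift_def beval_bscalar_mult vec_dir_unit)

lemma blift_bscalar_power:
  "blift (\<lambda>z. bscalar (c z ^ m)) q = blift (\<lambda>z. bscalar (c z)) q ^ m"
proof (induction m)
  case 0
  show ?case by (simp add: blift_def beval_bscalar)
next
  case (Suc m)
  have "bscalar (c z ^ Suc m) = bscalar (c z) * bscalar (c z ^ m)" for z
    by (simp add: biquat_eq_iff)
  thus ?case using Suc by (simp add: blift_bscalar_mult)
qed

lemma blift_bscalar_inverse:
  "blift (\<lambda>z. bscalar (inverse (c z))) q = inverse (blift (\<lambda>z. bscalar (c z)) q)"
proof (cases "c (slice_coord q) = 0")
  case True
  thus ?thesis by (simp add: blift_def beval_bscalar)
next
  case False
  have "blift (\<lambda>z. bscalar (inverse (c z)) * bscalar (c z)) q = 1"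
    using False by (simp add: blift_def beval_def bRe_def bIm_def quat_eq_iff)
  thus ?thesis unfolding blift_bscalar_mult by (metis inverse_unique inverse_inverse_eq)
qed

text \<open>With \<open>a = f q\<close>, the rotation \<open>a\<^sup>-\<^sup>1 q a\<close> has the same coordinate as \<open>q\<close> and the unit
  \<open>J = a\<^sup>-\<^sup>1 I a\<close>. Since \<open>a J = I a\<close>, multiplication by \<open>a\<close> moves the unit back to the left, where
  \<open>beval_mult\<close> puts it.\<close>
lemma star_prod_blift:
  assumes "circular U" "q \<in> U" "bsymmetric C"
    and f: "f q = blift B q" and g: "\<And>q. q \<in> U \<Longrightarrow> g q = blift C q"
  shows "(f \<star> g) q = blift (\<lambda>z. B z * C z) q"
proof -
  define I where "I = vec_dir q"
  define x y where "x = qRe q" and "y = vec_norm q"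
  have I: "I \<in> \<S>" and q: "q = of_real x + I * of_real y"
    unfolding I_def x_def y_def by (rule vec_dir_unit, rule quat_slice_repr)
  define a where "a = f q"
  have a: "a = beval I (B (slice_coord q))" by (simp add: a_def f blift_def I_def)
  have z: "slice_coord q = Complex x y" by (simp add: slice_coord_def x_def y_def)
  have r: "blift (\<lambda>z. B z * C z) q = a * bRe (C (Complex x y)) + I * a * bIm (C (Complex x y))"
    unfolding blift_def I_def[symmetric] beval_mult[OF I] a[symmetric] by (simp add: z)
  show ?thesis
  proof (cases "a = 0")
    case True
    thus ?thesis by (simp add: r) (simp add: star_prod_def a_def)
  next
    case False
    define J where "J = inverse a * I * a"
    have "J * J = inverse a * I * (a * inverse a) * I * a" by (simp add: J_def mult.assoc)
    also have "\<dots> = inverse a * (I * I) * a" using False by (simp add: mult.assoc)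
    also have "\<dots> = -1" using False imag_unit_mult[OF I] by simp
    finally have J: "J \<in> \<S>" by (simp add: quat_imag_units_def power2_eq_square)
    have c: "s * of_real r = of_real r * s" for r and s :: quat by (simp add: quat_eq_iff)
    have "inverse a * q * a = inverse a * (of_real x * a) + inverse a * (I * (of_real y * a))"
      unfolding q by (simp add: distrib_left distrib_right mult.assoc)
    also have "\<dots> = inverse a * a * of_real x + J * of_real y"
      unfolding J_def c[symmetric] by (simp add: mult.assoc)
    finally have "inverse a * q * a = inverse a * a * of_real x + J * of_real y" .
    hence qq: "inverse a * q * a = of_real x + J * of_real y" using False by simp
    have "of_real x + J * of_real y \<in> U" using circularD[OF assms(1) _ I J] assms(2) q by blast
    hence "g (inverse a * q * a) = bRe (C (Complex x y)) + J * bIm (C (Complex x y))"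
      by (simp add: qq g blift_slice[OF assms(3) J] beval_def)
    moreover have "a * J = I * a" using False by (simp add: J_def flip: mult.assoc)
    ultimately have "a * g (inverse a * q * a) =
        a * bRe (C (Complex x y)) + I * a * bIm (C (Complex x y))"
      by (simp add: distrib_left flip: mult.assoc)
    thus ?thesis using False unfolding r star_prod_def a_def[symmetric] by simp
  qed
qed

section \<open>Slice regularity and holomorphic stems\<close>

definition stem_analytic :: "(complex \<Rightarrow> biquat) \<Rightarrow> complex set \<Rightarrow> bool" where
  "stem_analytic B A \<longleftrightarrow> (\<forall>c\<in>{bq0, bq1, bq2, bq3}. (\<lambda>z. c (B z)) analytic_on A)"

definition stem_meromorphic :: "(complex \<Rightarrow> biquat) \<Rightarrow> complex set \<Rightarrow> bool" where
  "stem_meromorphic B A \<longleftrightarrow> (\<forall>c\<in>{bq0, bq1, bq2, bq3}. (\<lambda>z. c (B z)) meromorphic_on A)"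

lemma beval_coords:
  "beval I b = beval I (bscalar (bq0 b)) + beval I (bscalar (bq1 b)) * quat_i +
     beval I (bscalar (bq2 b)) * quat_j + beval I (bscalar (bq3 b)) * quat_k"
  by (simp add: beval_def bRe_def bIm_def quat_eq_iff)

lemma beval_bscalar_has_derivative:
  assumes "(\<phi> has_field_derivative d) (at (Complex x y))"
  shows "((\<lambda>(s, t). beval I (bscalar (\<phi> (Complex s t)))) has_derivative
          (\<lambda>(s, t). beval I (bscalar (d * Complex s t)))) (at (x, y))"
proof -
  let ?c = "\<lambda>v :: real \<times> real. of_real (fst v) + \<i> * of_real (snd v)"
  have c: "Complex (fst v) (snd v) = ?c v" for v by (simp add: complex_eq_iff)
  have "(?c has_derivative ?c) (at (x, y))" by (auto intro!: derivative_eq_intros)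
  moreover have "(\<phi> has_derivative (*) d) (at (?c (x, y)))"
    using assms c[of "(x, y)"] by (simp add: has_field_derivative_def)
  ultimately have \<phi>: "((\<lambda>v. \<phi> (?c v)) has_derivative (\<lambda>v. d * ?c v)) (at (x, y))"
    by (rule has_derivative_compose)
  have "((\<lambda>v. of_real (Re (\<phi> (?c v))) + I * of_real (Im (\<phi> (?c v)))) has_derivative
      (\<lambda>v. of_real (Re (d * ?c v)) + I * of_real (Im (d * ?c v)))) (at (x, y))"
    by (intro derivative_intros has_derivative_of_real has_derivative_Re has_derivative_Im \<phi>)
  thus ?thesis unfolding case_prod_beta beval_bscalar c .
qed

text \<open>Along the slice of \<open>I\<close> every coordinate contributes the complex derivative with \<open>\<i>\<close> replaced by
  \<open>I\<close>, and differentiating in \<open>y\<close> amounts to multiplying by \<open>I\<close> on the left.\<close>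
lemma blift_SR:
  assumes U: "open U" "circular U" and B: "bsymmetric B"
    and ana: "stem_analytic B (slice_set U)" and f: "\<And>q. q \<in> U \<Longrightarrow> f q = blift B q"
  shows "f \<in> SR U"
  unfolding SR_def
proof (intro CollectI conjI)
  have e: "f (of_real x + I * of_real y) = beval I (B (Complex x y))"
    if "I \<in> \<S>" "of_real x + I * of_real y \<in> U" for x y I
    using f[OF that(2)] blift_slice[OF B that(1)] by simp
  show "is_slice_function U f"
    unfolding is_slice_function_def
  proof (rule exI[of _ "\<lambda>x y. bRe (B (Complex x y))"], rule exI[of _ "\<lambda>x y. bIm (B (Complex x y))"],
      intro conjI allI ballI impI)
    fix x y
    have "B (Complex x (- y)) = bcnj (B (Complex x y))"
      using bsymmetricD[OF B, of "Complex x y"] by (simp add: complex_cnj)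
    thus "bRe (B (Complex x (- y))) = bRe (B (Complex x y))"
      "bIm (B (Complex x (- y))) = - bIm (B (Complex x y))"
      by (simp_all add: bRe_def bIm_def quat_eq_iff)
  qed (simp add: e beval_def)
  show "slice_holomorphic U f"
    unfolding slice_holomorphic_def
  proof (intro ballI allI impI)
    fix I x y assume I: "I \<in> \<S>" and xy: "of_real x + I * of_real y \<in> U"
    let ?z = "Complex x y"
    have "\<exists>d. ((\<lambda>z. c (B z)) has_field_derivative d) (at ?z)" if "c \<in> {bq0, bq1, bq2, bq3}" for c
    proof -
      have "?z \<in> slice_set U" using mem_slice_set_iff[OF U(2) I] xy by blast
      hence "(\<lambda>z. c (B z)) field_differentiable at ?z"
        using ana that unfolding stem_analytic_def
        by (meson analytic_on_imp_differentiable_at)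
      thus ?thesis unfolding field_differentiable_def .
    qed
    then obtain d0 d1 d2 d3 where
      "((\<lambda>z. bq0 (B z)) has_field_derivative d0) (at ?z)"
      "((\<lambda>z. bq1 (B z)) has_field_derivative d1) (at ?z)"
      "((\<lambda>z. bq2 (B z)) has_field_derivative d2) (at ?z)"
      "((\<lambda>z. bq3 (B z)) has_field_derivative d3) (at ?z)" by (metis insert_iff)
    note d = this[THEN beval_bscalar_has_derivative, of I, unfolded case_prod_beta]
    define E where "E = (\<lambda>d v. beval I (bscalar (d * Complex (fst v) (snd v))))"
    define D where "D = (\<lambda>v. E d0 v + E d1 v * quat_i + E d2 v * quat_j + E d3 v * quat_k)"
    have "((\<lambda>v. beval I (B (Complex (fst v) (snd v)))) has_derivative D) (at (x, y))"
      unfolding D_def E_def beval_coords[of I "B _"]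
      by (intro has_derivative_add has_derivative_mult_left d)
    moreover have "open ((\<lambda>v. of_real (fst v) + I * of_real (snd v)) -` U)"
      using U(1) by (intro open_vimage continuous_intros)
    ultimately have "((\<lambda>v. f (of_real (fst v) + I * of_real (snd v))) has_derivative D) (at (x, y))"
      by (rule has_derivative_transform_within_open) (use xy in \<open>auto simp: e[OF I]\<close>)
    moreover have "I * E d (0, 1) = - E d (1, 0)" for d
      using imag_unit_mult2[OF I]
      by (simp add: E_def beval_bscalar algebra_simps)
    hence "I * D (0, 1) = - D (1, 0)"
      unfolding D_def by (simp add: distrib_left flip: mult.assoc)
    hence "D (1, 0) + I * D (0, 1) = 0" by simp
    ultimately show "\<exists>D. ((\<lambda>(s, t). f (of_real s + I * of_real t)) has_derivative D) (at (x, y)) \<and>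
        (1 / 2) *\<^sub>R (D (1, 0) + I * D (0, 1)) = 0"
      unfolding case_prod_beta by (intro exI[of _ D]) simp
  qed
qed

text \<open>For slice functions the parts \<open>stem1\<close> and \<open>stem2\<close> are the same for all units, so one
  reference slice suffices. Built this way, the stem is symmetric for every function whatsoever.\<close>
definition stem_coord :: "(quat \<Rightarrow> real) \<Rightarrow> (quat \<Rightarrow> quat) \<Rightarrow> complex \<Rightarrow> complex" where
  "stem_coord L f z =
     Complex (L (stem1 f quat_i (Re z, Im z))) (L (stem2 f quat_i (Re z, Im z)))"

definition stem_of :: "(quat \<Rightarrow> quat) \<Rightarrow> complex \<Rightarrow> biquat" where
  "stem_of f z = Biquat (stem_coord qRe f z) (stem_coord qI f z) (stem_coord qJ f z) (stem_coord qK f z)"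

lemma bsymmetric_stem_of: "bsymmetric (stem_of f)"
proof -
  have "stem1 f I (s, - t) = stem1 f I (s, t)" for I s t
    by (simp add: stem1_def add.commute)
  moreover have "stem2 f I (s, - t) = - stem2 f I (s, t)" for I s t
    by (simp add: stem2_def quat_eq_iff right_diff_distrib)
  ultimately show ?thesis
    by (simp add: bsymmetric_def biquat_eq_iff stem_of_def stem_coord_def complex_eq_iff)
qed

lemma bRe_bIm_stem_of:
  "bRe (stem_of f z) = stem1 f quat_i (Re z, Im z)" "bIm (stem_of f z) = stem2 f quat_i (Re z, Im z)"
  by (simp_all add: bRe_def bIm_def stem_of_def stem_coord_def quat_eq_iff)

lemma blift_stem_of:
  assumes "f \<in> SR U" "circular U" "q \<in> U"
  shows "f q = blift (stem_of f) q"
proof -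
  obtain x y I where I: "I \<in> \<S>" and q: "q = of_real x + I * of_real y" by (rule quat_slice_cases)
  obtain F1 F2 where F: "\<And>x y. F1 x (- y) = F1 x y" "\<And>x y. F2 x (- y) = - F2 x y"
    "\<And>x y I. I \<in> \<S> \<Longrightarrow> of_real x + I * of_real y \<in> U \<Longrightarrow>
       f (of_real x + I * of_real y) = F1 x y + I * F2 x y"
    using assms(1) unfolding SR_def is_slice_function_def by (smt (verit) mem_Collect_eq)
  have i: "of_real x + quat_i * of_real y \<in> U"
    using circularD[OF assms(2) _ I quat_i_unit] assms(3) q by blast
  have "blift (stem_of f) q = stem1 f quat_i (x, y) + I * stem2 f quat_i (x, y)"
    unfolding q blift_slice[OF bsymmetric_stem_of I] beval_def bRe_bIm_stem_of by simp
  also have "\<dots> = F1 x y + I * F2 x y"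
    using stem_of_slice_function[OF quat_i_unit i assms(2) F] by simp
  finally show ?thesis using F(3)[OF I] assms(3) q by simp
qed

text \<open>The coefficient functions of a slice regular function are slice regular and preserve the slice
  of \<open>quat_i\<close>; there the condition on the derivative is the pair of Cauchy-Riemann equations.\<close>
lemma stem_coord_analytic:
  assumes f: "f \<in> SR U" and U: "circular U" "open U" and L: "bounded_linear L"
  shows "stem_coord L f analytic_on slice_set U"
  unfolding analytic_on_open[OF open_slice_set[OF U(2)]] holomorphic_on_def
proof
  fix z assume z: "z \<in> slice_set U"
  define h where "h = (\<lambda>(s, t). slice_coeff L f (of_real s + quat_i * of_real t))"
  have "slice_holomorphic U (slice_coeff L f)"
    using slice_coeff_SR[OF f U(1) L] by (simp add: SR_def)
  moreover have "of_real (Re z) + quat_i * of_real (Im z) \<in> U" using z by (simp add: slice_set_def)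
  ultimately obtain D where D: "(h has_derivative D) (at (Re z, Im z))"
    and "(1 / 2) *\<^sub>R (D (1, 0) + quat_i * D (0, 1)) = 0"
    using quat_i_unit unfolding slice_holomorphic_def h_def by blast
  hence CR: "qRe (D (0, 1)) = - qI (D (1, 0))" "qI (D (0, 1)) = qRe (D (1, 0))"
    by (simp_all add: quat_eq_iff)
  interpret D: bounded_linear D using D by (rule has_derivative_bounded_linear)
  have lin: "D (s, t) = s *\<^sub>R D (1, 0) + t *\<^sub>R D (0, 1)" for s t
    using D.add[of "s *\<^sub>R (1, 0)" "t *\<^sub>R (0, 1)"] D.scaleR[of s "(1, 0)"] D.scaleR[of t "(0, 1)"]
    by simp
  have \<phi>: "stem_coord L f w = of_real (qRe (h (Re w, Im w))) + \<i> * of_real (qI (h (Re w, Im w)))" for w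
    by (simp add: h_def slice_coeff_slice[OF quat_i_unit L] stem_coord_def complex_eq_iff)
  define d where "d = Complex (qRe (D (1, 0))) (qI (D (1, 0)))"
  have "((\<lambda>w. (Re w, Im w)) has_derivative (\<lambda>w. (Re w, Im w))) (at z)"
    by (auto intro!: derivative_eq_intros)
  from has_derivative_compose[OF this] D
  have h: "((\<lambda>w. h (Re w, Im w)) has_derivative (\<lambda>w. D (Re w, Im w))) (at z)" by blast
  have "(stem_coord L f has_derivative
      (\<lambda>w. of_real (qRe (D (Re w, Im w))) + \<i> * of_real (qI (D (Re w, Im w))))) (at z)"
    unfolding \<phi>[abs_def]
    by (intro derivative_intros has_derivative_of_real h
        bounded_linear.has_derivative[OF bounded_linear_coords(1)]
        bounded_linear.has_derivative[OF bounded_linear_coords(2)])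
  moreover have "(\<lambda>w. of_real (qRe (D (Re w, Im w))) + \<i> * of_real (qI (D (Re w, Im w)))) = (*) d"
    by (rule ext, subst (1 2) lin) (simp add: CR d_def complex_eq_iff)
  ultimately have "(stem_coord L f has_field_derivative d) (at z)"
    by (simp add: has_field_derivative_def)
  thus "stem_coord L f field_differentiable at z within slice_set U"
    using field_differentiable_at_within field_differentiable_def by blast
qed

lemma stem_of_analytic:
  assumes "f \<in> SR U" "circular U" "open U"
  shows "stem_analytic (stem_of f) (slice_set U)"
  using stem_coord_analytic[OF assms] bounded_linear_coords
  by (simp add: stem_analytic_def stem_of_def)

section \<open>Semi-regularity and meromorphic stems\<close>

lemma qsphere_iff: "q \<in> qsphere p \<longleftrightarrow> slice_coord q = slice_coord p"
proof
  show "slice_coord q = slice_coord p" if q: "q \<in> qsphere p"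
  proof -
    obtain x y J I where *: "q = of_real x + J * of_real y" "J \<in> \<S>" "I \<in> \<S>"
      "p = of_real x + I * of_real y" using q unfolding qsphere_def by blast
    show ?thesis by (simp only: *(1,4) slice_coord_slice[OF *(2)] slice_coord_slice[OF *(3)])
  qed
  show "q \<in> qsphere p" if "slice_coord q = slice_coord p"
  proof -
    have e: "qRe q = qRe p" "vec_norm q = vec_norm p" using that by (simp_all add: slice_coord_def)
    have "q = of_real (qRe p) + vec_dir q * of_real (vec_norm p)"
      using quat_slice_repr[of q] by (simp add: e)
    thus ?thesis unfolding qsphere_def using vec_dir_unit quat_slice_repr[of p] by blast
  qed
qed

lemma slice_coord_vimage_circular: "circular (slice_coord -` A)"
  unfolding circular_def by (auto simp: qsphere_iff)

lemma circular_diff_qsphere: "circular U \<Longrightarrow> circular (U - qsphere p)"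
  unfolding circular_def by (auto simp: qsphere_iff subset_iff)

text \<open>Its roots are the two planar points of the sphere of \<open>p\<close>.\<close>
definition Delta_stem :: "quat \<Rightarrow> complex \<Rightarrow> complex" where
  "Delta_stem p z = z\<^sup>2 - 2 * of_real (qRe p) * z + of_real ((norm p)\<^sup>2)"

lemma Delta_stem_factor:
  "Delta_stem p z = (z - slice_coord p) * (z - cnj (slice_coord p))"
proof -
  have "(norm p)\<^sup>2 = (qRe p)\<^sup>2 + (vec_norm p)\<^sup>2"
    by (simp add: norm_quat_power2 vec_norm_power2)
  thus ?thesis
    by (simp add: Delta_stem_def slice_coord_def complex_eq_iff power2_eq_square algebra_simps)
qed

lemma Delta_stem_cnj: "Delta_stem p (cnj z) = cnj (Delta_stem p z)"
  by (simp add: Delta_stem_def)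

lemma qDelta_blift: "qDelta p q = blift (\<lambda>z. bscalar (Delta_stem p z)) q"
proof -
  define I where "I = vec_dir q"
  define x y where "x = qRe q" and "y = vec_norm q"
  have I: "I \<in> \<S>" and q: "q = of_real x + I * of_real y"
    unfolding I_def x_def y_def by (rule vec_dir_unit, rule quat_slice_repr)
  have z: "slice_coord q = Complex x y" by (simp add: slice_coord_def x_def y_def)
  have "blift (\<lambda>z. bscalar (Delta_stem p z)) q =
      of_real (x * x - y * y - 2 * qRe p * x + (norm p)\<^sup>2) + I * of_real (2 * x * y - 2 * qRe p * y)"
    unfolding blift_def beval_bscalar I_def[symmetric] z
    by (simp add: Delta_stem_def power2_eq_square algebra_simps)
  also have "\<dots> = qDelta p q"
    unfolding qDelta_def power2_eq_square q slice_plane_mult[OF I]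
    by (simp add: algebra_simps quat_eq_iff)
  finally show ?thesis ..
qed

lemma qDelta_power_mult_blift:
  "qDelta p q ^ m * blift B q = blift (\<lambda>z. bscalar (Delta_stem p z ^ m) * B z) q"
  by (simp add: blift_bscalar_mult blift_bscalar_power qDelta_blift)

lemma filtermap_cnj_at: "filtermap cnj (at z) = at (cnj z)"
proof (rule filtermap_nhds_eq_imp_filtermap_at_eq)
  show "filtermap cnj (nhds z) = nhds (cnj z)"
    by (rule filtermap_nhds_open_map)
      (auto simp: image_cnj_conv_vimage_cnj intro!: open_vimage continuous_intros)
qed simp

lemma remove_sings_cnj:
  assumes "\<And>z. f (cnj z) = cnj (f z)"
  shows "remove_sings f (cnj z) = cnj (remove_sings f z)"
proof -
  have "remove_sings f (cnj z) = remove_sings (f \<circ> cnj) z"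
    using remove_sings_compose[OF filtermap_cnj_at] by simp
  also have "f \<circ> cnj = (\<lambda>z. cnj (f z))" using assms by (simp add: fun_eq_iff)
  also have "remove_sings (\<lambda>z. cnj (f z)) z = cnj (remove_sings f z)"
  proof (cases "\<exists>c. f \<midarrow>z\<rightarrow> c")
    case True
    then obtain c where c: "f \<midarrow>z\<rightarrow> c" by blast
    thus ?thesis using remove_sings_eqI[OF c] remove_sings_eqI[OF tendsto_cnj[OF c]] by simp
  next
    case False
    hence "\<nexists>c. (\<lambda>z. cnj (f z)) \<midarrow>z\<rightarrow> c" using lim_cnj[of f _ "at z"] by (metis complex_cnj_cnj)
    thus ?thesis using False by (simp add: remove_sings_def)
  qed
  finally show ?thesis .
qed

lemma analytic_at_cnj:
  assumes sym: "\<And>z. f (cnj z) = cnj (f z)" and "f analytic_on {z}"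
  shows "f analytic_on {cnj z}"
proof -
  obtain A where A: "open A" "z \<in> A" "f holomorphic_on A"
    using assms(2) unfolding analytic_at by blast
  have "cnj \<circ> f \<circ> cnj holomorphic_on cnj ` A"
    by (rule holomorphic_on_compose_cnj_cnj)
      (use A in \<open>auto simp: image_image image_cnj_conv_vimage_cnj intro!: open_vimage continuous_intros\<close>)
  moreover have "cnj \<circ> f \<circ> cnj = f" by (auto simp: sym)
  moreover have "open (cnj ` A)"
    unfolding image_cnj_conv_vimage_cnj using A(1) by (intro open_vimage continuous_intros)
  ultimately show ?thesis unfolding analytic_at using A(2) by auto
qed

text \<open>Every larger exponent works as well, which allows finitely many functions to share one.\<close>
lemma meromorphic_at_order_bound:
  assumes "f meromorphic_on {z}"
  obtains m where "\<And>n. n \<ge> m \<Longrightarrow> \<exists>l. (\<lambda>w. (w - z) ^ n * f w) \<midarrow>z\<rightarrow> l"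
proof -
  have iso: "isolated_singularity_at f z" "not_essential f z"
    using assms by (simp_all add: meromorphic_at_iff)
  obtain m :: nat and l where ml: "(\<lambda>w. (w - z) ^ m * f w) \<midarrow>z\<rightarrow> l"
  proof (cases "\<exists>\<^sub>F w in at z. f w \<noteq> 0")
    case False
    hence "\<forall>\<^sub>F w in at z. (w - z) ^ 0 * f w = 0" by (simp add: frequently_def)
    hence "(\<lambda>w. (w - z) ^ 0 * f w) \<midarrow>z\<rightarrow> 0" by (rule tendsto_eventually)
    thus ?thesis by (rule that)
  next
    case True
    define g where "g = zor_poly f z"
    define n where "n = zorder f z"
    obtain r where r: "r > 0" "g holomorphic_on cball z r"
      "\<And>w. w \<in> cball z r - {z} \<Longrightarrow> f w = g w * (w - z) powi n"
      using zorder_exist[OF iso True] unfolding g_def n_def by blast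
    \<comment> \<open>The exponent is \<open>0\<close> at a pole of order \<open>- n\<close> and \<open>n\<close> at a zero of order \<open>n\<close>.\<close>
    define k where "k = nat (int (nat (- n)) + n)"
    have "g holomorphic_on ball z r" using r(2) holomorphic_on_subset ball_subset_cball by blast
    hence "isCont g z"
      using r(1) by (metis centre_in_ball continuous_on_eq_continuous_at holomorphic_on_imp_continuous_on open_ball)
    hence "(\<lambda>w. (w - z) ^ k * g w) \<midarrow>z\<rightarrow> (z - z) ^ k * g z"
      by (intro tendsto_intros) (simp add: isCont_def)
    moreover have "\<forall>\<^sub>F w in at z. (w - z) ^ k * g w = (w - z) ^ nat (- n) * f w"
    proof -
      have "\<forall>\<^sub>F w in at z. w \<in> ball z r - {z}" using r(1) by (intro eventually_at_in_open) auto
      thus ?thesis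
      proof eventually_elim
        case (elim w)
        have "(w - z) ^ nat (- n) * (w - z) powi n = (w - z) powi int (nat (- n)) * (w - z) powi n"
          by (simp only: power_int_of_nat)
        also have "\<dots> = (w - z) powi (int (nat (- n)) + n)"
          using elim by (subst power_int_add) auto
        also have "\<dots> = (w - z) ^ k"
          unfolding k_def by (subst power_int_nonneg_exp) auto
        finally show ?case using r(3)[of w] elim by (simp add: mult_ac)
      qed
    qed
    ultimately have "(\<lambda>w. (w - z) ^ nat (- n) * f w) \<midarrow>z\<rightarrow> (z - z) ^ k * g z"
      by (rule Lim_transform_eventually)
    thus ?thesis by (rule that)
  qed
  show ?thesis
  proof (rule that)
    fix n assume "n \<ge> m"
    hence split: "(w - z) ^ n * f w = (w - z) ^ (n - m) * ((w - z) ^ m * f w)" for w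
      by (simp flip: power_add mult.assoc)
    have "(\<lambda>w. (w - z) ^ (n - m) * ((w - z) ^ m * f w)) \<midarrow>z\<rightarrow> (z - z) ^ (n - m) * l"
      by (intro tendsto_intros ml)
    thus "\<exists>l. (\<lambda>w. (w - z) ^ n * f w) \<midarrow>z\<rightarrow> l" unfolding split by blast
  qed
qed

text \<open>The planar complement of an admissible set is discrete in the planar set of \<open>\<Omega>\<close>. This is the
  shape of a domain of definition in \<open>regular_off_poles\<close>.\<close>
definition admissible :: "quat set \<Rightarrow> quat set \<Rightarrow> bool" where
  "admissible \<Omega> W \<longleftrightarrow> W \<subseteq> \<Omega> \<and> open W \<and> circular W \<and>
     (\<forall>z\<in>slice_set \<Omega>. \<forall>\<^sub>F w in at z. w \<in> slice_set W)"

definition stem_on :: "quat set \<Rightarrow> (complex \<Rightarrow> biquat) \<Rightarrow> quat set \<Rightarrow> bool" where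
  "stem_on \<Omega> B W \<longleftrightarrow> admissible \<Omega> W \<and> bsymmetric B \<and>
     stem_meromorphic B (slice_set \<Omega>) \<and> stem_analytic B (slice_set W)"

text \<open>At a point outside \<open>W\<close> the coordinates have at most poles, so a common power of \<open>Delta_stem p\<close>
  makes all four singularities removable. Removing them keeps the symmetry, hence the result lifts to
  a slice regular function.\<close>
lemma regular_off_polesI:
  assumes \<Omega>: "open \<Omega>" "circular \<Omega>" and B: "stem_on \<Omega> B W"
    and f: "\<And>q. q \<in> W \<Longrightarrow> f q = blift B q"
  shows "regular_off_poles \<Omega> f W"
  unfolding regular_off_poles_def
proof (intro conjI ballI)
  show W: "W \<subseteq> \<Omega>" "open W" "circular W"
    using B unfolding stem_on_def admissible_def by blast+
  have sym: "bsymmetric B" and mero: "stem_meromorphic B (slice_set \<Omega>)"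
    and ana: "stem_analytic B (slice_set W)"
    and adm: "\<And>z. z \<in> slice_set \<Omega> \<Longrightarrow> \<forall>\<^sub>F w in at z. w \<in> slice_set W"
    using B unfolding stem_on_def admissible_def by blast+
  show "f \<in> SR W" by (rule blift_SR[OF W(2,3) sym ana f])
  fix p assume p: "p \<in> \<Omega> - W"
  define z0 where "z0 = slice_coord p"
  have z0: "z0 \<in> slice_set \<Omega>" using p slice_coord_mem_iff[OF \<Omega>(2)] by (simp add: z0_def)
  obtain e1 where e1: "e1 > 0" "ball z0 e1 \<subseteq> slice_set \<Omega>"
    using open_slice_set[OF \<Omega>(1)] z0 open_contains_ball by blast
  obtain e2 where e2: "e2 > 0" "\<And>w. w \<noteq> z0 \<Longrightarrow> dist w z0 < e2 \<Longrightarrow> w \<in> slice_set W"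
    using adm[OF z0] unfolding eventually_at by blast
  define e where "e = min e1 e2"
  have e: "e > 0" "ball z0 e \<subseteq> slice_set \<Omega>" "ball z0 e - {z0} \<subseteq> slice_set W"
    using e1 e2 by (auto simp: e_def dist_commute subset_iff)
  have "\<exists>m. \<forall>n\<ge>m. \<exists>l. (\<lambda>w. (w - z0) ^ n * c (B w)) \<midarrow>z0\<rightarrow> l" if "c \<in> {bq0, bq1, bq2, bq3}" for c
  proof -
    have "(\<lambda>w. c (B w)) meromorphic_on {z0}"
      using mero that z0 meromorphic_on_subset unfolding stem_meromorphic_def by blast
    from meromorphic_at_order_bound[OF this] show ?thesis by metis
  qed
  then obtain M where M: "\<And>c n. c \<in> {bq0, bq1, bq2, bq3} \<Longrightarrow> n \<ge> M c \<Longrightarrow>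
      \<exists>l. (\<lambda>w. (w - z0) ^ n * c (B w)) \<midarrow>z0\<rightarrow> l" by metis
  define m where "m = M bq0 + M bq1 + M bq2 + M bq3"
  define K where "K = (\<lambda>c w. Delta_stem p w ^ m * c (B w))"
  define G where "G = (\<lambda>w. Biquat (remove_sings (K bq0) w) (remove_sings (K bq1) w)
    (remove_sings (K bq2) w) (remove_sings (K bq3) w))"
  have Gc: "c (G w) = remove_sings (K c) w" if "c \<in> {bq0, bq1, bq2, bq3}" for c w
    using that by (auto simp: G_def)
  have Kana: "K c analytic_on {w}" if "c \<in> {bq0, bq1, bq2, bq3}" "w \<in> slice_set W" for c w
  proof -
    have "(\<lambda>w. c (B w)) analytic_on {w}"
      using ana that analytic_on_subset unfolding stem_analytic_def by blast
    thus ?thesis unfolding K_def Delta_stem_def by (intro analytic_intros)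
  qed
  have Kz0: "remove_sings (K c) analytic_on {z0}" if c: "c \<in> {bq0, bq1, bq2, bq3}" for c
  proof -
    have "isolated_singularity_at (K c) z0"
      unfolding isolated_singularity_at_def
      using e(1,3) Kana[OF c] by (intro exI[of _ e]) (auto simp: analytic_on_analytic_at[of _ "_ - _"])
    moreover have "m \<ge> M c" using c by (auto simp: m_def)
    then obtain l where l: "(\<lambda>w. (w - z0) ^ m * c (B w)) \<midarrow>z0\<rightarrow> l" using M[OF c] by blast
    have "(\<lambda>w. (w - cnj z0) ^ m * ((w - z0) ^ m * c (B w))) \<midarrow>z0\<rightarrow> (z0 - cnj z0) ^ m * l"
      by (intro tendsto_intros l)
    hence "K c \<midarrow>z0\<rightarrow> (z0 - cnj z0) ^ m * l"
      by (simp add: K_def Delta_stem_factor power_mult_distrib z0_def mult_ac)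
    ultimately show ?thesis by (rule remove_sings_analytic_at)
  qed
  have Gana: "remove_sings (K c) analytic_on {w}"
    if "c \<in> {bq0, bq1, bq2, bq3}" "w \<in> ball z0 e" for c w
    using Kz0 Kana remove_sings_analytic_on e(3) that by (cases "w = z0") blast+
  have Ksym: "K c (cnj w) = cnj (K c w)" if "c \<in> {bq0, bq1, bq2, bq3}" for c w
    using that by (auto simp: K_def Delta_stem_cnj bsymmetricD[OF sym])
  have Rsym: "remove_sings (K c) (cnj w) = cnj (remove_sings (K c) w)"
    if "c \<in> {bq0, bq1, bq2, bq3}" for c w
    using remove_sings_cnj[of "K c"] Ksym[OF that] by blast
  have Gsym: "bsymmetric G"
    unfolding bsymmetric_def biquat_eq_iff using Rsym Gc by simp
  define N where "N = slice_coord -` ball z0 e"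
  have N: "open N" "circular N" "p \<in> N" "N \<subseteq> \<Omega>"
  proof -
    show "open N" unfolding N_def
      by (intro open_vimage open_ball continuous_slice_coord)
    show "circular N" unfolding N_def by (rule slice_coord_vimage_circular)
    show "p \<in> N" using e(1) by (simp add: N_def z0_def)
    show "N \<subseteq> \<Omega>" using e(2) slice_coord_mem_iff[OF \<Omega>(2)] by (auto simp: N_def)
  qed
  have NW: "q \<in> W \<and> slice_coord q \<in> slice_set W" if "q \<in> N - qsphere p" for q
    using that e(3) slice_coord_mem_iff[OF W(3)] by (auto simp: N_def qsphere_iff z0_def)
  have "stem_analytic G (slice_set N)"
    unfolding stem_analytic_def
  proof
    fix c assume c: "c \<in> {bq0, bq1, bq2, bq3}"
    have "remove_sings (K c) analytic_on {z}" if z: "z \<in> slice_set N" for z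
    proof -
      obtain q where q: "q \<in> N" "slice_coord q = z \<or> slice_coord q = cnj z"
        using slice_set_slice_coord_or_cnj[OF N(2) z] by blast
      have a: "remove_sings (K c) analytic_on {slice_coord q}"
        using Gana[OF c] q(1) by (simp add: N_def)
      have "remove_sings (K c) analytic_on {cnj (slice_coord q)}"
        by (rule analytic_at_cnj[OF Rsym[OF c] a])
      thus ?thesis using a q(2) by auto
    qed
    thus "(\<lambda>z. c (G z)) analytic_on slice_set N"
      unfolding Gc[OF c] by (subst analytic_on_analytic_at) blast
  qed
  hence G: "blift G \<in> SR N" by (rule blift_SR[OF N(1,2) Gsym]) simp
  have "blift G q = qDelta p q ^ m * f q" if q: "q \<in> N - qsphere p" for q
  proof -
    have "G (slice_coord q) = bscalar (Delta_stem p (slice_coord q) ^ m) * B (slice_coord q)"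
      using Kana NW[OF q] by (simp add: biquat_eq_iff Gc) (simp add: K_def)
    hence "blift G q = blift (\<lambda>z. bscalar (Delta_stem p z ^ m) * B z) q" by (simp add: blift_def)
    thus ?thesis using f NW[OF q] by (simp add: qDelta_power_mult_blift)
  qed
  thus "\<exists>N. open N \<and> circular N \<and> p \<in> N \<and> N \<subseteq> \<Omega> \<and> N - qsphere p \<subseteq> W \<and>
        (\<exists>m. \<exists>g\<in>SR N. \<forall>q\<in>N - qsphere p. g q = (qDelta p q) ^ m * f q)"
    using N NW G by (intro exI[of _ N]) blast
qed

text \<open>Near a pole the coordinates are quotients of holomorphic functions by a power of \<open>Delta_stem p\<close>.
  The punctured neighbourhood has to avoid both \<open>z\<close> and \<open>cnj z\<close>, since the removed sphere meets the
  planar set in both.\<close>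
lemma regular_off_poles_stem_of:
  assumes f: "regular_off_poles \<Omega> f U"
  shows "stem_on \<Omega> (stem_of f) U" "\<And>q. q \<in> U \<Longrightarrow> f q = blift (stem_of f) q"
proof -
  have U: "U \<subseteq> \<Omega>" "open U" "circular U" "f \<in> SR U"
    using f unfolding regular_off_poles_def by blast+
  show fq: "f q = blift (stem_of f) q" if "q \<in> U" for q by (rule blift_stem_of[OF U(4,3) that])
  have ana: "stem_analytic (stem_of f) (slice_set U)" by (rule stem_of_analytic[OF U(4,3,2)])
  have local: "(\<forall>\<^sub>F w in at z. w \<in> slice_set U) \<and> stem_meromorphic (stem_of f) {z}"
    if z: "z \<in> slice_set \<Omega>" for z
  proof (cases "z \<in> slice_set U")
    case True
    have "\<forall>\<^sub>F w in at z. w \<in> slice_set U"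
      using eventually_at_in_open'[OF open_slice_set[OF U(2)] True] .
    moreover have "stem_meromorphic (stem_of f) {z}"
      using ana True analytic_on_imp_meromorphic_on analytic_on_subset
      unfolding stem_analytic_def stem_meromorphic_def by blast
    ultimately show ?thesis ..
  next
    case False
    define p where "p = of_real (Re z) + quat_i * of_real (Im z)"
    have p: "p \<in> \<Omega> - U" using z False by (simp add: slice_set_def p_def)
    obtain N m g where N: "open N" "circular N" "p \<in> N" "N \<subseteq> \<Omega>" "N - qsphere p \<subseteq> U"
      and g: "g \<in> SR N" "\<forall>q\<in>N - qsphere p. g q = (qDelta p q) ^ m * f q"
      using f p unfolding regular_off_poles_def by meson
    have zp: "slice_coord p = z \<or> slice_coord p = cnj z"
      unfolding p_def slice_coord_slice[OF quat_i_unit] by (auto simp: complex_eq_iff)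
    have zN: "z \<in> slice_set N" using N(3) by (simp add: slice_set_def p_def)
    have "\<forall>\<^sub>F w in at z. w \<in> slice_set N - {z}"
      using open_slice_set[OF N(1)] zN by (rule eventually_at_in_open)
    moreover have "\<forall>\<^sub>F w in at z. w \<noteq> cnj z" 
      using eventually_neq_at_within[of "cnj z" z UNIV] by simp
    ultimately have ev: "\<forall>\<^sub>F w in at z. w \<in> slice_set (N - qsphere p) \<and> Delta_stem p w \<noteq> 0"
    proof eventually_elim
      case (elim w)
      have w: "w \<noteq> z" "w \<noteq> cnj z" "cnj w \<noteq> z" "cnj w \<noteq> cnj z"
        using elim by (auto simp: complex_eq_iff)
      have "slice_coord (of_real (Re w) + quat_i * of_real (Im w)) \<in> {w, cnj w}"
        unfolding slice_coord_slice[OF quat_i_unit] by (auto simp: complex_eq_iff)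
      hence "of_real (Re w) + quat_i * of_real (Im w) \<notin> qsphere p"
        using w zp unfolding qsphere_iff by auto
      moreover have "Delta_stem p w \<noteq> 0" using w zp unfolding Delta_stem_factor by auto
      ultimately show ?case using elim by (simp add: slice_set_def)
    qed
    have NU: "slice_set (N - qsphere p) \<subseteq> slice_set U" using N(5) by (auto simp: slice_set_def)
    have 1: "\<forall>\<^sub>F w in at z. w \<in> slice_set U"
      using ev by (rule eventually_mono) (use NU in blast)
    have inj: "stem_of g w = bscalar (Delta_stem p w ^ m) * stem_of f w"
      if "w \<in> slice_set (N - qsphere p)" for w
    proof (rule blift_inject[OF circular_diff_qsphere[OF N(2), of p] bsymmetric_stem_of _ that])
      show "bsymmetric (\<lambda>w. bscalar (Delta_stem p w ^ m) * stem_of f w)"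
        using bsymmetricD[OF bsymmetric_stem_of[of f]]
        by (simp add: bsymmetric_def Delta_stem_cnj biquat_eq_iff)
      fix q assume q: "q \<in> N - qsphere p"
      have "blift (stem_of g) q = g q" using blift_stem_of[OF g(1) N(2)] q by simp
      also have "\<dots> = qDelta p q ^ m * blift (stem_of f) q" using g(2) q fq N(5) by auto
      finally show "blift (stem_of g) q = blift (\<lambda>w. bscalar (Delta_stem p w ^ m) * stem_of f w) q"
        by (simp add: qDelta_power_mult_blift)
    qed
    have "(\<lambda>w. c (stem_of f w)) meromorphic_on {z}" if c: "c \<in> {bq0, bq1, bq2, bq3}" for c
    proof -
      have "(\<lambda>w. c (stem_of g w)) analytic_on {z}"
        using stem_of_analytic[OF g(1) N(2,1)] zN c analytic_on_subset
        unfolding stem_analytic_def by blast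
      hence "(\<lambda>w. c (stem_of g w) / Delta_stem p w ^ m) meromorphic_on {z}"
        unfolding Delta_stem_def by (intro meromorphic_intros analytic_on_imp_meromorphic_on)
      moreover have "\<forall>\<^sub>F w in at z. c (stem_of f w) = c (stem_of g w) / Delta_stem p w ^ m"
        using ev
      proof eventually_elim
        case (elim w)
        hence "c (stem_of g w) = Delta_stem p w ^ m * c (stem_of f w)"
          using inj c by auto
        thus ?case using elim by simp
      qed
      ultimately show ?thesis
        by (subst meromorphic_on_cong[of "{z}" _ "\<lambda>w. c (stem_of g w) / Delta_stem p w ^ m"]) auto
    qed
    thus ?thesis using 1 by (simp add: stem_meromorphic_def)
  qed
  show "stem_on \<Omega> (stem_of f) U"
    unfolding stem_on_def admissible_def
  proof (intro conjI)
    show "stem_meromorphic (stem_of f) (slice_set \<Omega>)"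
      unfolding stem_meromorphic_def
    proof
      fix c assume "c \<in> {bq0, bq1, bq2, bq3}"
      thus "(\<lambda>z. c (stem_of f z)) meromorphic_on slice_set \<Omega>"
        using local unfolding stem_meromorphic_def
        by (subst meromorphic_on_meromorphic_at) blast
    qed
  qed (use U ana local bsymmetric_stem_of in auto)
qed

section \<open>Generic equality of stems\<close>

abbreviation generically :: "quat set \<Rightarrow> (complex \<Rightarrow> bool) \<Rightarrow> bool" where
  "generically \<Omega> P \<equiv> eventually P (cosparse (slice_set \<Omega>))"

text \<open>Stems matter only up to equality off a discrete set. With this relation, domains of definition
  disappear from the calculations: \<open>B\<close> itself may be arbitrary at exceptional points.\<close>
definition represents :: "quat set \<Rightarrow> (quat \<Rightarrow> quat) \<Rightarrow> (complex \<Rightarrow> biquat) \<Rightarrow> bool" where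
  "represents \<Omega> f B \<longleftrightarrow>
     (\<exists>C W. stem_on \<Omega> C W \<and> (\<forall>q\<in>W. f q = blift C q) \<and> generically \<Omega> (\<lambda>z. C z = B z))"

lemma slice_set_Int: "slice_set (U \<inter> V) = slice_set U \<inter> slice_set V"
  by (auto simp: slice_set_def)

lemma admissible_Int: "admissible \<Omega> U \<Longrightarrow> admissible \<Omega> V \<Longrightarrow> admissible \<Omega> (U \<inter> V)"
  unfolding admissible_def slice_set_Int using circular_Int by (auto intro: eventually_conj)

lemma stem_analytic_subset: "stem_analytic B A \<Longrightarrow> A' \<subseteq> A \<Longrightarrow> stem_analytic B A'"
  unfolding stem_analytic_def using analytic_on_subset by blast

lemma stem_on_restrict:
  assumes "stem_on \<Omega> B U" "admissible \<Omega> V"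
  shows "stem_on \<Omega> B (U \<inter> V)" "stem_on \<Omega> B (V \<inter> U)"
  using assms admissible_Int stem_analytic_subset[of B "slice_set U"]
  unfolding stem_on_def slice_set_Int by auto

lemma stem_on_admissible: "stem_on \<Omega> B U \<Longrightarrow> admissible \<Omega> U"
  by (simp add: stem_on_def)

lemma stem_on_circular: "stem_on \<Omega> B U \<Longrightarrow> circular U"
  by (simp add: stem_on_def admissible_def)

lemma stem_on_bsymmetric: "stem_on \<Omega> B U \<Longrightarrow> bsymmetric B"
  by (simp add: stem_on_def)

lemma stem_on_binary:
  assumes "stem_on \<Omega> B U" "stem_on \<Omega> C U"
  shows "stem_on \<Omega> (\<lambda>z. B z + C z) U" "stem_on \<Omega> (\<lambda>z. B z - C z) U" "stem_on \<Omega> (\<lambda>z. B z * C z) U"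
  using assms unfolding stem_on_def stem_analytic_def stem_meromorphic_def bsymmetric_def
  by (auto simp: biquat_eq_iff intro!: analytic_intros meromorphic_intros)

lemma stem_on_const:
  assumes "admissible \<Omega> U" "bcnj b = b"
  shows "stem_on \<Omega> (\<lambda>_. b) U"
  using assms unfolding stem_on_def stem_analytic_def stem_meromorphic_def bsymmetric_def
  by (auto intro!: analytic_intros meromorphic_intros)

lemma stem_on_coord:
  assumes "stem_on \<Omega> B U" "c \<in> {bq0, bq1, bq2, bq3}"
  shows "stem_on \<Omega> (\<lambda>z. bscalar (c (B z))) U"
  using assms unfolding stem_on_def stem_analytic_def stem_meromorphic_def bsymmetric_def
  by (auto simp: biquat_eq_iff intro!: analytic_intros meromorphic_intros)

lemma stem_on_isCont:
  assumes "stem_on \<Omega> B U" "z \<in> slice_set U" "c \<in> {bq0, bq1, bq2, bq3}"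
  shows "isCont (\<lambda>z. c (B z)) z"
proof -
  have "(\<lambda>z. c (B z)) analytic_on {z}"
    using assms analytic_on_subset unfolding stem_on_def stem_analytic_def by blast
  thus ?thesis by (rule analytic_at_imp_isCont)
qed

text \<open>Both stems are continuous on the domain, which has no isolated points.\<close>
lemma stem_generic_eqD:
  assumes B: "stem_on \<Omega> B U" and C: "stem_on \<Omega> C U"
    and eq: "generically \<Omega> (\<lambda>z. B z = C z)" and z: "z \<in> slice_set U"
  shows "B z = C z"
proof -
  have "U \<subseteq> \<Omega>" using B by (simp add: stem_on_def admissible_def)
  hence "z \<in> slice_set \<Omega>" using z by (auto simp: slice_set_def)
  hence ev: "\<forall>\<^sub>F w in at z. B w = C w" by (rule eventually_cosparse_imp_eventually_at[OF eq])
  have "c (B z) = c (C z)" if c: "c \<in> {bq0, bq1, bq2, bq3}" for c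
  proof -
    have "(\<lambda>w. c (B w)) \<midarrow>z\<rightarrow> c (B z)" using stem_on_isCont[OF B z c] by (simp add: isCont_def)
    moreover have "\<forall>\<^sub>F w in at z. c (B w) = c (C w)" using ev by eventually_elim simp
    ultimately have "(\<lambda>w. c (C w)) \<midarrow>z\<rightarrow> c (B z)" by (rule Lim_transform_eventually)
    moreover have "(\<lambda>w. c (C w)) \<midarrow>z\<rightarrow> c (C z)"
      using stem_on_isCont[OF C z c] by (simp add: isCont_def)
    ultimately show ?thesis by (rule LIM_unique)
  qed
  thus ?thesis by (simp add: biquat_eq_iff)
qed

lemma slice_set_vimage:
  assumes "\<And>z. z \<in> A \<Longrightarrow> cnj z \<in> A"
  shows "slice_set (slice_coord -` A) = A"
proof -
  have "slice_coord (of_real (Re z) + quat_i * of_real (Im z)) \<in> {z, cnj z}" for z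
    unfolding slice_coord_slice[OF quat_i_unit] by (auto simp: complex_eq_iff)
  thus ?thesis using assms unfolding slice_set_def by (auto, (metis complex_cnj_cnj)+)
qed

context
  fixes \<Omega> :: "quat set"
  assumes dom: "circular_domain \<Omega>"
begin

lemma open_\<Omega>: "open \<Omega>" and circular_\<Omega>: "circular \<Omega>" and connected_\<Omega>: "connected \<Omega>"
  using dom by (simp_all add: circular_domain_def)

lemma generically_iff: "generically \<Omega> P \<longleftrightarrow> (\<forall>z\<in>slice_set \<Omega>. eventually P (at z))"
  by (rule eventually_cosparse_open_eq[OF open_slice_set[OF open_\<Omega>]])

lemma admissible_generically: "admissible \<Omega> U \<Longrightarrow> generically \<Omega> (\<lambda>z. z \<in> slice_set U)"
  by (simp add: generically_iff admissible_def)

lemma admissible_UNIV: "admissible \<Omega> \<Omega>"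
  unfolding admissible_def
  using open_\<Omega> circular_\<Omega> eventually_at_in_open'[OF open_slice_set[OF open_\<Omega>]] by auto

lemma represents_cong:
  assumes "represents \<Omega> f B" and eq: "generically \<Omega> (\<lambda>z. B z = B' z)"
  shows "represents \<Omega> f B'"
proof -
  obtain C U where *: "stem_on \<Omega> C U" "\<forall>q\<in>U. f q = blift C q" "generically \<Omega> (\<lambda>z. C z = B z)"
    using assms(1) unfolding represents_def by blast
  have "generically \<Omega> (\<lambda>z. C z = B' z)" using *(3) eq by eventually_elim simp
  thus ?thesis unfolding represents_def using *(1,2) by blast
qed

lemma represents_blift: "stem_on \<Omega> B U \<Longrightarrow> represents \<Omega> (blift B) B"
  unfolding represents_def by (intro exI[of _ B] exI[of _ U]) simp

lemma represents_SEM: "represents \<Omega> f B \<Longrightarrow> f \<in> SEM \<Omega>"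
  unfolding represents_def SEM_def using regular_off_polesI[OF open_\<Omega> circular_\<Omega>] by blast

lemma represents_stem_of: "regular_off_poles \<Omega> f U \<Longrightarrow> represents \<Omega> f (stem_of f)"
  unfolding represents_def using regular_off_poles_stem_of
  by (intro exI[of _ "stem_of f"] exI[of _ U]) auto

lemma SEM_represents:
  assumes "f \<in> SEM \<Omega>"
  obtains B where "represents \<Omega> f B"
  using assms represents_stem_of unfolding SEM_def by blast

lemma representsE2:
  assumes "represents \<Omega> f B" "represents \<Omega> g C"
  obtains B' U C' where "stem_on \<Omega> B' U" "stem_on \<Omega> C' U"
    "\<forall>q\<in>U. f q = blift B' q" "\<forall>q\<in>U. g q = blift C' q"
    "generically \<Omega> (\<lambda>z. B' z = B z)" "generically \<Omega> (\<lambda>z. C' z = C z)"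
proof -
  obtain B' U where 1: "stem_on \<Omega> B' U" "\<forall>q\<in>U. f q = blift B' q" "generically \<Omega> (\<lambda>z. B' z = B z)"
    using assms(1) unfolding represents_def by blast
  obtain C' V where 2: "stem_on \<Omega> C' V" "\<forall>q\<in>V. g q = blift C' q" "generically \<Omega> (\<lambda>z. C' z = C z)"
    using assms(2) unfolding represents_def by blast
  show ?thesis
    using 1 2 stem_on_restrict(1)[OF 1(1) stem_on_admissible[OF 2(1)]]
      stem_on_restrict(2)[OF 2(1) stem_on_admissible[OF 1(1)]]
    by (intro that[of B' "U \<inter> V" C']) auto
qed

text \<open>Agreement on some pair of domains passes to generic points by injectivity of \<open>blift\<close>; in the
  other direction continuity extends generic equality to the whole common domain.\<close>
lemma sem_eq_iff:
  assumes f: "represents \<Omega> f B" and g: "represents \<Omega> g C"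
  shows "sem_eq \<Omega> f g \<longleftrightarrow> generically \<Omega> (\<lambda>z. B z = C z)"
proof
  have agree: "generically \<Omega> (\<lambda>z. B1 z = C1 z)"
    if f: "represents \<Omega> f B1" and g: "represents \<Omega> g C1"
      and W: "admissible \<Omega> W" and eq: "\<And>q. q \<in> W \<Longrightarrow> f q = g q" for f g B1 C1 W
  proof -
    obtain B' U C' where *: "stem_on \<Omega> B' U" "stem_on \<Omega> C' U"
      "\<forall>q\<in>U. f q = blift B' q" "\<forall>q\<in>U. g q = blift C' q"
      "generically \<Omega> (\<lambda>z. B' z = B1 z)" "generically \<Omega> (\<lambda>z. C' z = C1 z)"
      by (rule representsE2[OF f g])
    have UW: "admissible \<Omega> (U \<inter> W)" by (rule admissible_Int[OF stem_on_admissible[OF *(1)] W])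
    hence circ: "circular (U \<inter> W)" by (simp add: admissible_def)
    have "B' z = C' z" if "z \<in> slice_set (U \<inter> W)" for z
    proof (rule blift_inject[OF circ _ _ that])
      show "bsymmetric B'" "bsymmetric C'" using *(1,2) by (simp_all add: stem_on_bsymmetric)
      show "blift B' q = blift C' q" if "q \<in> U \<inter> W" for q
        using *(3,4) eq[of q] that by simp
    qed
    with admissible_generically[OF UW] have "generically \<Omega> (\<lambda>z. B' z = C' z)"
      by (auto elim: eventually_mono)
    thus ?thesis using *(5,6) by eventually_elim simp
  qed
  show "generically \<Omega> (\<lambda>z. B z = C z)" if fg: "sem_eq \<Omega> f g"
  proof -
    obtain U V where UV: "regular_off_poles \<Omega> f U" "regular_off_poles \<Omega> g V" "\<forall>q\<in>U \<inter> V. f q = g q"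
      using fg unfolding sem_eq_def by blast
    have "admissible \<Omega> (U \<inter> V)"
      using regular_off_poles_stem_of(1)[OF UV(1)] regular_off_poles_stem_of(1)[OF UV(2)]
      by (intro admissible_Int stem_on_admissible)
    thus ?thesis using agree[OF f g] UV(3) by blast
  qed
  show "sem_eq \<Omega> f g" if eq: "generically \<Omega> (\<lambda>z. B z = C z)"
  proof -
    obtain B' U C' where *: "stem_on \<Omega> B' U" "stem_on \<Omega> C' U"
      "\<forall>q\<in>U. f q = blift B' q" "\<forall>q\<in>U. g q = blift C' q"
      "generically \<Omega> (\<lambda>z. B' z = B z)" "generically \<Omega> (\<lambda>z. C' z = C z)"
      by (rule representsE2[OF f g])
    have "generically \<Omega> (\<lambda>z. B' z = C' z)" using *(5,6) eq by eventually_elim simp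
    hence "B' z = C' z" if "z \<in> slice_set U" for z using stem_generic_eqD[OF *(1,2)] that by blast
    hence "f q = g q" if "q \<in> U" for q
      using that *(3,4) slice_coord_mem_iff[OF stem_on_circular[OF *(1)], of q]
      by (simp add: blift_def)
    thus ?thesis
      unfolding sem_eq_def using regular_off_polesI[OF open_\<Omega> circular_\<Omega>] *(1-4) by blast
  qed
qed

lemma represents_unique:
  assumes "represents \<Omega> f B" "represents \<Omega> f C"
  shows "generically \<Omega> (\<lambda>z. B z = C z)"
proof -
  have "sem_eq \<Omega> f f"
    using represents_SEM[OF assms(1)] unfolding SEM_def sem_eq_def by blast
  thus ?thesis using sem_eq_iff[OF assms] by blast
qed

lemma represents_add:
  assumes "represents \<Omega> f B" "represents \<Omega> g C"
  shows "represents \<Omega> (\<lambda>q. f q + g q) (\<lambda>z. B z + C z)"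
proof -
  obtain B' U C' where *: "stem_on \<Omega> B' U" "stem_on \<Omega> C' U"
    "\<forall>q\<in>U. f q = blift B' q" "\<forall>q\<in>U. g q = blift C' q"
    "generically \<Omega> (\<lambda>z. B' z = B z)" "generically \<Omega> (\<lambda>z. C' z = C z)"
    by (rule representsE2[OF assms])
  have "generically \<Omega> (\<lambda>z. B' z + C' z = B z + C z)" using *(5,6) by eventually_elim simp
  thus ?thesis unfolding represents_def using stem_on_binary(1)[OF *(1,2)] *(3,4) blift_add
    by (intro exI[of _ "\<lambda>z. B' z + C' z"] exI[of _ U]) simp
qed

lemma represents_diff:
  assumes "represents \<Omega> f B" "represents \<Omega> g C"
  shows "represents \<Omega> (\<lambda>q. f q - g q) (\<lambda>z. B z - C z)"
proof -
  obtain B' U C' where *: "stem_on \<Omega> B' U" "stem_on \<Omega> C' U"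
    "\<forall>q\<in>U. f q = blift B' q" "\<forall>q\<in>U. g q = blift C' q"
    "generically \<Omega> (\<lambda>z. B' z = B z)" "generically \<Omega> (\<lambda>z. C' z = C z)"
    by (rule representsE2[OF assms])
  have "generically \<Omega> (\<lambda>z. B' z - C' z = B z - C z)" using *(5,6) by eventually_elim simp
  thus ?thesis unfolding represents_def using stem_on_binary(2)[OF *(1,2)] *(3,4) blift_diff
    by (intro exI[of _ "\<lambda>z. B' z - C' z"] exI[of _ U]) simp
qed

lemma represents_star:
  assumes "represents \<Omega> f B" "represents \<Omega> g C"
  shows "represents \<Omega> (f \<star> g) (\<lambda>z. B z * C z)"
proof -
  obtain B' U C' where *: "stem_on \<Omega> B' U" "stem_on \<Omega> C' U"
    "\<forall>q\<in>U. f q = blift B' q" "\<forall>q\<in>U. g q = blift C' q"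
    "generically \<Omega> (\<lambda>z. B' z = B z)" "generically \<Omega> (\<lambda>z. C' z = C z)"
    by (rule representsE2[OF assms])
  have "generically \<Omega> (\<lambda>z. B' z * C' z = B z * C z)" using *(5,6) by eventually_elim simp
  moreover have "(f \<star> g) q = blift (\<lambda>z. B' z * C' z) q" if "q \<in> U" for q
    by (rule star_prod_blift[OF stem_on_circular[OF *(1)] that stem_on_bsymmetric[OF *(2)]])
      (use *(3,4) that in auto)
  ultimately show ?thesis unfolding represents_def using stem_on_binary(3)[OF *(1,2)]
    by (intro exI[of _ "\<lambda>z. B' z * C' z"] exI[of _ U]) simp
qed

lemma represents_const:
  assumes "bcnj b = b"
  shows "represents \<Omega> (\<lambda>_. bRe b) (\<lambda>_. b)"
proof -
  have "bIm b = 0" using assms by (simp add: bIm_def biquat_eq_iff quat_eq_iff complex_eq_iff)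
  hence "blift (\<lambda>_. b) = (\<lambda>_. bRe b)" by (simp add: blift_def beval_def fun_eq_iff)
  thus ?thesis using represents_blift[OF stem_on_const[OF admissible_UNIV assms]] by simp
qed

lemma represents_0: "represents \<Omega> (\<lambda>_. 0) (\<lambda>_. 0)"
  and represents_1: "represents \<Omega> (\<lambda>_. 1) (\<lambda>_. 1)"
  using represents_const[of 0] represents_const[of 1]
  by (simp_all add: biquat_eq_iff bRe_def zero_quat_def one_quat_def)

lemma represents_mult_const:
  assumes "represents \<Omega> f B" "bcnj b = b"
  shows "represents \<Omega> (\<lambda>q. f q * bRe b) (\<lambda>z. B z * b)"
proof -
  obtain C U where *: "stem_on \<Omega> C U" "\<forall>q\<in>U. f q = blift C q" "generically \<Omega> (\<lambda>z. C z = B z)"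
    using assms(1) unfolding represents_def by blast
  have "bIm b = 0" using assms(2) by (simp add: bIm_def biquat_eq_iff quat_eq_iff complex_eq_iff)
  hence "blift (\<lambda>z. C z * b) q = blift C q * bRe b" for q
    by (simp add: blift_def beval_mult vec_dir_unit)
  moreover have "generically \<Omega> (\<lambda>z. C z * b = B z * b)" using *(3) by eventually_elim simp
  moreover have "stem_on \<Omega> (\<lambda>z. C z * b) U"
    using stem_on_binary(3)[OF *(1) stem_on_const[OF stem_on_admissible[OF *(1)] assms(2)]] .
  ultimately show ?thesis unfolding represents_def using *(2)
    by (intro exI[of _ "\<lambda>z. C z * b"] exI[of _ U]) simp
qed

lemma represents_coord:
  assumes "represents \<Omega> f B" "c \<in> {bq0, bq1, bq2, bq3}"
  shows "\<exists>g. represents \<Omega> g (\<lambda>z. bscalar (c (B z)))"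
proof -
  obtain C U where *: "stem_on \<Omega> C U" "generically \<Omega> (\<lambda>z. C z = B z)"
    using assms(1) unfolding represents_def by blast
  have "generically \<Omega> (\<lambda>z. bscalar (c (C z)) = bscalar (c (B z)))"
    using *(2) by eventually_elim simp
  thus ?thesis
    by (intro exI) (rule represents_cong[OF represents_blift[OF stem_on_coord[OF *(1) assms(2)]]])
qed

subsection \<open>The identity principle\<close>

text \<open>A meromorphic function vanishes identically near a point or has no zeros in a punctured
  neighbourhood. The two alternatives define disjoint open sets, and their preimages under
  \<open>slice_coord\<close> cover the connected set \<open>\<Omega>\<close>. Working in \<open>\<Omega>\<close> is essential as the planar set need not
  be connected; its lower half is reached through the symmetry.\<close>
lemma stem_coord_zero_or_nonzero:
  assumes B: "stem_on \<Omega> B U" and c: "c \<in> {bq0, bq1, bq2, bq3}"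
  shows "generically \<Omega> (\<lambda>z. c (B z) = 0) \<or> generically \<Omega> (\<lambda>z. c (B z) \<noteq> 0)"
proof -
  define \<phi> where "\<phi> = (\<lambda>z. c (B z))"
  have mero: "\<phi> meromorphic_on slice_set \<Omega>"
    using B c unfolding stem_on_def stem_meromorphic_def \<phi>_def by blast
  have sym: "\<phi> (cnj z) = cnj (\<phi> z)" for z
    using c bsymmetricD[OF stem_on_bsymmetric[OF B], of z] by (auto simp: \<phi>_def)
  define Z where "Z = {z. \<forall>\<^sub>F w in at z. \<phi> w = 0}"
  define N where "N = {z. \<forall>\<^sub>F w in at z. \<phi> w \<noteq> 0}"
  have "open {z. \<forall>\<^sub>F w in at z. P w}" for P :: "complex \<Rightarrow> bool"
  proof (subst open_subopen, safe)
    fix z assume "\<forall>\<^sub>F w in at z. P w"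
    then obtain S where S: "open S" "z \<in> S" "\<And>w. w \<in> S \<Longrightarrow> w \<noteq> z \<Longrightarrow> P w"
      unfolding eventually_at_topological by blast
    have "\<forall>\<^sub>F w in at y. P w" if "y \<in> S" for y
    proof (cases "y = z")
      case True
      thus ?thesis using S unfolding eventually_at_topological by blast
    next
      case False
      thus ?thesis using S that
        unfolding eventually_at_topological by (intro exI[of _ "S - {z}"]) auto
    qed
    thus "\<exists>T. open T \<and> z \<in> T \<and> T \<subseteq> {z. \<forall>\<^sub>F w in at z. P w}" using S by blast
  qed
  hence op: "open Z" "open N" unfolding Z_def N_def by blast+
  have disj: "Z \<inter> N = {}"
  proof -
    have False if "\<forall>\<^sub>F w in at z. \<phi> w = 0" "\<forall>\<^sub>F w in at z. \<phi> w \<noteq> 0" for z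
    proof -
      have "\<forall>\<^sub>F w in at z. False" using that by eventually_elim simp
      thus False by (simp add: trivial_limit_def[symmetric] eventually_False)
    qed
    thus ?thesis by (auto simp: Z_def N_def)
  qed
  have cover: "slice_set \<Omega> \<subseteq> Z \<union> N"
  proof
    fix z assume "z \<in> slice_set \<Omega>"
    hence "isolated_singularity_at \<phi> z" "not_essential \<phi> z"
      using mero by (auto simp: meromorphic_on_altdef)
    hence "(\<exists>\<^sub>F w in at z. \<phi> w = 0) \<longrightarrow> (\<forall>\<^sub>F w in at z. \<phi> w = 0)"
      using not_essential_frequently_0_imp_eventually_0 by blast
    thus "z \<in> Z \<union> N" by (auto simp: Z_def N_def frequently_def)
  qed
  have closed_cnj: "cnj z \<in> Z \<Longrightarrow> z \<in> Z" "cnj z \<in> N \<Longrightarrow> z \<in> N" for z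
    by (simp_all add: Z_def N_def sym eventually_filtermap flip: filtermap_cnj_at)
  have sep: "open (slice_coord -` Z)" "open (slice_coord -` N)"
    using op by (auto intro!: open_vimage continuous_slice_coord)
  have memO: "slice_coord q \<in> slice_set \<Omega>" if "q \<in> \<Omega>" for q
    using that slice_coord_mem_iff[OF circular_\<Omega>] by blast
  have "\<Omega> \<subseteq> slice_coord -` Z \<union> slice_coord -` N" using cover memO by auto
  moreover have "slice_coord -` Z \<inter> slice_coord -` N \<inter> \<Omega> = {}" using disj by auto
  ultimately have "slice_coord -` Z \<inter> \<Omega> = {} \<or> slice_coord -` N \<inter> \<Omega> = {}"
    using connectedD[OF connected_\<Omega> sep] by blast
  hence "\<Omega> \<subseteq> slice_coord -` N \<or> \<Omega> \<subseteq> slice_coord -` Z"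
    using \<open>\<Omega> \<subseteq> slice_coord -` Z \<union> slice_coord -` N\<close> by blast
  moreover have "slice_set \<Omega> \<subseteq> A" if "\<Omega> \<subseteq> slice_coord -` A" "\<And>z. cnj z \<in> A \<Longrightarrow> z \<in> A" for A
  proof
    fix z assume "z \<in> slice_set \<Omega>"
    then obtain q where "q \<in> \<Omega>" "slice_coord q = z \<or> slice_coord q = cnj z"
      using slice_set_slice_coord_or_cnj[OF circular_\<Omega>] by blast
    thus "z \<in> A" using that by auto
  qed
  ultimately have "slice_set \<Omega> \<subseteq> N \<or> slice_set \<Omega> \<subseteq> Z" using closed_cnj by meson
  thus ?thesis unfolding generically_iff by (auto simp: Z_def N_def \<phi>_def)
qed

lemma represents_zero_or_nonzero:
  assumes "represents \<Omega> f (\<lambda>z. bscalar (n z))"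
  shows "generically \<Omega> (\<lambda>z. n z = 0) \<or> generically \<Omega> (\<lambda>z. n z \<noteq> 0)"
proof -
  obtain C U where *: "stem_on \<Omega> C U" "generically \<Omega> (\<lambda>z. C z = bscalar (n z))"
    using assms(1) unfolding represents_def by blast
  have "generically \<Omega> (\<lambda>z. bq0 (C z) = 0) \<or> generically \<Omega> (\<lambda>z. bq0 (C z) \<noteq> 0)"
    by (rule stem_coord_zero_or_nonzero[OF *(1)]) simp
  thus ?thesis
  proof
    assume "generically \<Omega> (\<lambda>z. bq0 (C z) = 0)"
    with *(2) have "generically \<Omega> (\<lambda>z. n z = 0)" by eventually_elim simp
    thus ?thesis ..
  next
    assume "generically \<Omega> (\<lambda>z. bq0 (C z) \<noteq> 0)"
    with *(2) have "generically \<Omega> (\<lambda>z. n z \<noteq> 0)" by eventually_elim simp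
    thus ?thesis ..
  qed
qed

text \<open>Zeros of \<open>f\<close> become poles of the pointwise inverse, so they leave the domain of definition. They
  form isolated spheres because \<open>n\<close> is generically nonzero.\<close>
lemma represents_inverse:
  assumes f: "represents \<Omega> f (\<lambda>z. bscalar (n z))" and n: "generically \<Omega> (\<lambda>z. n z \<noteq> 0)"
  shows "represents \<Omega> (\<lambda>q. inverse (f q)) (\<lambda>z. bscalar (inverse (n z)))"
proof -
  obtain C U where C: "stem_on \<Omega> C U" "\<forall>q\<in>U. f q = blift C q" "generically \<Omega> (\<lambda>z. C z = bscalar (n z))"
    using f unfolding represents_def by blast
  define \<phi> where "\<phi> = (\<lambda>z. bq0 (C z))"
  have S: "stem_on \<Omega> (\<lambda>z. bscalar (\<phi> z)) U" unfolding \<phi>_def by (rule stem_on_coord[OF C(1)]) simp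
  have "generically \<Omega> (\<lambda>z. C z = bscalar (\<phi> z))" using C(3) by eventually_elim (simp add: \<phi>_def)
  hence C\<phi>: "C z = bscalar (\<phi> z)" if "z \<in> slice_set U" for z using stem_generic_eqD[OF C(1) S _ that] by blast
  have U: "U \<subseteq> \<Omega>" "open U" "circular U" "\<And>z. z \<in> slice_set \<Omega> \<Longrightarrow> \<forall>\<^sub>F w in at z. w \<in> slice_set U"
    using C(1) by (simp_all add: stem_on_def admissible_def)
  have sym: "\<phi> (cnj z) = cnj (\<phi> z)" for z
    using bsymmetricD[OF stem_on_bsymmetric[OF C(1)], of z] by (simp add: \<phi>_def)
  define A where "A = {z \<in> slice_set U. \<phi> z \<noteq> 0}"
  define V where "V = slice_coord -` A"
  have sV: "slice_set V = A"
    unfolding V_def by (rule slice_set_vimage) (auto simp: A_def sym cnj_mem_slice_set[OF U(3)])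
  have "open A"
  proof -
    have "continuous_on (slice_set U) \<phi>"
      unfolding \<phi>_def using stem_on_isCont[OF C(1)] by (intro continuous_at_imp_continuous_on) auto
    from continuous_open_preimage[OF this open_slice_set[OF U(2)], of "- {0}"]
    have "open (slice_set U \<inter> \<phi> -` (- {0}))" by blast
    moreover have "slice_set U \<inter> \<phi> -` (- {0}) = A" by (auto simp: A_def)
    ultimately show ?thesis by simp
  qed
  hence oV: "open V" unfolding V_def by (intro open_vimage continuous_slice_coord)
  have VU: "V \<subseteq> U" using slice_coord_mem_iff[OF U(3)] by (auto simp: V_def A_def)
  have gn: "generically \<Omega> (\<lambda>z. \<phi> z = n z)" using C(3) by eventually_elim (simp add: \<phi>_def)
  have "generically \<Omega> (\<lambda>z. z \<in> A)"
    using admissible_generically[OF stem_on_admissible[OF C(1)]] gn n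
    by eventually_elim (simp add: A_def)
  hence adm: "admissible \<Omega> V"
    unfolding admissible_def sV using VU U(1) oV slice_coord_vimage_circular[of A]
    by (auto simp: generically_iff V_def)
  define D where "D = (\<lambda>z. bscalar (inverse (\<phi> z)))"
  have "stem_on \<Omega> D V"
    unfolding stem_on_def
  proof (intro conjI adm)
    show "bsymmetric D" by (simp add: bsymmetric_def D_def sym biquat_eq_iff)
    have "\<phi> meromorphic_on slice_set \<Omega>"
      using C(1) by (simp add: stem_on_def stem_meromorphic_def \<phi>_def)
    thus "stem_meromorphic D (slice_set \<Omega>)"
      by (auto simp: stem_meromorphic_def D_def intro!: meromorphic_intros)
    have "\<phi> analytic_on slice_set U"
      using C(1) by (simp add: stem_on_def stem_analytic_def \<phi>_def)
    hence "\<phi> analytic_on A" by (rule analytic_on_subset) (auto simp: A_def)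
    hence "(\<lambda>z. inverse (\<phi> z)) analytic_on A" by (intro analytic_intros) (auto simp: A_def)
    thus "stem_analytic D (slice_set V)"
      by (auto simp: stem_analytic_def D_def sV)
  qed
  moreover have "inverse (f q) = blift D q" if q: "q \<in> V" for q
  proof -
    have "q \<in> U" using q VU by blast
    hence "f q = blift (\<lambda>z. bscalar (\<phi> z)) q"
      using C(2) C\<phi> slice_coord_mem_iff[OF U(3), of q] by (simp add: blift_def)
    thus ?thesis by (simp add: D_def blift_bscalar_inverse)
  qed
  moreover have "generically \<Omega> (\<lambda>z. D z = bscalar (inverse (n z)))"
    using gn by eventually_elim (simp add: D_def)
  ultimately show ?thesis unfolding represents_def by blast
qed

section \<open>Conjugation, symmetrization and equivalence on stems\<close>

text \<open>The coefficients \<open>P\<close> and \<open>Q\<close> of a value \<open>P + I Q\<close> of a slice preserving function lie in the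
  planes of \<open>quat_i\<close> and \<open>quat_j\<close>, so they are real and the stem is a scalar.\<close>
lemma SEM_R_iff:
  assumes f: "represents \<Omega> f B"
  shows "f \<in> SEM_R \<Omega> \<longleftrightarrow> generically \<Omega> (\<lambda>z. B z = bscalar (bq0 (B z)))"
proof
  assume "f \<in> SEM_R \<Omega>"
  then obtain U where U: "regular_off_poles \<Omega> f U"
    and sp: "\<forall>I\<in>\<S>. f ` (U \<inter> slice_plane I) \<subseteq> slice_plane I" unfolding SEM_R_def by blast
  have SR: "is_slice_function U f" "circular U"
    using U unfolding regular_off_poles_def SR_def by blast+
  have "stem_of f z = bscalar (bq0 (stem_of f z))" if z: "z \<in> slice_set U" for z
  proof -
    have "of_real (Re z) + quat_i * of_real (Im z) \<in> U" using z by (simp add: slice_set_def)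
    from slice_preserving_stem[OF SR this quat_i_unit sp] obtain a b where ab:
      "f (of_real (Re z) + quat_i * of_real (Im z)) = of_real a + quat_i * of_real b"
      "f (of_real (Re z) - quat_i * of_real (Im z)) = of_real a - quat_i * of_real b" by blast
    have "stem1 f quat_i (Re z, Im z) = of_real a" "stem2 f quat_i (Re z, Im z) = of_real b"
      by (simp_all only: stem1_def stem2_def prod.case ab) (simp_all add: quat_eq_iff)
    hence "bRe (stem_of f z) = of_real a" "bIm (stem_of f z) = of_real b"
      by (simp_all only: bRe_bIm_stem_of)
    thus ?thesis by (simp add: bRe_def bIm_def quat_eq_iff biquat_eq_iff complex_eq_iff)
  qed
  hence "generically \<Omega> (\<lambda>z. stem_of f z = bscalar (bq0 (stem_of f z)))"
    using admissible_generically[OF stem_on_admissible[OF regular_off_poles_stem_of(1)[OF U]]]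
    by (auto elim: eventually_mono)
  moreover have "generically \<Omega> (\<lambda>z. B z = stem_of f z)"
    by (rule represents_unique[OF f represents_stem_of[OF U]])
  ultimately show "generically \<Omega> (\<lambda>z. B z = bscalar (bq0 (B z)))" by eventually_elim simp
next
  assume B: "generically \<Omega> (\<lambda>z. B z = bscalar (bq0 (B z)))"
  obtain C U where C: "stem_on \<Omega> C U" "\<forall>q\<in>U. f q = blift C q" "generically \<Omega> (\<lambda>z. C z = B z)"
    using f unfolding represents_def by blast
  have "generically \<Omega> (\<lambda>z. C z = bscalar (bq0 (C z)))" using B C(3) by eventually_elim simp
  hence Cs: "C z = bscalar (bq0 (C z))" if "z \<in> slice_set U" for z
    using stem_generic_eqD[OF C(1) stem_on_coord[OF C(1), of bq0]] that by blast
  have "f q \<in> slice_plane I" if I: "I \<in> \<S>" and q: "q \<in> U" "q \<in> slice_plane I" for I q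
  proof -
    obtain x y where xy: "q = of_real x + I * of_real y" using q(2) unfolding slice_plane_def by blast
    have "Complex x y \<in> slice_set U"
      using mem_slice_set_iff[OF stem_on_circular[OF C(1)] I] q(1) xy by blast
    hence "f q = beval I (bscalar (bq0 (C (Complex x y))))"
      using C(2) q(1) Cs blift_slice[OF stem_on_bsymmetric[OF C(1)] I] xy by metis
    thus ?thesis unfolding beval_bscalar slice_plane_def by blast
  qed
  moreover have "regular_off_poles \<Omega> f U"
    by (rule regular_off_polesI[OF open_\<Omega> circular_\<Omega> C(1)]) (use C(2) in blast)
  ultimately show "f \<in> SEM_R \<Omega>" unfolding SEM_R_def by blast
qed

lemma SEM_R_represents:
  assumes "f \<in> SEM_R \<Omega>"
  obtains n where "represents \<Omega> f (\<lambda>z. bscalar (n z))"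
proof -
  have "f \<in> SEM \<Omega>" using assms unfolding SEM_R_def SEM_def by blast
  then obtain B where B: "represents \<Omega> f B" by (rule SEM_represents)
  have "represents \<Omega> f (\<lambda>z. bscalar (bq0 (B z)))"
    by (rule represents_cong[OF B]) (use SEM_R_iff[OF B] assms in blast)
  thus ?thesis by (rule that)
qed

text \<open>Whatever decomposition the choice in \<open>sem_conj\<close> selects, its four stems are the coordinates of
  \<open>B\<close> at generic points.\<close>
lemma represents_conj:
  assumes f: "represents \<Omega> f B"
  shows "represents \<Omega> (sem_conj \<Omega> f) (\<lambda>z. bconj (B z))"
proof -
  obtain f0 f1 f2 f3 where eq: "(SOME c. sem_decomp \<Omega> f c) = (f0, f1, f2, f3)"
    by (rule prod_cases4)
  have d: "sem_decomp \<Omega> f (f0, f1, f2, f3)"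
    using someI_ex[OF sem_decomp_exists[OF represents_SEM[OF f]]] eq by simp
  hence R: "f0 \<in> SEM_R \<Omega>" "f1 \<in> SEM_R \<Omega>" "f2 \<in> SEM_R \<Omega>" "f3 \<in> SEM_R \<Omega>"
    and se: "sem_eq \<Omega> f (\<lambda>q. f0 q + f1 q * quat_i + f2 q * quat_j + f3 q * quat_k)"
    by (simp_all add: sem_decomp_def)
  obtain b0 where b0: "represents \<Omega> f0 (\<lambda>z. bscalar (b0 z))" by (rule SEM_R_represents[OF R(1)])
  obtain b1 where b1: "represents \<Omega> f1 (\<lambda>z. bscalar (b1 z))" by (rule SEM_R_represents[OF R(2)])
  obtain b2 where b2: "represents \<Omega> f2 (\<lambda>z. bscalar (b2 z))" by (rule SEM_R_represents[OF R(3)])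
  obtain b3 where b3: "represents \<Omega> f3 (\<lambda>z. bscalar (b3 z))" by (rule SEM_R_represents[OF R(4)])
  have u: "bcnj bi = bi" "bcnj bj = bj" "bcnj bk = bk"
    by (simp_all add: biquat_eq_iff bi_def bj_def bk_def)
  have r: "bRe bi = quat_i" "bRe bj = quat_j" "bRe bk = quat_k"
    by (simp_all add: bRe_def bi_def bj_def bk_def)
  note v = represents_mult_const[OF b1 u(1), unfolded r]
    represents_mult_const[OF b2 u(2), unfolded r]
    represents_mult_const[OF b3 u(3), unfolded r]
  have "generically \<Omega> (\<lambda>z. B z = bscalar (b0 z) + bscalar (b1 z) * bi + bscalar (b2 z) * bj + bscalar (b3 z) * bk)"
    using se sem_eq_iff[OF f represents_add[OF represents_add[OF represents_add[OF b0 v(1)] v(2)] v(3)]]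
    by blast
  hence "generically \<Omega> (\<lambda>z. bscalar (b0 z) -
      (bscalar (b1 z) * bi + bscalar (b2 z) * bj + bscalar (b3 z) * bk) = bconj (B z))"
    by eventually_elim (simp add: biquat_eq_iff bi_def bj_def bk_def)
  moreover have "sem_conj \<Omega> f = (\<lambda>q. f0 q - (f1 q * quat_i + f2 q * quat_j + f3 q * quat_k))"
    by (simp add: sem_conj_def eq)
  ultimately show ?thesis
    using represents_cong[OF represents_diff[OF b0 represents_add[OF represents_add[OF v(1,2)] v(3)]]]
    by simp
qed

lemma represents_symm:
  assumes "represents \<Omega> f B"
  shows "represents \<Omega> (sem_symm \<Omega> f) (\<lambda>z. bscalar (bnorm (B z)))"
  using represents_star[OF assms represents_conj[OF assms]]
  by (simp add: sem_symm_def mult_bconj)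

lemma represents_vec_part:
  assumes f: "represents \<Omega> f B"
  shows "represents \<Omega> (sem_vec_part \<Omega> f) (\<lambda>z. bvec (B z))"
proof -
  have h: "bcnj (bscalar (1 / 2)) = bscalar (1 / 2)" by (simp add: biquat_eq_iff)
  have "sem_vec_part \<Omega> f = (\<lambda>q. f q - (f q + sem_conj \<Omega> f q) * bRe (bscalar (1 / 2)))"
    by (simp add: fun_eq_iff sem_vec_part_def sem_real_part_def quat_eq_iff bRe_def)
  moreover have "B z - (B z + bconj (B z)) * bscalar (1 / 2) = bvec (B z)" for z
    by (simp add: biquat_eq_iff)
  ultimately show ?thesis
    using represents_diff[OF f represents_mult_const[OF represents_add[OF f represents_conj[OF f]] h]]
    by simp
qed

lemma bscalar_0: "bscalar n = 0 \<longleftrightarrow> n = 0"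
  by (simp add: biquat_eq_iff)

lemma sem_symm_eq_0_iff:
  assumes "represents \<Omega> f B"
  shows "sem_eq \<Omega> (sem_symm \<Omega> f) (\<lambda>_. 0) \<longleftrightarrow> generically \<Omega> (\<lambda>z. bnorm (B z) = 0)"
  using sem_eq_iff[OF represents_symm[OF assms] represents_0] by (simp add: bscalar_0)

lemma represents_star_inverse:
  assumes h: "represents \<Omega> h H" and "generically \<Omega> (\<lambda>z. bnorm (H z) \<noteq> 0)"
  shows "represents \<Omega> (star_inverse \<Omega> h) (\<lambda>z. binverse (H z))"
  using represents_star[OF represents_inverse[OF represents_symm[OF h] assms(2)] represents_conj[OF h]]
  by (simp add: star_inverse_def binverse_def)

text \<open>Clearing the inverse leaves the linear equation \<open>h f = g h\<close>. By the identity principle a norm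
  that does not vanish identically is generically nonzero, so the equation can be solved for \<open>f\<close>
  again.\<close>
lemma sem_equivalent_iff:
  assumes f: "represents \<Omega> f F" and g: "represents \<Omega> g G"
  shows "sem_equivalent \<Omega> f g \<longleftrightarrow>
    (\<exists>h H. represents \<Omega> h H \<and> \<not> generically \<Omega> (\<lambda>z. bnorm (H z) = 0) \<and>
       generically \<Omega> (\<lambda>z. bnorm (H z) \<noteq> 0) \<and> generically \<Omega> (\<lambda>z. H z * F z = G z * H z))"
proof -
  have conj: "sem_eq \<Omega> f (star_inverse \<Omega> h \<star> g \<star> h) \<longleftrightarrow> generically \<Omega> (\<lambda>z. H z * F z = G z * H z)"
    if h: "represents \<Omega> h H" and nz: "generically \<Omega> (\<lambda>z. bnorm (H z) \<noteq> 0)" for h H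
  proof -
    have "sem_eq \<Omega> f (star_inverse \<Omega> h \<star> g \<star> h) \<longleftrightarrow>
        generically \<Omega> (\<lambda>z. F z = binverse (H z) * G z * H z)"
      by (rule sem_eq_iff[OF f represents_star[OF represents_star[OF represents_star_inverse[OF h nz] g] h]])
    also have "\<dots> \<longleftrightarrow> generically \<Omega> (\<lambda>z. H z * F z = G z * H z)"
      by (rule eventually_subst) (use nz in \<open>eventually_elim, simp add: binverse_conjugation_iff\<close>)
    finally show ?thesis .
  qed
  have inv: "star_invertible \<Omega> h \<longleftrightarrow> \<not> generically \<Omega> (\<lambda>z. bnorm (H z) = 0)"
    if h: "represents \<Omega> h H" for h H
    using represents_SEM[OF h] sem_symm_eq_0_iff[OF h] by (simp add: star_invertible_def)
  have nz: "generically \<Omega> (\<lambda>z. bnorm (H z) \<noteq> 0)"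
    if h: "represents \<Omega> h H" and "\<not> generically \<Omega> (\<lambda>z. bnorm (H z) = 0)" for h H
    using represents_zero_or_nonzero[OF represents_symm[OF h]] that(2) by blast
  show ?thesis
  proof
    assume "sem_equivalent \<Omega> f g"
    then obtain h where h: "star_invertible \<Omega> h" "sem_eq \<Omega> f (star_inverse \<Omega> h \<star> g \<star> h)"
      unfolding sem_equivalent_def by blast
    then obtain H where H: "represents \<Omega> h H"
      using SEM_represents unfolding star_invertible_def by blast
    thus "\<exists>h H. represents \<Omega> h H \<and> \<not> generically \<Omega> (\<lambda>z. bnorm (H z) = 0) \<and>
       generically \<Omega> (\<lambda>z. bnorm (H z) \<noteq> 0) \<and> generically \<Omega> (\<lambda>z. H z * F z = G z * H z)"
      using h inv[OF H] nz[OF H] conj[OF H] by blast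
  next
    assume "\<exists>h H. represents \<Omega> h H \<and> \<not> generically \<Omega> (\<lambda>z. bnorm (H z) = 0) \<and>
       generically \<Omega> (\<lambda>z. bnorm (H z) \<noteq> 0) \<and> generically \<Omega> (\<lambda>z. H z * F z = G z * H z)"
    thus "sem_equivalent \<Omega> f g" unfolding sem_equivalent_def using inv conj by blast
  qed
qed

text \<open>If all four candidate intertwiners had identically vanishing norm, so would the vector part, by
  \<open>intertwiner_norm_sum\<close>.\<close>
lemma sem_equivalent_of_equal_norms:
  assumes f: "represents \<Omega> f F" and g: "represents \<Omega> g G"
    and re: "generically \<Omega> (\<lambda>z. bq0 (F z) = bq0 (G z))"
    and nm: "generically \<Omega> (\<lambda>z. bnorm (bvec (F z)) = bnorm (bvec (G z)))"
    and nz: "\<not> generically \<Omega> (\<lambda>z. bnorm (bvec (F z)) = 0)"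
  shows "sem_equivalent \<Omega> f g"
proof -
  define H where "H = (\<lambda>u z. bvec (G z) * u + u * bvec (F z))"
  have rep: "\<exists>h. represents \<Omega> h (H u)" if u: "u \<in> {1, bi, bj, bk}" for u
  proof -
    have "bcnj u = u" using u by (auto simp: biquat_eq_iff bi_def bj_def bk_def)
    note c = represents_const[OF this]
    show ?thesis
      unfolding H_def
      using represents_add[OF represents_star[OF represents_vec_part[OF g] c]
          represents_star[OF c represents_vec_part[OF f]]] by blast
  qed
  have "\<exists>u\<in>{1, bi, bj, bk}. \<not> generically \<Omega> (\<lambda>z. bnorm (H u z) = 0)"
  proof (rule ccontr)
    assume "\<not> ?thesis"
    hence "generically \<Omega> (\<lambda>z. bnorm (H 1 z) = 0)" "generically \<Omega> (\<lambda>z. bnorm (H bi z) = 0)"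
      "generically \<Omega> (\<lambda>z. bnorm (H bj z) = 0)" "generically \<Omega> (\<lambda>z. bnorm (H bk z) = 0)" by blast+
    with nm have "generically \<Omega> (\<lambda>z. bnorm (bvec (F z)) = 0)"
    proof eventually_elim
      case (elim z)
      show ?case using intertwiner_norm_sum[OF refl elim(1)[symmetric]] elim by (simp add: H_def)
    qed
    thus False using nz by blast
  qed
  then obtain u where u: "u \<in> {1, bi, bj, bk}" "\<not> generically \<Omega> (\<lambda>z. bnorm (H u z) = 0)" by blast
  obtain h where h: "represents \<Omega> h (H u)" using rep[OF u(1)] by blast
  have "generically \<Omega> (\<lambda>z. H u z * F z = G z * H u z)"
    using re nm by eventually_elim (simp add: H_def intertwiner_conjugates)
  moreover have "generically \<Omega> (\<lambda>z. bnorm (H u z) \<noteq> 0)"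
    using represents_zero_or_nonzero[OF represents_symm[OF h]] u(2) by blast
  ultimately show ?thesis using sem_equivalent_iff[OF f g] h u(2) by blast
qed

section \<open>One-slice preserving functions\<close>

text \<open>The values at \<open>x + I y\<close> and \<open>x - I y\<close> lie in the plane of \<open>I\<close>, hence so do both parts of the stem,
  and the vector part is a complex multiple \<open>\<phi>\<close> of \<open>I\<close>. As a coordinate of the star product of \<open>g\<close>
  with \<open>- I\<close>, \<open>\<phi>\<close> is again the stem of a semi-regular function.\<close>
lemma one_slice_preserving_norm_square:
  assumes g: "represents \<Omega> g G" and "one_slice_preserving \<Omega> g"
  obtains r \<phi> where "represents \<Omega> r (\<lambda>z. bscalar (\<phi> z))"
    "generically \<Omega> (\<lambda>z. bnorm (bvec (G z)) = (\<phi> z)\<^sup>2)"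
    "generically \<Omega> (\<lambda>z. \<phi> z = 0 \<longrightarrow> bvec (G z) = 0)"
proof -
  obtain U I where U: "regular_off_poles \<Omega> g U" and I: "I \<in> \<S>"
    and sp: "g ` (U \<inter> slice_plane I) \<subseteq> slice_plane I"
    using assms(2) unfolding one_slice_preserving_def by blast
  \<comment> \<open>The constant \<open>- I\<close>: the scalar part of \<open>G * (- I)\<close> is the component of \<open>G\<close> along \<open>I\<close>.\<close>
  define b where "b = Biquat 0 (- of_real (qI I)) (- of_real (qJ I)) (- of_real (qK I))"
  have b: "bcnj b = b" by (simp add: b_def biquat_eq_iff)
  define \<phi> where "\<phi> = (\<lambda>z. bq0 (G z * b))"
  have \<phi>: "\<phi> z = bq1 (G z) * of_real (qI I) + bq2 (G z) * of_real (qJ I) + bq3 (G z) * of_real (qK I)" for z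
    by (simp add: \<phi>_def b_def)
  have unit: "(of_real (qI I))\<^sup>2 + (of_real (qJ I))\<^sup>2 + (of_real (qK I))\<^sup>2 = (1 :: complex)"
    using imag_unit_re(2)[OF I] by (simp flip: of_real_power of_real_add)
  have S: "stem_on \<Omega> (stem_of g) U" and gS: "\<And>q. q \<in> U \<Longrightarrow> g q = blift (stem_of g) q"
    using regular_off_poles_stem_of[OF U] by blast+
  have circ: "circular U" by (rule stem_on_circular[OF S])
  have along: "\<exists>c. bvec (stem_of g z) = Biquat 0 (c * of_real (qI I)) (c * of_real (qJ I)) (c * of_real (qK I))"
    if z: "z \<in> slice_set U" for z
  proof -
    have in_plane: "beval J (stem_of g z) \<in> slice_plane I" if J: "J = I \<or> J = - I" for J
    proof -
      have JS: "J \<in> \<S>" using I imag_unit_uminus J by blast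
      let ?q = "of_real (Re z) + J * of_real (Im z)"
      have "Complex (Re z) (Im z) \<in> slice_set U" using z by simp
      hence q: "?q \<in> U" using mem_slice_set_iff[OF circ JS] by blast
      have "?q = of_real (Re z) + I * of_real (if J = I then Im z else - Im z)" using J by auto
      hence "?q \<in> slice_plane I" unfolding slice_plane_def by blast
      hence "g ?q \<in> slice_plane I" using sp q by blast
      thus ?thesis using gS[OF q] blift_slice[OF stem_on_bsymmetric[OF S] JS] by simp
    qed
    obtain s t where st: "bRe (stem_of g z) + I * bIm (stem_of g z) = of_real s + I * of_real t"
      using in_plane[of I] unfolding beval_def slice_plane_def by blast
    obtain s' t' where st': "bRe (stem_of g z) - I * bIm (stem_of g z) = of_real s' + I * of_real t'"
      using in_plane[of "- I"] unfolding beval_def slice_plane_def by auto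
    have two: "2 *\<^sub>R bRe (stem_of g z) = of_real (s + s') + I * of_real (t + t')"
      using arg_cong2[OF st st', of "(+)"] by (simp add: scaleR_2 algebra_simps)
    have "2 *\<^sub>R (I * bIm (stem_of g z)) = of_real (s - s') + I * of_real (t - t')"
      using arg_cong2[OF st st', of "(-)"] by (simp add: scaleR_2 algebra_simps)
    hence "I * (2 *\<^sub>R (I * bIm (stem_of g z))) = I * (of_real (s - s') + I * of_real (t - t'))" by simp
    hence three: "2 *\<^sub>R bIm (stem_of g z) = of_real (t - t') - I * of_real (s - s')"
      using imag_unit_mult2[OF I] by (simp add: distrib_left eq_neg_iff_add_eq_0 algebra_simps)
    have "2 * Re (bq1 (stem_of g z)) = (t + t') * qI I" "2 * Re (bq2 (stem_of g z)) = (t + t') * qJ I"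
      "2 * Re (bq3 (stem_of g z)) = (t + t') * qK I"
      using two by (simp_all add: bRe_def quat_eq_iff mult.commute)
    moreover have "2 * Im (bq1 (stem_of g z)) = - (s - s') * qI I" "2 * Im (bq2 (stem_of g z)) = - (s - s') * qJ I"
      "2 * Im (bq3 (stem_of g z)) = - (s - s') * qK I"
      using three by (simp_all add: bIm_def quat_eq_iff algebra_simps)
    ultimately show ?thesis
      by (intro exI[of _ "Complex ((t + t') / 2) (- (s - s') / 2)"]) (simp add: biquat_eq_iff complex_eq_iff)
  qed
  have "generically \<Omega> (\<lambda>z. stem_of g z = G z)"
    by (rule represents_unique[OF represents_stem_of[OF U] g])
  hence main: "generically \<Omega> (\<lambda>z. bvec (G z) =
      Biquat 0 (\<phi> z * of_real (qI I)) (\<phi> z * of_real (qJ I)) (\<phi> z * of_real (qK I)))"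
    using admissible_generically[OF stem_on_admissible[OF S]]
  proof eventually_elim
    case (elim z)
    then obtain c where c: "bvec (G z) = Biquat 0 (c * of_real (qI I)) (c * of_real (qJ I)) (c * of_real (qK I))"
      using along by metis
    hence "bq1 (G z) = c * of_real (qI I)" "bq2 (G z) = c * of_real (qJ I)" "bq3 (G z) = c * of_real (qK I)"
      by (simp_all add: biquat_eq_iff)
    hence "\<phi> z = c * ((of_real (qI I))\<^sup>2 + (of_real (qJ I))\<^sup>2 + (of_real (qK I))\<^sup>2)"
      unfolding \<phi> by (simp add: power2_eq_square algebra_simps)
    hence "\<phi> z = c" unfolding unit by simp
    thus ?case using c by simp
  qed
  have "generically \<Omega> (\<lambda>z. bnorm (bvec (G z)) = (\<phi> z)\<^sup>2)"
    using main
  proof eventually_elim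
    case (elim z)
    have "bnorm (bvec (G z)) = (\<phi> z)\<^sup>2 * ((of_real (qI I))\<^sup>2 + (of_real (qJ I))\<^sup>2 + (of_real (qK I))\<^sup>2)"
      unfolding elim bnorm_def by (simp add: power_mult_distrib algebra_simps)
    thus ?case unfolding unit by simp
  qed
  moreover have "generically \<Omega> (\<lambda>z. \<phi> z = 0 \<longrightarrow> bvec (G z) = 0)"
    using main by eventually_elim (simp add: biquat_eq_iff)
  moreover obtain r where "represents \<Omega> r (\<lambda>z. bscalar (\<phi> z))"
    using represents_coord[OF represents_mult_const[OF g b], of bq0] unfolding \<phi>_def by auto
  ultimately show ?thesis using that by blast
qed

lemma one_slice_preservingI:
  assumes g: "represents \<Omega> g (\<lambda>z. Biquat (a z) (b z) 0 0)"
  shows "one_slice_preserving \<Omega> g"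
proof -
  obtain C U where C: "stem_on \<Omega> C U" "\<forall>q\<in>U. g q = blift C q"
    and ev: "generically \<Omega> (\<lambda>z. C z = Biquat (a z) (b z) 0 0)"
    using g unfolding represents_def by blast
  have zero: "c (C z) = 0" if c: "c \<in> {bq2, bq3}" and z: "z \<in> slice_set U" for c z
  proof -
    have "stem_on \<Omega> (\<lambda>z. bscalar (c (C z))) U" by (rule stem_on_coord[OF C(1)]) (use c in auto)
    moreover have "stem_on \<Omega> (\<lambda>z. 0) U"
      by (rule stem_on_const[OF stem_on_admissible[OF C(1)]]) (simp add: biquat_eq_iff)
    moreover have "generically \<Omega> (\<lambda>z. bscalar (c (C z)) = 0)"
      using ev by eventually_elim (use c in \<open>auto simp: biquat_eq_iff\<close>)
    ultimately have "bscalar (c (C z)) = 0" using z by (rule stem_generic_eqD)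
    thus ?thesis by (simp add: bscalar_0)
  qed
  have "g q \<in> slice_plane quat_i" if q: "q \<in> U" "q \<in> slice_plane quat_i" for q
  proof -
    obtain x y where xy: "q = of_real x + quat_i * of_real y" using q(2) unfolding slice_plane_def by blast
    have z: "Complex x y \<in> slice_set U"
      using mem_slice_set_iff[OF stem_on_circular[OF C(1)] quat_i_unit] q(1) xy by blast
    have "g q = beval quat_i (C (Complex x y))"
      using C(2) q(1) blift_slice[OF stem_on_bsymmetric[OF C(1)] quat_i_unit] xy by metis
    moreover have "qJ (beval quat_i (C (Complex x y))) = 0" "qK (beval quat_i (C (Complex x y))) = 0"
      using zero[OF _ z, of bq2] zero[OF _ z, of bq3] by (simp_all add: beval_def bRe_def bIm_def)
    ultimately have "g q = of_real (qRe (g q)) + quat_i * of_real (qI (g q))" by (simp add: quat_eq_iff)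
    thus ?thesis unfolding slice_plane_def by blast
  qed
  moreover have "regular_off_poles \<Omega> g U"
    by (rule regular_off_polesI[OF open_\<Omega> circular_\<Omega> C(1)]) (use C(2) in blast)
  ultimately show ?thesis unfolding one_slice_preserving_def using quat_i_unit by blast
qed

text \<open>The norm of the vector part is invariant under equivalence, and for a function preserving the
  slice of \<open>I\<close> it is the square of the component along \<open>I\<close>. A square root \<open>r\<close> in turn serves as the
  component along \<open>quat_i\<close> of the function \<open>f\<^sub>0 + r i\<close> equivalent to \<open>f\<close>.\<close>
theorem equivalent_one_slice_preserving_iff:
  assumes f: "f \<in> SEM \<Omega> - SEM_R \<Omega>"
  shows "(\<exists>g \<in> SEM \<Omega> - SEM_R \<Omega>. one_slice_preserving \<Omega> g \<and> sem_equivalent \<Omega> f g) \<longleftrightarrow>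
    (\<not> sem_eq \<Omega> (sem_symm \<Omega> (sem_vec_part \<Omega> f)) (\<lambda>_. 0) \<and>
     (\<exists>r \<in> SEM_R \<Omega>. sem_eq \<Omega> (r \<star> r) (sem_symm \<Omega> (sem_vec_part \<Omega> f))))"
proof -
  obtain F where F: "represents \<Omega> f F" using SEM_represents f by blast
  note symm = represents_symm[OF represents_vec_part[OF F]]
  have eq0: "sem_eq \<Omega> (sem_symm \<Omega> (sem_vec_part \<Omega> f)) (\<lambda>_. 0) \<longleftrightarrow>
      generically \<Omega> (\<lambda>z. bnorm (bvec (F z)) = 0)"
    by (rule sem_symm_eq_0_iff[OF represents_vec_part[OF F]])
  have sq: "sem_eq \<Omega> (r \<star> r) (sem_symm \<Omega> (sem_vec_part \<Omega> f)) \<longleftrightarrow>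
      generically \<Omega> (\<lambda>z. (\<phi> z)\<^sup>2 = bnorm (bvec (F z)))"
    if "represents \<Omega> r (\<lambda>z. bscalar (\<phi> z))" for r \<phi>
    using sem_eq_iff[OF represents_star[OF that that] symm]
    by (simp add: biquat_eq_iff power2_eq_square)
  show ?thesis
  proof
    assume "\<exists>g \<in> SEM \<Omega> - SEM_R \<Omega>. one_slice_preserving \<Omega> g \<and> sem_equivalent \<Omega> f g"
    then obtain g where g: "g \<in> SEM \<Omega>" "g \<notin> SEM_R \<Omega>" "one_slice_preserving \<Omega> g" "sem_equivalent \<Omega> f g"
      by blast
    obtain G where G: "represents \<Omega> g G" using SEM_represents[OF g(1)] .
    obtain H where H: "generically \<Omega> (\<lambda>z. bnorm (H z) \<noteq> 0)" "generically \<Omega> (\<lambda>z. H z * F z = G z * H z)"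
      using g(4) sem_equivalent_iff[OF F G] by blast
    have FG: "generically \<Omega> (\<lambda>z. bnorm (bvec (F z)) = bnorm (bvec (G z)))"
      using H by eventually_elim (rule bnorm_bvec_conjugate)
    obtain r \<phi> where r: "represents \<Omega> r (\<lambda>z. bscalar (\<phi> z))"
      "generically \<Omega> (\<lambda>z. bnorm (bvec (G z)) = (\<phi> z)\<^sup>2)"
      "generically \<Omega> (\<lambda>z. \<phi> z = 0 \<longrightarrow> bvec (G z) = 0)"
      using one_slice_preserving_norm_square[OF G g(3)] .
    have "r \<in> SEM_R \<Omega>" using SEM_R_iff[OF r(1)] by simp
    moreover have "sem_eq \<Omega> (r \<star> r) (sem_symm \<Omega> (sem_vec_part \<Omega> f))"
      unfolding sq[OF r(1)] using FG r(2) by eventually_elim simp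
    moreover have "\<not> generically \<Omega> (\<lambda>z. bnorm (bvec (F z)) = 0)"
    proof
      assume "generically \<Omega> (\<lambda>z. bnorm (bvec (F z)) = 0)"
      hence "generically \<Omega> (\<lambda>z. G z = bscalar (bq0 (G z)))"
        using FG r(2,3) by eventually_elim (auto simp: biquat_eq_iff)
      thus False using SEM_R_iff[OF G] g(2) by blast
    qed
    ultimately show "\<not> sem_eq \<Omega> (sem_symm \<Omega> (sem_vec_part \<Omega> f)) (\<lambda>_. 0) \<and>
     (\<exists>r \<in> SEM_R \<Omega>. sem_eq \<Omega> (r \<star> r) (sem_symm \<Omega> (sem_vec_part \<Omega> f)))" using eq0 by blast
  next
    assume *: "\<not> sem_eq \<Omega> (sem_symm \<Omega> (sem_vec_part \<Omega> f)) (\<lambda>_. 0) \<and>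
     (\<exists>r \<in> SEM_R \<Omega>. sem_eq \<Omega> (r \<star> r) (sem_symm \<Omega> (sem_vec_part \<Omega> f)))"
    then obtain r where r: "r \<in> SEM_R \<Omega>" "sem_eq \<Omega> (r \<star> r) (sem_symm \<Omega> (sem_vec_part \<Omega> f))" by blast
    obtain \<phi> where \<phi>: "represents \<Omega> r (\<lambda>z. bscalar (\<phi> z))" using SEM_R_represents[OF r(1)] .
    have nz: "\<not> generically \<Omega> (\<lambda>z. bnorm (bvec (F z)) = 0)" using * eq0 by blast
    have n: "generically \<Omega> (\<lambda>z. (\<phi> z)\<^sup>2 = bnorm (bvec (F z)))" using r(2) sq[OF \<phi>] by blast
    obtain f0 where f0: "represents \<Omega> f0 (\<lambda>z. bscalar (bq0 (F z)))"
      using represents_coord[OF F, of bq0] by auto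
    have i: "bcnj bi = bi" by (simp add: bi_def biquat_eq_iff)
    \<comment> \<open>Any other imaginary unit could replace \<open>i\<close>: only the norm \<open>r\<^sup>2\<close> of the vector part counts.\<close>
    define g where "g = (\<lambda>q. f0 q + r q * bRe bi)"
    have "represents \<Omega> g (\<lambda>z. bscalar (bq0 (F z)) + bscalar (\<phi> z) * bi)"
      unfolding g_def by (rule represents_add[OF f0 represents_mult_const[OF \<phi> i]])
    moreover have "bscalar (bq0 (F z)) + bscalar (\<phi> z) * bi = Biquat (bq0 (F z)) (\<phi> z) 0 0" for z
      by (simp add: biquat_eq_iff bi_def)
    ultimately have g: "represents \<Omega> g (\<lambda>z. Biquat (bq0 (F z)) (\<phi> z) 0 0)" by simp
    have "sem_equivalent \<Omega> f g"
    proof (rule sem_equivalent_of_equal_norms[OF F g _ _ nz])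
      show "generically \<Omega> (\<lambda>z. bnorm (bvec (F z)) = bnorm (bvec (Biquat (bq0 (F z)) (\<phi> z) 0 0)))"
        using n by eventually_elim (simp add: bnorm_def)
    qed simp
    moreover have "g \<notin> SEM_R \<Omega>"
    proof
      assume "g \<in> SEM_R \<Omega>"
      hence "generically \<Omega> (\<lambda>z. \<phi> z = 0)" using SEM_R_iff[OF g] by (simp add: biquat_eq_iff)
      with n have "generically \<Omega> (\<lambda>z. bnorm (bvec (F z)) = 0)" by eventually_elim simp
      thus False using nz by blast
    qed
    ultimately show "\<exists>g \<in> SEM \<Omega> - SEM_R \<Omega>. one_slice_preserving \<Omega> g \<and> sem_equivalent \<Omega> f g"
      using represents_SEM[OF g] one_slice_preservingI[OF g] by blast
  qed
qed

section \<open>Idempotents\<close>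

text \<open>The vector part of \<open>\<sigma> \<star> \<sigma> = \<sigma>\<close> says that \<open>2 \<sigma>\<^sub>0 - 1\<close> annihilates the vector part of \<open>\<sigma>\<close>. If
  \<open>2 \<sigma>\<^sub>0 - 1\<close> is not identically zero, then \<open>\<sigma>\<close> is scalar and satisfies \<open>\<sigma>\<^sub>0 (\<sigma>\<^sub>0 - 1) = 0\<close>, which
  leaves only \<open>0\<close> and \<open>1\<close>.\<close>
lemma idempotent_stem:
  assumes f: "represents \<Omega> f S" and idem: "sem_idempotent \<Omega> f"
  shows "generically \<Omega> (\<lambda>z. bq0 (S z) = 1 / 2 \<and> bnorm (bvec (S z)) = - 1 / 4)"
    and "\<not> generically \<Omega> (\<lambda>z. False)"
proof -
  have n0: "\<not> generically \<Omega> (\<lambda>z. S z = 0)" and n1: "\<not> generically \<Omega> (\<lambda>z. S z = 1)"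
    and sq: "generically \<Omega> (\<lambda>z. S z * S z = S z)"
    using idem sem_eq_iff[OF f represents_0] sem_eq_iff[OF f represents_1]
      sem_eq_iff[OF represents_star[OF f f] f] by (auto simp: sem_idempotent_def)
  show "\<not> generically \<Omega> (\<lambda>z. False)"
  proof
    assume "generically \<Omega> (\<lambda>z. False)"
    hence "generically \<Omega> (\<lambda>z. S z = 0)" by (rule eventually_mono) simp
    thus False using n0 by blast
  qed
  have coords: "generically \<Omega> (\<lambda>z. (2 * bq0 (S z) - 1) * bq1 (S z) = 0 \<and> (2 * bq0 (S z) - 1) * bq2 (S z) = 0 \<and>
      (2 * bq0 (S z) - 1) * bq3 (S z) = 0 \<and> (bq0 (S z))\<^sup>2 - bnorm (bvec (S z)) = bq0 (S z))"
    using sq by eventually_elim (simp add: biquat_eq_iff bnorm_def power2_eq_square algebra_simps)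
  obtain s where s: "represents \<Omega> s (\<lambda>z. bscalar (bq0 (S z)))"
    using represents_coord[OF f, of bq0] by auto
  have "represents \<Omega> (\<lambda>q. s q + s q - 1) (\<lambda>z. bscalar (bq0 (S z)) + bscalar (bq0 (S z)) - 1)"
    by (intro represents_diff represents_add represents_1 s)
  moreover have "bscalar n + bscalar n - 1 = bscalar (2 * n - 1)" for n
    by (simp add: biquat_eq_iff)
  ultimately have "represents \<Omega> (\<lambda>q. s q + s q - 1) (\<lambda>z. bscalar (2 * bq0 (S z) - 1))" by simp
  from represents_zero_or_nonzero[OF this]
  have "generically \<Omega> (\<lambda>z. 2 * bq0 (S z) - 1 = 0)"
  proof
    assume "generically \<Omega> (\<lambda>z. 2 * bq0 (S z) - 1 \<noteq> 0)"
    with coords have real: "generically \<Omega> (\<lambda>z. S z = bscalar (bq0 (S z)) \<and> bq0 (S z) * (bq0 (S z) - 1) = 0)"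
      by eventually_elim (auto simp: biquat_eq_iff bnorm_def power2_eq_square algebra_simps)
    from represents_zero_or_nonzero[OF s] show ?thesis
    proof
      assume "generically \<Omega> (\<lambda>z. bq0 (S z) = 0)"
      with real have "generically \<Omega> (\<lambda>z. S z = 0)" by eventually_elim (simp add: biquat_eq_iff)
      thus ?thesis using n0 by blast
    next
      assume "generically \<Omega> (\<lambda>z. bq0 (S z) \<noteq> 0)"
      with real have "generically \<Omega> (\<lambda>z. S z = 1)" by eventually_elim (auto simp: biquat_eq_iff)
      thus ?thesis using n1 by blast
    qed
  qed
  with coords show "generically \<Omega> (\<lambda>z. bq0 (S z) = 1 / 2 \<and> bnorm (bvec (S z)) = - 1 / 4)"
  proof eventually_elim
    case (elim z)
    hence h: "bq0 (S z) = 1 / 2" by (simp add: field_simps)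
    have "bnorm (bvec (S z)) = (bq0 (S z))\<^sup>2 - bq0 (S z)" using elim by algebra
    thus ?case unfolding h by (simp add: power2_eq_square)
  qed
qed

theorem idempotents_equivalent:
  assumes "sem_idempotent \<Omega> \<sigma>" "sem_idempotent \<Omega> \<tau>"
  shows "sem_equivalent \<Omega> \<sigma> \<tau>"
proof -
  obtain S where S: "represents \<Omega> \<sigma> S"
    using SEM_represents assms(1) unfolding sem_idempotent_def by blast
  obtain T where T: "represents \<Omega> \<tau> T"
    using SEM_represents assms(2) unfolding sem_idempotent_def by blast
  note s = idempotent_stem[OF S assms(1)] and t = idempotent_stem(1)[OF T assms(2)]
  show ?thesis
  proof (rule sem_equivalent_of_equal_norms[OF S T])
    show "generically \<Omega> (\<lambda>z. bq0 (S z) = bq0 (T z))" using s(1) t by eventually_elim metis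
    show "generically \<Omega> (\<lambda>z. bnorm (bvec (S z)) = bnorm (bvec (T z)))"
      using s(1) t by eventually_elim metis
    show "\<not> generically \<Omega> (\<lambda>z. bnorm (bvec (S z)) = 0)"
    proof
      assume "generically \<Omega> (\<lambda>z. bnorm (bvec (S z)) = 0)"
      with s(1) have "generically \<Omega> (\<lambda>z. False)" by eventually_elim simp
      thus False using s(2) by blast
    qed
  qed
qed

end

theorem proposition8p1:
  fixes \<Omega> :: "quat set"
  assumes "circular_domain \<Omega>"
  shows "(\<forall>f \<in> SEM \<Omega> - SEM_R \<Omega>.
            (\<exists>g \<in> SEM \<Omega> - SEM_R \<Omega>. one_slice_preserving \<Omega> g \<and> sem_equivalent \<Omega> f g) \<longleftrightarrow>
            (\<not> sem_eq \<Omega> (sem_symm \<Omega> (sem_vec_part \<Omega> f)) (\<lambda>_. 0) \<and>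
             (\<exists>r \<in> SEM_R \<Omega>. sem_eq \<Omega> (r \<star> r) (sem_symm \<Omega> (sem_vec_part \<Omega> f))))) \<and>
         (\<forall>\<sigma> \<in> SR \<Omega>. \<forall>\<tau> \<in> SR \<Omega>.
            sem_idempotent \<Omega> \<sigma> \<longrightarrow> sem_idempotent \<Omega> \<tau> \<longrightarrow> sem_equivalent \<Omega> \<sigma> \<tau>)"
  using equivalent_one_slice_preserving_iff[OF assms] idempotents_equivalent[OF assms] by blast

end
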